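(* Let $R(\lambda)=C(\lambda I_\ell-A)^{-1}B+\sum_{i=0}^d D_i\lambda^i$ be an $m\times n$ rational matrix, where $C(\lambda I_\ell-A)^{-1}B$ is a minimal state-space realization of the strictly proper part of $R(\lambda)$ and $D_d\neq 0$, let $S(\lambda)$ be a block Kronecker linearization of $R(\lambda)$ with parameters $(\epsilon,\eta)$, $\max(\epsilon,\eta)>0$, and let $f_1,f_2,f_3$ be the numbers defined in the context. Let $\widehat S(\lambda):=S(\lambda)+\Delta_S(\lambda)$, where $\Delta_S(\lambda)$ is an arbitrary pencil of the same size as $S(\lambda)$, and put $\delta:=\|\Delta_S(\lambda)\|_F/\|S(\lambda)\|_F$. If $\|\Delta_S(\lambda)\|_F$ is sufficiently small, then $\widehat S(\lambda)$ is strictly equivalent to a block Kronecker linearization $\widetilde S(\lambda)$, with the same parameters $\epsilon$ and $\eta$ as $S(\lambda)$, of a rational matrix $$\widetilde R(\lambda)=\widetilde C(\lambda I_\ell-\widetilde A)^{-1}\widetilde B+\sum_{i=0}^d\widetilde D_i\lambda^i,$$ where $\widetilde C(\lambda I_\ell-\widetilde A)^{-1}\widetilde B$ is a minimal state-space realization of the strictly proper part of $\widetilde R(\lambda)$. Moreover, if $\widetilde A=A+\Delta A$, $\widetilde B=B+\Delta B$, $\widetilde C=C+\Delta C$ and $\widetilde D_i=D_i+\Delta D_i$, $i=0,\ldots,d$, then $$\frac{\sqrt{\|\Delta A\|_F^2+\|\Delta B\|_F^2+\|\Delta C\|_F^2+\sum_{i=0}^d\|\Delta D_i\|_F^2}}{\|R(\lambda)\|_F}\le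 K_{S,R}\,\frac{\|\Delta_S(\lambda)\|_F}{\|S(\lambda)\|_F}+\mathcal O(\delta^2),$$ where $$K_{S,R}:=\sqrt{2\min(\epsilon+1,\eta+1)}\,(1+f_1\|S(\lambda)\|_2)(1+f_2\|S(\lambda)\|_2)(1+f_3\|S(\lambda)\|_2)\frac{\|S(\lambda)\|_F}{\|R(\lambda)\|_F}.$$
   Context: Let $\mathbb F$ be $\mathbb R$ or $\mathbb C$; all matrices have entries in $\mathbb F$; $m,n,\ell\ge1$ and $\epsilon,\eta\ge0$ are integers. For $k\ge0$ let $E_k=[\,I_k\ \ 0\,]$ and $F_k=[\,0\ \ I_k\,]$ (both $k\times(k+1)$), $L_k(\lambda):=E_k-\lambda F_k$, $\Lambda_k(\lambda):=[\lambda^k\ \cdots\ \lambda\ \ 1]^T$, and let $\mathbf e_k=[0\cdots0\ 1]^T\in\mathbb F^k$ be the last unit vector. Put $K_1(\lambda)=L_\epsilon(\lambda)\otimes I_n$, $\widehat K_1=\mathbf e_{\epsilon+1}^T\otimes I_n$, $K_2(\lambda)=L_\eta(\lambda)\otimes I_m$, $\widehat K_2=\mathbf e_{\eta+1}^T\otimes I_m$ ($K_1$, resp. $K_2$, is empty with zero rows if $\epsilon=0$, resp. $\eta=0$). A state-space triple $\{A,B,C\}$ ($A\in\mathbb F^{\ell\times\ell}$, $B\in\mathbb F^{\ell\times n}$, $C\in\mathbb F^{m\times\ell}$) is minimal if it is controllable and observable. A block Kronecker linearization with parameters $(\epsilon,\eta)$ of $R(\lambda)=C(\lambda I_\ell-A)^{-1}B+D(\lambda)$,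 where $\{A,B,C\}$ is minimal and $D(\lambda)=\sum_{i=0}^dD_i\lambda^i$ has degree $d=\epsilon+\eta+1$, is a pencil $$S(\lambda)=\begin{bmatrix}M(\lambda)&\widehat K_2^TC&K_2^T(\lambda)\\ B\widehat K_1&A-\lambda I_\ell&0\\ K_1(\lambda)&0&0\end{bmatrix},$$ where $M(\lambda)$ is an $(\eta+1)m\times(\epsilon+1)n$ pencil (matrix polynomial of degree at most 1) with $D(\lambda)=(\Lambda_\eta(\lambda)\otimes I_m)^TM(\lambda)(\Lambda_\epsilon(\lambda)\otimes I_n)$. Two pencils $P(\lambda),Q(\lambda)$ are strictly equivalent if $Q(\lambda)=UP(\lambda)V$ with constant invertible matrices $U,V$. Norms: for a pencil $S_a-\lambda S_b$, $\|S_a-\lambda S_b\|_F=(\|S_a\|_F^2+\|S_b\|_F^2)^{1/2}$ and $\|S_a-\lambda S_b\|_2=(\|S_a\|_2^2+\|S_b\|_2^2)^{1/2}$ (Frobenius and spectral norms of the coefficients). $\|R(\lambda)\|_F:=\sqrt{\ell+\|A\|_F^2+\|B\|_F^2+\|C\|_F^2+\sum_{i=0}^d\|D_i\|_F^2}$. Constants: $\alpha=1+2\epsilon\max(1,\|A\|_2^\epsilon)$, $\beta=1+2\eta\max(1,\|A\|_2^\eta)$, $\gamma=\frac{\epsilon+\eta}{2\sqrt2}$, $s=\max(\alpha,\beta,\gamma)+\gamma(\beta\|B\|_2+\alpha\|C\|_2)$, and $$f_1=\frac{4\sqrt2\,s}{2-\sqrt3},\quad f_2=\frac{\sqrt2\,(4\max(\epsilon,\eta)-1)}{3},\quad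 f_3=\sqrt2\,[1+2\max(\eta,\epsilon)\max(1,\|A\|_2^{\max(\eta,\epsilon)})].$$ Convention: $S(\lambda)$ (and $R(\lambda)$) is fixed; "if $\|\Delta_S\|_F$ is sufficiently small" together with the $\mathcal O(\delta^2)$ bound means that there are constants $\tau,K>0$ depending only on $S(\lambda)$ such that for every pencil $\Delta_S(\lambda)$ with $\|\Delta_S\|_F<\tau$ such an $\widetilde S(\lambda)$ exists for which the inequality holds with $\mathcal O(\delta^2)$ replaced by $K\delta^2$. *)

theory Defs
  imports
    "HOL-Analysis.Euclidean_Space"
    "HOL-Computational_Algebra.Normalized_Fraction"
    "Jordan_Normal_Form.Gauss_Jordan_Elimination"
    "Jordan_Normal_Form.DL_Rank"
begin

text \<open>
  The ground field is a type of sort real_normed_field and euclidean_space. The types real and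
  complex are instances, and by Frobenius' theorem (a finite-dimensional commutative real division
  algebra, here with a multiplicative norm) every instance is isometrically isomorphic to one
  of these two.

  A matrix polynomial is a matrix over polynomials; its indeterminate is the polynomial [:0, 1:].
\<close>

section \<open>Matrices\<close>

definition kronecker :: "'a::semiring_1 mat \<Rightarrow> 'a mat \<Rightarrow> 'a mat" (infixl \<open>\<otimes>\<^sub>k\<close> 72) where
  "X \<otimes>\<^sub>k Y = mat (dim_row X * dim_row Y) (dim_col X * dim_col Y)
     (\<lambda>(i, j). X $$ (i div dim_row Y, j div dim_col Y) * Y $$ (i mod dim_row Y, j mod dim_col Y))"

definition append_cols :: "'a::zero mat \<Rightarrow> 'a mat \<Rightarrow> 'a mat" (infixr \<open>@\<^sub>c\<close> 66) where
  "X @\<^sub>c Y = four_block_mat X Y (0\<^sub>m 0 (dim_col X)) (0\<^sub>m 0 (dim_col Y))"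

definition frobenius_norm :: "'a::real_normed_field mat \<Rightarrow> real" where
  "frobenius_norm X = sqrt (\<Sum>i<dim_row X. \<Sum>j<dim_col X. (norm (X $$ (i, j)))\<^sup>2)"

definition euclidean_vec_norm :: "'a::real_normed_field vec \<Rightarrow> real" where
  "euclidean_vec_norm v = sqrt (\<Sum>i<dim_vec v. (norm (v $ i))\<^sup>2)"

text \<open>The spectral norm is the matrix norm induced by the Euclidean norm.\<close>

definition spectral_norm :: "'a::real_normed_field mat \<Rightarrow> real" where
  "spectral_norm X =
     (SUP v\<in>{v \<in> carrier_vec (dim_col X). euclidean_vec_norm v \<le> 1}. euclidean_vec_norm (X *\<^sub>v v))"

section \<open>Pencils\<close>

definition const_poly_mat :: "'a::zero mat \<Rightarrow> 'a poly mat" where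
  "const_poly_mat = map_mat (\<lambda>a. [:a:])"

definition coeff_mat :: "'a::zero poly mat \<Rightarrow> nat \<Rightarrow> 'a mat" where
  "coeff_mat P k = map_mat (\<lambda>p. coeff p k) P"

definition pencil :: "nat \<Rightarrow> nat \<Rightarrow> 'a::zero poly mat \<Rightarrow> bool" where
  "pencil r c P \<longleftrightarrow> P \<in> carrier_mat r c \<and> (\<forall>i<r. \<forall>j<c. degree (P $$ (i, j)) \<le> 1)"

text \<open>
  For a pencil with coefficients \<open>S\<^sub>a\<close> and \<open>- S\<^sub>b\<close>; the sign of the second one is irrelevant
  for its norm.
\<close>

definition pencil_frobenius_norm :: "'a::real_normed_field poly mat \<Rightarrow> real" where
  "pencil_frobenius_norm P =
     sqrt ((frobenius_norm (coeff_mat P 0))\<^sup>2 + (frobenius_norm (coeff_mat P 1))\<^sup>2)"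

definition pencil_spectral_norm :: "'a::real_normed_field poly mat \<Rightarrow> real" where
  "pencil_spectral_norm P =
     sqrt ((spectral_norm (coeff_mat P 0))\<^sup>2 + (spectral_norm (coeff_mat P 1))\<^sup>2)"

definition strictly_equivalent :: "'a::field poly mat \<Rightarrow> 'a poly mat \<Rightarrow> bool" where
  "strictly_equivalent P Q \<longleftrightarrow>
     (\<exists>U V. U \<in> carrier_mat (dim_row P) (dim_row P) \<and> invertible_mat U \<and>
            V \<in> carrier_mat (dim_col P) (dim_col P) \<and> invertible_mat V \<and>
            Q = const_poly_mat U * P * const_poly_mat V)"

section \<open>State-space realizations\<close>

text \<open>\<open>[B  A B  \<dots>  A\<^sup>l\<^sup>-\<^sup>1 B]\<close> and, stacked by rows, \<open>C, C A, \<dots>, C A\<^sup>l\<^sup>-\<^sup>1\<close>, for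
  \<open>A\<close> of order \<open>l\<close>.\<close>

definition controllability_mat :: "'a::field mat \<Rightarrow> 'a mat \<Rightarrow> 'a mat" where
  "controllability_mat A B = mat (dim_row A) (dim_row A * dim_col B)
     (\<lambda>(i, j). (A ^\<^sub>m (j div dim_col B) * B) $$ (i, j mod dim_col B))"

definition observability_mat :: "'a::field mat \<Rightarrow> 'a mat \<Rightarrow> 'a mat" where
  "observability_mat A C = mat (dim_row A * dim_row C) (dim_row A)
     (\<lambda>(i, j). (C * A ^\<^sub>m (i div dim_row C)) $$ (i mod dim_row C, j))"

definition controllable :: "'a::field mat \<Rightarrow> 'a mat \<Rightarrow> bool" where
  "controllable A B \<longleftrightarrow> vec_space.rank (dim_row A) (controllability_mat A B) = dim_row A"

definition observable :: "'a::field mat \<Rightarrow> 'a mat \<Rightarrow> bool" where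
  "observable A C \<longleftrightarrow>
     vec_space.rank (dim_row A * dim_row C) (observability_mat A C) = dim_row A"

definition minimal_triple :: "'a::field mat \<Rightarrow> 'a mat \<Rightarrow> 'a mat \<Rightarrow> bool" where
  "minimal_triple A B C \<longleftrightarrow> controllable A B \<and> observable A C"

text \<open>\<open>C (\<lambda> I - A)\<^sup>-\<^sup>1 B\<close> over the field of rational functions, where \<open>\<lambda> I - A\<close> is always
  invertible, so that \<open>mat_inverse\<close> does not return \<open>None\<close>.\<close>

definition transfer_mat :: "'a::field mat \<Rightarrow> 'a mat \<Rightarrow> 'a mat \<Rightarrow> 'a poly fract mat" where
  "transfer_mat A B C =
     map_mat to_fract (const_poly_mat C) *
     the (mat_inverse (map_mat to_fract ([:0, 1:] \<cdot>\<^sub>m 1\<^sub>m (dim_row A) - const_poly_mat A))) *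
     map_mat to_fract (const_poly_mat B)"

definition matrix_poly :: "nat \<Rightarrow> nat \<Rightarrow> nat \<Rightarrow> (nat \<Rightarrow> 'a::comm_monoid_add mat) \<Rightarrow> 'a poly mat" where
  "matrix_poly m n d D = mat m n (\<lambda>(i, j). \<Sum>k\<le>d. monom (D k $$ (i, j)) k)"

text \<open>
  The \<open>m \<times> n\<close> rational matrix \<open>R\<close> has polynomial part of degree \<open>d\<close> with coefficients
  \<open>D\<^sub>0, \<dots>, D\<^sub>d\<close>, and \<open>{A, B, C}\<close> is a minimal realization of order \<open>l\<close> of its strictly proper
  part. (\<open>C (\<lambda> I - A)\<^sup>-\<^sup>1 B\<close> is strictly proper, hence it is the strictly proper part of \<open>R\<close>.)
  The values of \<open>D\<close> beyond \<open>d\<close> are irrelevant.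
\<close>

definition minimal_representation ::
  "nat \<Rightarrow> nat \<Rightarrow> nat \<Rightarrow> nat \<Rightarrow> 'a::field poly fract mat \<Rightarrow>
   'a mat \<Rightarrow> 'a mat \<Rightarrow> 'a mat \<Rightarrow> (nat \<Rightarrow> 'a mat) \<Rightarrow> bool" where
  "minimal_representation m n l d R A B C D \<longleftrightarrow>
     A \<in> carrier_mat l l \<and> B \<in> carrier_mat l n \<and> C \<in> carrier_mat m l \<and>
     (\<forall>i\<le>d. D i \<in> carrier_mat m n) \<and> D d \<noteq> 0\<^sub>m m n \<and>
     minimal_triple A B C \<and>
     R = transfer_mat A B C + map_mat to_fract (matrix_poly m n d D)"

text \<open>The quantity written \<open>\<parallel>R(\<lambda>)\<parallel>\<^sub>F\<close>; it depends on the chosen representation of \<open>R\<close>.\<close>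

definition representation_norm ::
  "nat \<Rightarrow> nat \<Rightarrow> 'a::real_normed_field mat \<Rightarrow> 'a mat \<Rightarrow> 'a mat \<Rightarrow> (nat \<Rightarrow> 'a mat) \<Rightarrow> real" where
  "representation_norm l d A B C D =
     sqrt (real l + (frobenius_norm A)\<^sup>2 + (frobenius_norm B)\<^sup>2 + (frobenius_norm C)\<^sup>2
           + (\<Sum>i\<le>d. (frobenius_norm (D i))\<^sup>2))"

section \<open>Block Kronecker linearizations\<close>

definition E_mat :: "nat \<Rightarrow> 'a::zero_neq_one mat" where
  "E_mat k = mat k (k + 1) (\<lambda>(i, j). if j = i then 1 else 0)"

definition F_mat :: "nat \<Rightarrow> 'a::zero_neq_one mat" where
  "F_mat k = mat k (k + 1) (\<lambda>(i, j). if j = i + 1 then 1 else 0)"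

definition L_pencil :: "nat \<Rightarrow> 'a::field poly mat" where
  "L_pencil k = const_poly_mat (E_mat k) - [:0, 1:] \<cdot>\<^sub>m const_poly_mat (F_mat k)"

definition Lambda_mat :: "nat \<Rightarrow> 'a::field poly mat" where
  "Lambda_mat k = mat (k + 1) 1 (\<lambda>(i, j). monom 1 (k - i))"

definition last_unit :: "nat \<Rightarrow> 'a::zero_neq_one mat" where
  "last_unit k = mat k 1 (\<lambda>(i, j). if i + 1 = k then 1 else 0)"

text \<open>\<open>K\<^sub>1(\<lambda>)\<close> is \<open>K_pencil \<epsilon> n\<close> and \<open>K\<^sub>2(\<lambda>)\<close> is \<open>K_pencil \<eta> m\<close>; likewise for the hatted
  matrices.\<close>

definition K_pencil :: "nat \<Rightarrow> nat \<Rightarrow> 'a::field poly mat" where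
  "K_pencil k r = L_pencil k \<otimes>\<^sub>k 1\<^sub>m r"

definition K_hat :: "nat \<Rightarrow> nat \<Rightarrow> 'a::field mat" where
  "K_hat k r = transpose_mat (last_unit (k + 1)) \<otimes>\<^sub>k 1\<^sub>m r"

definition block_kronecker_pencil ::
  "nat \<Rightarrow> nat \<Rightarrow> nat \<Rightarrow> nat \<Rightarrow> nat \<Rightarrow>
   'a::field mat \<Rightarrow> 'a mat \<Rightarrow> 'a mat \<Rightarrow> 'a poly mat \<Rightarrow> 'a poly mat" where
  "block_kronecker_pencil m n l \<epsilon> \<eta> A B C M =
     (M @\<^sub>c const_poly_mat (transpose_mat (K_hat \<eta> m) * C) @\<^sub>c transpose_mat (K_pencil \<eta> m))
     @\<^sub>r
     (const_poly_mat (B * K_hat \<epsilon> n) @\<^sub>c (const_poly_mat A - [:0, 1:] \<cdot>\<^sub>m 1\<^sub>m l) @\<^sub>c 0\<^sub>m l (\<eta> * m))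
     @\<^sub>r
     (K_pencil \<epsilon> n @\<^sub>c 0\<^sub>m (\<epsilon> * n) l @\<^sub>c 0\<^sub>m (\<epsilon> * n) (\<eta> * m))"

definition block_kronecker_linearization ::
  "nat \<Rightarrow> nat \<Rightarrow> nat \<Rightarrow> nat \<Rightarrow> nat \<Rightarrow> 'a::field poly fract mat \<Rightarrow>
   'a mat \<Rightarrow> 'a mat \<Rightarrow> 'a mat \<Rightarrow> (nat \<Rightarrow> 'a mat) \<Rightarrow> 'a poly mat \<Rightarrow> bool" where
  "block_kronecker_linearization m n l \<epsilon> \<eta> R A B C D S \<longleftrightarrow>
     minimal_representation m n l (\<epsilon> + \<eta> + 1) R A B C D \<and>
     (\<exists>M. pencil ((\<eta> + 1) * m) ((\<epsilon> + 1) * n) M \<and>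
          matrix_poly m n (\<epsilon> + \<eta> + 1) D =
            transpose_mat (Lambda_mat \<eta> \<otimes>\<^sub>k 1\<^sub>m m) * M * (Lambda_mat \<epsilon> \<otimes>\<^sub>k 1\<^sub>m n) \<and>
          S = block_kronecker_pencil m n l \<epsilon> \<eta> A B C M)"

section \<open>Constants of the perturbation bound\<close>

text \<open>The two constants \<open>\<alpha>\<close> and \<open>\<beta>\<close> are \<open>ab_const \<epsilon> A\<close> and \<open>ab_const \<eta> A\<close>.\<close>

definition ab_const :: "nat \<Rightarrow> 'a::real_normed_field mat \<Rightarrow> real" where
  "ab_const k A = 1 + 2 * real k * max 1 (spectral_norm A ^ k)"

definition gamma_const :: "nat \<Rightarrow> nat \<Rightarrow> real" where
  "gamma_const \<epsilon> \<eta> = real (\<epsilon> + \<eta>) / (2 * sqrt 2)"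

definition s_const ::
  "nat \<Rightarrow> nat \<Rightarrow> 'a::real_normed_field mat \<Rightarrow> 'a mat \<Rightarrow> 'a mat \<Rightarrow> real" where
  "s_const \<epsilon> \<eta> A B C =
     (let \<alpha> = ab_const \<epsilon> A; \<beta> = ab_const \<eta> A; \<gamma> = gamma_const \<epsilon> \<eta> in
      max \<alpha> (max \<beta> \<gamma>) + \<gamma> * (\<beta> * spectral_norm B + \<alpha> * spectral_norm C))"

definition f1_const ::
  "nat \<Rightarrow> nat \<Rightarrow> 'a::real_normed_field mat \<Rightarrow> 'a mat \<Rightarrow> 'a mat \<Rightarrow> real" where
  "f1_const \<epsilon> \<eta> A B C = 4 * sqrt 2 * s_const \<epsilon> \<eta> A B C / (2 - sqrt 3)"

definition f2_const :: "nat \<Rightarrow> nat \<Rightarrow> real" where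
  "f2_const \<epsilon> \<eta> = sqrt 2 * (4 * real (max \<epsilon> \<eta>) - 1) / 3"

definition f3_const :: "nat \<Rightarrow> nat \<Rightarrow> 'a::real_normed_field mat \<Rightarrow> real" where
  "f3_const \<epsilon> \<eta> A =
     sqrt 2 * (1 + 2 * real (max \<eta> \<epsilon>) * max 1 (spectral_norm A ^ max \<eta> \<epsilon>))"

definition K_SR ::
  "nat \<Rightarrow> nat \<Rightarrow> nat \<Rightarrow> 'a::real_normed_field mat \<Rightarrow> 'a mat \<Rightarrow> 'a mat \<Rightarrow>
   (nat \<Rightarrow> 'a mat) \<Rightarrow> 'a poly mat \<Rightarrow> real" where
  "K_SR l \<epsilon> \<eta> A B C D S =
     sqrt (2 * real (min (\<epsilon> + 1) (\<eta> + 1)))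
     * (1 + f1_const \<epsilon> \<eta> A B C * pencil_spectral_norm S)
     * (1 + f2_const \<epsilon> \<eta> * pencil_spectral_norm S)
     * (1 + f3_const \<epsilon> \<eta> A * pencil_spectral_norm S)
     * (pencil_frobenius_norm S / representation_norm l (\<epsilon> + \<eta> + 1) A B C D)"

end

theory Submission
  imports Defs
begin

text \<open>
  Write the linearization as \<open>S\<^sub>0 + \<lambda> S\<^sub>1\<close> and the perturbation as \<open>\<Delta>\<^sub>0 + \<lambda> \<Delta>\<^sub>1\<close>, of size \<open>\<delta>\<close>.
  A pair \<open>(T\<^sub>0, T\<^sub>1)\<close> is called structured if adding it to \<open>(S\<^sub>0, S\<^sub>1)\<close> alters only the free data
  \<open>A\<close>, \<open>B\<close>, \<open>C\<close>, \<open>M\<close> of the block Kronecker pencil. The theorem follows once constant matrices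
  \<open>X\<close>, \<open>Y\<close> of norm less than 1 are found with
  \<open>(I + X) (S\<^sub>i + \<Delta>\<^sub>i) (I + Y) = S\<^sub>i + T\<^sub>i\<close> for \<open>i = 0, 1\<close>, where \<open>(T\<^sub>0, T\<^sub>1)\<close> is structured and small.

  To first order this is the linear problem of writing a given pair as \<open>G\<^sub>i = X S\<^sub>i + S\<^sub>i Y + T\<^sub>i\<close>.
  The remainder \<open>G\<^sub>i - X S\<^sub>i - S\<^sub>i Y\<close> has to be structured, which is one pair of matrix equations for
  each block that is prescribed in \<open>S\<close>. They are solved in three stages, each of which keeps what the
  stages before it achieved: the blocks that are zero in \<open>S\<close> (\<open>eliminate_zero_blocks\<close>), the two Kronecker
  blocks and the leading coefficient of the state block (\<open>restore_kronecker_blocks\<close>), and the blocks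
  that contain \<open>B\<close> and \<open>C\<close> (\<open>restore_state_blocks\<close>). The coefficients of the Kronecker blocks are shift
  matrices; therefore eliminating one unknown from a pair of equations leaves a Stein equation
  \<open>Z = H + N Z A\<close> in which \<open>N\<close> or \<open>A\<close> is a nilpotent shift, and its solution is the finite sum of the
  \<open>N\<^sup>j H A\<^sup>j\<close>, with an explicit norm bound. If stage \<open>i\<close> has a solution of norm at most \<open>c\<^sub>i\<close> times
  the norm of its data, it multiplies the remainder by at most \<open>1 + c\<^sub>i \<parallel>S\<parallel>\<^sub>2\<close>. The product of these three
  factors is bounded by \<open>(1 + f\<^sub>1 \<parallel>S\<parallel>\<^sub>2) (1 + f\<^sub>2 \<parallel>S\<parallel>\<^sub>2) (1 + f\<^sub>3 \<parallel>S\<parallel>\<^sub>2)\<close>: the estimate of the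
  first factor leaves a factor 3 to spare, which the second one needs.

  The nonlinear problem is solved by a simplified Newton iteration (\<open>newton_iteration\<close>). After a correction step
  the error consists of products of the correction with quantities of order \<open>\<delta>\<close>, so that the errors
  decrease geometrically with a ratio of order \<open>\<delta>\<close>. The iterates converge, structured pairs form
  a closed set, and only the first step contributes to the linear term of the bound for \<open>(T\<^sub>0, T\<^sub>1)\<close>.

  It remains to read off the new data. Full row and column rank are equivalent to the
  existence of one-sided inverses, which persist under small perturbations; hence so does
  minimality (\<open>minimal_triple_open\<close>), and the leading coefficient of the polynomial part stays nonzero. The
  coefficients of the polynomial part are sums of blocks of the coefficients of \<open>M\<close> along antidiagonals. At
  most \<open>2 min (\<epsilon> + 1) (\<eta> + 1)\<close> blocks occur in one sum and every block occurs in one sum only, so that the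
  Cauchy-Schwarz inequality yields the remaining factor of the bound (\<open>antidiagonal_sums_norm\<close>).
\<close>

section \<open>Frobenius and spectral norms\<close>

lemma frobenius_norm_L2: "frobenius_norm X =
  L2_set (\<lambda>(i, j). norm (X $$ (i, j))) ({..<dim_row X} \<times> {..<dim_col X})"
  unfolding frobenius_norm_def L2_set_def by (simp add: sum.cartesian_product case_prod_unfold)

lemma euclidean_vec_norm_L2: "euclidean_vec_norm v = L2_set (\<lambda>i. norm (v $ i)) {..<dim_vec v}"
  unfolding euclidean_vec_norm_def L2_set_def by simp

lemma frobenius_norm_sq: "(frobenius_norm X)\<^sup>2 =
  (\<Sum>i<dim_row X. \<Sum>j<dim_col X. (norm (X $$ (i, j)))\<^sup>2)"
  unfolding frobenius_norm_def by (simp add: sum_nonneg)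

lemma frobenius_norm_sq_carrier:
  "X \<in> carrier_mat r c \<Longrightarrow> (frobenius_norm X)\<^sup>2 = (\<Sum>i<r. \<Sum>j<c. (norm (X $$ (i, j)))\<^sup>2)"
  by (auto simp: frobenius_norm_sq)

lemma frobenius_norm_nonneg [simp]: "0 \<le> frobenius_norm X"
  unfolding frobenius_norm_def by (simp add: sum_nonneg)

lemma euclidean_vec_norm_nonneg [simp]: "0 \<le> euclidean_vec_norm v"
  unfolding euclidean_vec_norm_def by (simp add: sum_nonneg)

lemma euclidean_vec_norm_sq: "(euclidean_vec_norm v)\<^sup>2 = (\<Sum>i<dim_vec v. (norm (v $ i))\<^sup>2)"
  unfolding euclidean_vec_norm_def by (simp add: sum_nonneg)

lemma frobenius_norm_zero [simp]: "frobenius_norm (0\<^sub>m r c :: 'a::real_normed_field mat) = 0"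
  unfolding frobenius_norm_def by simp

lemma frobenius_norm_transpose [simp]: "frobenius_norm (transpose_mat X) = frobenius_norm X"
  unfolding frobenius_norm_def by (simp add: sum.swap[of _ "{..<dim_row X}"])

lemma norm_entry_le_frobenius:
  assumes "i < dim_row X" "j < dim_col X"
  shows "norm (X $$ (i, j)) \<le> frobenius_norm X"
  using member_le_L2_set[of "{..<dim_row X} \<times> {..<dim_col X}" "(i,j)"
      "\<lambda>(i, j). norm (X $$ (i, j))"] assms
  by (simp add: frobenius_norm_L2)

lemma frobenius_norm_eq_0:
  assumes "X \<in> carrier_mat r c" "frobenius_norm X = 0"
  shows "X = 0\<^sub>m r c"
proof (intro eq_matI)
  fix i j assume "i < dim_row (0\<^sub>m r c :: 'a mat)" "j < dim_col (0\<^sub>m r c :: 'a mat)"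
  then show "X $$ (i, j) = 0\<^sub>m r c $$ (i, j)"
    using norm_entry_le_frobenius[of i X j] assms by auto
qed (use assms in auto)

lemma frobenius_norm_triangle:
  assumes "X \<in> carrier_mat r c" "Y \<in> carrier_mat r c"
  shows "frobenius_norm (X + Y) \<le> frobenius_norm X + frobenius_norm Y"
proof -
  let ?I = "{..<r} \<times> {..<c}"
  have "frobenius_norm (X + Y) = L2_set (\<lambda>(i, j). norm ((X + Y) $$ (i, j))) ?I"
    using assms by (simp add: frobenius_norm_L2)
  also have "\<dots> \<le> L2_set (\<lambda>p. norm (X $$ p) + norm (Y $$ p)) ?I"
    using assms by (intro L2_set_mono) (auto simp: norm_triangle_ineq)
  also have "\<dots> \<le> frobenius_norm X + frobenius_norm Y"
    using L2_set_triangle_ineq[of "\<lambda>p. norm (X $$ p)" "\<lambda>p. norm (Y $$ p)" ?I] assms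
    by (simp add: frobenius_norm_L2 case_prod_unfold)
  finally show ?thesis .
qed

lemma frobenius_norm_uminus [simp]: "frobenius_norm (- X) = frobenius_norm X"
  unfolding frobenius_norm_def by simp

lemma frobenius_norm_triangle_minus:
  assumes "X \<in> carrier_mat r c" "Y \<in> carrier_mat r c"
  shows "frobenius_norm (X - Y) \<le> frobenius_norm X + frobenius_norm Y"
  using frobenius_norm_triangle[of X r c "- Y"] assms by (simp add: minus_add_uminus_mat)

lemma frobenius_norm_minus_commute:
  assumes "X \<in> carrier_mat r c" "Y \<in> carrier_mat r c"
  shows "frobenius_norm (X - Y) = frobenius_norm (Y - X)"
  using assms unfolding frobenius_norm_def by (auto simp: norm_minus_commute)

lemma frobenius_norm_le_entries:
  assumes "X \<in> carrier_mat r c" "Y \<in> carrier_mat r c"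
    and "\<And>i j. i < r \<Longrightarrow> j < c \<Longrightarrow> norm (X $$ (i, j)) \<le> norm (Y $$ (i, j))"
  shows "frobenius_norm X \<le> frobenius_norm Y"
  unfolding frobenius_norm_def using assms
  by (auto intro!: sum_mono real_sqrt_le_mono power_mono)

text \<open>Used for a matrix \<open>Z\<close> whose entries are taken, up to sign, from \<open>X\<close> at some places and from \<open>Y\<close>
  at the others. The triangle inequality would lose a factor \<open>\<surd>2\<close>.\<close>

lemma frobenius_norm_disjoint:
  assumes X: "X \<in> carrier_mat r c" and Y: "Y \<in> carrier_mat r c" and Z: "Z \<in> carrier_mat r c"
    and "\<And>i j. i < r \<Longrightarrow> j < c \<Longrightarrow>
      (norm (Z $$ (i, j)))\<^sup>2 \<le> (norm (X $$ (i, j)))\<^sup>2 + (norm (Y $$ (i, j)))\<^sup>2"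
  shows "(frobenius_norm Z)\<^sup>2 \<le> (frobenius_norm X)\<^sup>2 + (frobenius_norm Y)\<^sup>2"
  unfolding frobenius_norm_sq_carrier[OF X] frobenius_norm_sq_carrier[OF Y]
    frobenius_norm_sq_carrier[OF Z] sum.distrib[symmetric]
  using assms(4) by (intro sum_mono) auto

lemma norm_scalar_prod_le:
  fixes v w :: "'a::real_normed_field vec"
  assumes "dim_vec v = dim_vec w"
  shows "norm (v \<bullet> w) \<le> euclidean_vec_norm v * euclidean_vec_norm w"
proof -
  have "norm (v \<bullet> w) \<le> (\<Sum>i<dim_vec w. \<bar>norm (v $ i)\<bar> * \<bar>norm (w $ i)\<bar>)"
    unfolding scalar_prod_def atLeast0LessThan
    by (rule order_trans[OF norm_sum]) (simp add: norm_mult)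
  also have "\<dots> \<le> euclidean_vec_norm v * euclidean_vec_norm w"
    unfolding euclidean_vec_norm_L2 assms by (rule L2_set_mult_ineq)
  finally show ?thesis .
qed

lemma euclidean_vec_norm_mult_frobenius:
  fixes X :: "'a::real_normed_field mat"
  assumes "v \<in> carrier_vec (dim_col X)"
  shows "euclidean_vec_norm (X *\<^sub>v v) \<le> frobenius_norm X * euclidean_vec_norm v"
proof (rule power2_le_imp_le)
  have "(euclidean_vec_norm (X *\<^sub>v v))\<^sup>2 = (\<Sum>i<dim_row X. (norm (row X i \<bullet> v))\<^sup>2)"
    by (simp add: euclidean_vec_norm_sq)
  also have "\<dots> \<le> (\<Sum>i<dim_row X. (euclidean_vec_norm (row X i))\<^sup>2 * (euclidean_vec_norm v)\<^sup>2)"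
    unfolding power_mult_distrib[symmetric] using assms
    by (intro sum_mono power_mono norm_scalar_prod_le) auto
  also have "\<dots> = (frobenius_norm X * euclidean_vec_norm v)\<^sup>2"
    by (simp add: euclidean_vec_norm_sq frobenius_norm_sq power_mult_distrib sum_distrib_right)
  finally show "(euclidean_vec_norm (X *\<^sub>v v))\<^sup>2 \<le> (frobenius_norm X * euclidean_vec_norm v)\<^sup>2" .
qed simp

lemma euclidean_vec_norm_smult:
  "euclidean_vec_norm (a \<cdot>\<^sub>v v) = norm a * euclidean_vec_norm v"
  by (rule power2_eq_imp_eq)
    (auto simp: euclidean_vec_norm_sq power_mult_distrib norm_mult sum_distrib_left)

lemma euclidean_vec_norm_eq_0: "euclidean_vec_norm v = 0 \<longleftrightarrow> v = 0\<^sub>v (dim_vec v)"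
  by (auto simp: euclidean_vec_norm_L2 L2_set_eq_0_iff vec_eq_iff)

lemma spectral_norm_bdd_above:
  fixes X :: "'a::real_normed_field mat"
  shows "bdd_above ((\<lambda>v. euclidean_vec_norm (X *\<^sub>v v)) `
    {v \<in> carrier_vec (dim_col X). euclidean_vec_norm v \<le> 1})"
proof (rule bdd_aboveI2)
  fix v :: "'a vec" assume v: "v \<in> {v \<in> carrier_vec (dim_col X). euclidean_vec_norm v \<le> 1}"
  then have "euclidean_vec_norm (X *\<^sub>v v) \<le> frobenius_norm X * euclidean_vec_norm v"
    by (intro euclidean_vec_norm_mult_frobenius) auto
  also have "\<dots> \<le> frobenius_norm X * 1"
    using v by (intro mult_left_mono) auto
  finally show "euclidean_vec_norm (X *\<^sub>v v) \<le> frobenius_norm X" by simp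
qed

lemma zero_vec_norm [simp]: "euclidean_vec_norm (0\<^sub>v n :: 'a::real_normed_field vec) = 0"
  by (simp add: euclidean_vec_norm_eq_0)

lemma spectral_norm_nonneg [simp]: "0 \<le> spectral_norm X"
proof -
  have "euclidean_vec_norm (X *\<^sub>v 0\<^sub>v (dim_col X)) \<le> spectral_norm X"
    unfolding spectral_norm_def by (intro cSUP_upper spectral_norm_bdd_above) auto
  then show ?thesis using euclidean_vec_norm_nonneg order_trans by blast
qed

lemma euclidean_vec_norm_mult_spectral:
  fixes X :: "'a::real_normed_field mat"
  assumes v: "v \<in> carrier_vec (dim_col X)"
  shows "euclidean_vec_norm (X *\<^sub>v v) \<le> spectral_norm X * euclidean_vec_norm v"
proof (cases "euclidean_vec_norm v = 0")
  case True
  then show ?thesis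
    using euclidean_vec_norm_mult_frobenius[OF v] by simp
next
  case False
  define a :: 'a where "a = of_real (inverse (euclidean_vec_norm v))"
  have a: "norm a = inverse (euclidean_vec_norm v)" unfolding a_def by (simp del: of_real_inverse)
  have "euclidean_vec_norm (X *\<^sub>v (a \<cdot>\<^sub>v v)) \<le> spectral_norm X"
    unfolding spectral_norm_def using v False a
    by (intro cSUP_upper spectral_norm_bdd_above) (auto simp: euclidean_vec_norm_smult)
  moreover have "X *\<^sub>v (a \<cdot>\<^sub>v v) = a \<cdot>\<^sub>v (X *\<^sub>v v)"
    using v by (intro mult_mat_vec[where nr = "dim_row X" and nc = "dim_col X"]) auto
  ultimately have "inverse (euclidean_vec_norm v) * euclidean_vec_norm (X *\<^sub>v v) \<le> spectral_norm X"
    by (simp add: euclidean_vec_norm_smult a)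
  then show ?thesis using False euclidean_vec_norm_nonneg[of v]
    by (simp add: field_simps)
qed

lemma spectral_norm_le:
  fixes X :: "'a::real_normed_field mat"
  assumes "0 \<le> b"
    and "\<And>v. v \<in> carrier_vec (dim_col X) \<Longrightarrow>
      euclidean_vec_norm (X *\<^sub>v v) \<le> b * euclidean_vec_norm v"
  shows "spectral_norm X \<le> b"
  unfolding spectral_norm_def
proof (rule cSUP_least)
  show "{v \<in> carrier_vec (dim_col X). euclidean_vec_norm (v :: 'a vec) \<le> 1} \<noteq> {}"
    by (auto intro!: exI[of _ "0\<^sub>v (dim_col X)"])
  fix v :: "'a vec" assume v: "v \<in> {v \<in> carrier_vec (dim_col X). euclidean_vec_norm v \<le> 1}"
  then show "euclidean_vec_norm (X *\<^sub>v v) \<le> b"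
    using assms(2)[of v] mult_left_mono[of "euclidean_vec_norm v" 1 b] assms(1) by auto
qed

lemma spectral_norm_le_frobenius: "spectral_norm X \<le> frobenius_norm X"
  by (intro spectral_norm_le euclidean_vec_norm_mult_frobenius) auto

lemma norm_entry_le_spectral:
  fixes X :: "'a::real_normed_field mat"
  assumes "i < dim_row X" "j < dim_col X"
  shows "norm (X $$ (i, j)) \<le> spectral_norm X"
proof -
  let ?e = "unit_vec (dim_col X) j :: 'a vec"
  have e: "euclidean_vec_norm ?e = 1"
    unfolding euclidean_vec_norm_def using assms
    by (simp add: unit_vec_def if_distrib[of norm] if_distrib[of "\<lambda>x. x\<^sup>2"] cong: if_cong)
  have "norm (X $$ (i, j)) = norm ((X *\<^sub>v ?e) $ i)"
    using assms by simp
  also have "\<dots> \<le> euclidean_vec_norm (X *\<^sub>v ?e)"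
    unfolding euclidean_vec_norm_L2 using assms by (intro member_le_L2_set) auto
  also have "\<dots> \<le> spectral_norm X"
    using euclidean_vec_norm_mult_spectral[of ?e X] e by simp
  finally show ?thesis .
qed

lemma frobenius_norm_sq_cols: "(frobenius_norm X)\<^sup>2 = (\<Sum>j<dim_col X. (euclidean_vec_norm (col X j))\<^sup>2)"
  unfolding frobenius_norm_sq euclidean_vec_norm_sq by (subst sum.swap) auto

lemma frobenius_norm_mult_spectral_left:
  fixes X Y :: "'a::real_normed_field mat"
  assumes "X \<in> carrier_mat r k" "Y \<in> carrier_mat k c"
  shows "frobenius_norm (X * Y) \<le> spectral_norm X * frobenius_norm Y"
proof (rule power2_le_imp_le)
  have "(frobenius_norm (X * Y))\<^sup>2 = (\<Sum>j<c. (euclidean_vec_norm (X *\<^sub>v col Y j))\<^sup>2)"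
    unfolding frobenius_norm_sq_cols using assms by (simp add: col_mult2[OF assms] del: col_mult)
  also have "\<dots> \<le> (\<Sum>j<c. (spectral_norm X * euclidean_vec_norm (col Y j))\<^sup>2)"
    using assms by (intro sum_mono power_mono euclidean_vec_norm_mult_spectral) auto
  also have "\<dots> = (spectral_norm X * frobenius_norm Y)\<^sup>2"
    using assms by (simp add: frobenius_norm_sq_cols power_mult_distrib sum_distrib_left)
  finally show "(frobenius_norm (X * Y))\<^sup>2 \<le> (spectral_norm X * frobenius_norm Y)\<^sup>2" .
qed simp

text \<open>By duality: the vector \<open>u = X\<^sup>T x\<close> is paired with its complex conjugate \<open>y\<close>, and \<open>\<parallel>u\<parallel>\<^sup>2 = u \<bullet> y = x \<bullet> X y\<close>
  is estimated by the Cauchy-Schwarz inequality. The ground field carries no conjugation as an operation;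
  the conjugate of \<open>u\<close> is \<open>\<bar>u\<bar>\<^sup>2 / u\<close>, with value 0 for \<open>u = 0\<close>.\<close>

lemma spectral_norm_transpose_le:
  fixes X :: "'a::real_normed_field mat"
  shows "spectral_norm (transpose_mat X) \<le> spectral_norm X"
proof (rule spectral_norm_le)
  fix x :: "'a vec" assume "x \<in> carrier_vec (dim_col (transpose_mat X))"
  then have x: "x \<in> carrier_vec (dim_row X)" by simp
  define u where "u = transpose_mat X *\<^sub>v x"
  define y where "y = vec (dim_col X) (\<lambda>i. of_real ((norm (u $ i))\<^sup>2) / u $ i)"
  have u: "u \<in> carrier_vec (dim_col X)" unfolding u_def by (simp add: carrier_vecI)
  have y: "y \<in> carrier_vec (dim_col X)" unfolding y_def by simp
  have ny: "norm (y $ i) = norm (u $ i)" if "i < dim_col X" for i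
    using that unfolding y_def by (simp add: norm_divide power2_eq_square norm_mult)
  have "euclidean_vec_norm y = euclidean_vec_norm u"
    unfolding euclidean_vec_norm_def using u y ny by auto
  have uy: "u \<bullet> y = of_real ((euclidean_vec_norm u)\<^sup>2)"
    unfolding scalar_prod_def euclidean_vec_norm_sq using u y
    by (auto simp: y_def atLeast0LessThan intro!: sum.cong)
  have "u \<bullet> y = x \<bullet> (X *\<^sub>v y)"
    unfolding u_def using transpose_vec_mult_scalar[of X "dim_row X" "dim_col X" y x] x y by auto
  then have "(euclidean_vec_norm u)\<^sup>2 = norm (x \<bullet> (X *\<^sub>v y))"
    using uy by (metis norm_of_real abs_of_nonneg zero_le_power2)
  also have "\<dots> \<le> euclidean_vec_norm x * euclidean_vec_norm (X *\<^sub>v y)"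
    using x by (intro norm_scalar_prod_le) auto
  also have "\<dots> \<le> euclidean_vec_norm x * (spectral_norm X * euclidean_vec_norm y)"
    using y by (intro mult_left_mono euclidean_vec_norm_mult_spectral) auto
  finally have *: "(euclidean_vec_norm u)\<^sup>2 \<le> spectral_norm X * euclidean_vec_norm x * euclidean_vec_norm u"
    using \<open>euclidean_vec_norm y = euclidean_vec_norm u\<close> by (simp add: mult_ac)
  show "euclidean_vec_norm (transpose_mat X *\<^sub>v x) \<le> spectral_norm X * euclidean_vec_norm x"
  proof (cases "euclidean_vec_norm u = 0")
    case True
    then show ?thesis by (simp add: u_def)
  next
    case False
    then show ?thesis using * euclidean_vec_norm_nonneg[of u]
      by (simp add: u_def[symmetric] power2_eq_square)
  qed
qed simp

lemma spectral_norm_transpose [simp]: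
  fixes X :: "'a::real_normed_field mat"
  shows "spectral_norm (transpose_mat X) = spectral_norm X"
  using spectral_norm_transpose_le[of X] spectral_norm_transpose_le[of "transpose_mat X"] by simp

lemma frobenius_norm_mult_spectral_right:
  fixes X Y :: "'a::real_normed_field mat"
  assumes "X \<in> carrier_mat r k" "Y \<in> carrier_mat k c"
  shows "frobenius_norm (X * Y) \<le> frobenius_norm X * spectral_norm Y"
  using frobenius_norm_mult_spectral_left[of "transpose_mat Y" c k "transpose_mat X" r] assms
  by (subst frobenius_norm_transpose[symmetric]) (simp add: transpose_mult mult.commute)

lemma frobenius_norm_mult:
  fixes X Y :: "'a::real_normed_field mat"
  assumes "X \<in> carrier_mat r k" "Y \<in> carrier_mat k c"
  shows "frobenius_norm (X * Y) \<le> frobenius_norm X * frobenius_norm Y"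
  using frobenius_norm_mult_spectral_left[OF assms] spectral_norm_le_frobenius[of X]
    mult_right_mono[of "spectral_norm X" "frobenius_norm X" "frobenius_norm Y"] by simp

section \<open>Shift matrices\<close>

definition shift_mat :: "nat \<Rightarrow> nat \<Rightarrow> nat \<Rightarrow> 'a::zero_neq_one mat" where
  "shift_mat p q d = mat p q (\<lambda>(i, j). if j = i + d then 1 else 0)"

lemma shift_mat_carrier [simp]: "shift_mat p q d \<in> carrier_mat p q"
  "dim_row (shift_mat p q d) = p" "dim_col (shift_mat p q d) = q"
  by (simp_all add: shift_mat_def)

text \<open>The index rules have only dimensions as premises, so that the simplifier can discharge them
  for products of any shape.\<close>

lemma shift_mult_index:
  fixes X :: "'a::semiring_1 mat"
  assumes "dim_row X = q" "i < p" "j < dim_col X"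
  shows "(shift_mat p q d * X) $$ (i, j) = (if i + d < q then X $$ (i + d, j) else 0)"
  using assms by (simp add: scalar_prod_def shift_mat_def if_distrib[of "\<lambda>x. x * _"] cong: if_cong)

lemma mult_shift_index:
  fixes X :: "'a::semiring_1 mat"
  assumes "dim_col X = p" "i < dim_row X" "j < q"
  shows "(X * shift_mat p q d) $$ (i, j) = (if d \<le> j \<and> j - d < p then X $$ (i, j - d) else 0)"
proof -
  have "(X * shift_mat p q d) $$ (i, j) = (\<Sum>k = 0..<p. if k = j - d \<and> d \<le> j then X $$ (i, k) else 0)"
    using assms by (auto simp: scalar_prod_def shift_mat_def intro!: sum.cong)
  also have "\<dots> = (if d \<le> j \<and> j - d < p then X $$ (i, j - d) else 0)"
    by (cases "d \<le> j") simp_all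
  finally show ?thesis .
qed

lemma shift_transpose_mult_index:
  fixes X :: "'a::comm_semiring_1 mat"
  assumes "dim_row X = p" "i < q" "j < dim_col X"
  shows "((shift_mat p q d)\<^sup>T * X) $$ (i, j) = (if d \<le> i \<and> i - d < p then X $$ (i - d, j) else 0)"
proof -
  have "(shift_mat p q d)\<^sup>T * X = (X\<^sup>T * shift_mat p q d)\<^sup>T"
    using assms by (subst transpose_mult[of _ "dim_col X" p _ q]) auto
  then show ?thesis using assms mult_shift_index[of "X\<^sup>T" p j i q d] by simp
qed

lemma mult_shift_transpose_index:
  fixes X :: "'a::comm_semiring_1 mat"
  assumes "dim_col X = q" "i < dim_row X" "j < p"
  shows "(X * (shift_mat p q d)\<^sup>T) $$ (i, j) = (if j + d < q then X $$ (i, j + d) else 0)"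
proof -
  have "X * (shift_mat p q d)\<^sup>T = (shift_mat p q d * X\<^sup>T)\<^sup>T"
    using assms by (subst transpose_mult[of _ p q _ "dim_row X"]) auto
  then show ?thesis using assms shift_mult_index[of "X\<^sup>T" q j p i d] by simp
qed

lemma spectral_norm_shift: "spectral_norm (shift_mat p q d :: 'a::real_normed_field mat) \<le> 1"
proof (rule spectral_norm_le)
  fix v :: "'a vec" assume "v \<in> carrier_vec (dim_col (shift_mat p q d :: 'a mat))"
  then have v: "v \<in> carrier_vec q" by simp
  let ?J = "shift_mat p q d :: 'a mat"
  have "(euclidean_vec_norm (?J *\<^sub>v v))\<^sup>2 = (\<Sum>i<p. if i + d < q then (norm (v $ (i + d)))\<^sup>2 else 0)"
    using v unfolding euclidean_vec_norm_sq
    by (auto simp: scalar_prod_def shift_mat_def if_distrib[of "\<lambda>x. x * _"] intro!: sum.cong cong: if_cong)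
  also have "\<dots> = (\<Sum>i\<in>{i. i < p \<and> i + d < q}. (norm (v $ (i + d)))\<^sup>2)"
    by (rule sum.mono_neutral_cong_right) auto
  also have "\<dots> = (\<Sum>i\<in>(\<lambda>i. i + d) ` {i. i < p \<and> i + d < q}. (norm (v $ i))\<^sup>2)"
    by (subst sum.reindex) (auto simp: inj_on_def)
  also have "\<dots> \<le> (euclidean_vec_norm v)\<^sup>2"
    unfolding euclidean_vec_norm_sq using v by (intro sum_mono2) auto
  finally show "euclidean_vec_norm (?J *\<^sub>v v) \<le> 1 * euclidean_vec_norm v"
    by (auto intro: power2_le_imp_le)
qed simp

lemma frobenius_norm_shift_left:
  fixes X :: "'a::real_normed_field mat"
  assumes "X \<in> carrier_mat q c"
  shows "frobenius_norm (shift_mat p q d * X) \<le> frobenius_norm X"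
  using frobenius_norm_mult_spectral_left[OF shift_mat_carrier(1)[of p q d] assms]
    mult_right_mono[OF spectral_norm_shift frobenius_norm_nonneg] order_trans by fastforce

lemma frobenius_norm_shift_right:
  fixes X :: "'a::real_normed_field mat"
  assumes "X \<in> carrier_mat r p"
  shows "frobenius_norm (X * shift_mat p q d) \<le> frobenius_norm X"
  using frobenius_norm_mult_spectral_right[OF assms shift_mat_carrier(1)[of p q d]]
    mult_left_mono[OF spectral_norm_shift frobenius_norm_nonneg] order_trans by fastforce

lemma frobenius_norm_shift_transpose_left:
  fixes X :: "'a::real_normed_field mat"
  assumes "X \<in> carrier_mat p c"
  shows "frobenius_norm ((shift_mat p q d)\<^sup>T * X) \<le> frobenius_norm X"
  using frobenius_norm_mult_spectral_left[of "(shift_mat p q d)\<^sup>T" q p X c] assms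
    mult_right_mono[OF spectral_norm_shift[of p q d] frobenius_norm_nonneg[of X]]
  by (auto intro: order_trans)

lemma frobenius_norm_shift_transpose_right:
  fixes X :: "'a::real_normed_field mat"
  assumes "X \<in> carrier_mat r q"
  shows "frobenius_norm (X * (shift_mat p q d)\<^sup>T) \<le> frobenius_norm X"
  using frobenius_norm_mult_spectral_right[of X r q "(shift_mat p q d)\<^sup>T" p] assms
    mult_left_mono[OF spectral_norm_shift[of p q d] frobenius_norm_nonneg[of X]]
  by (auto intro: order_trans)

section \<open>Stein equations with a nilpotent coefficient\<close>

text \<open>The truncated Neumann series of the map \<open>Z \<mapsto> N Z A\<close>, that is \<open>H + N H A + \<dots> + N\<^sup>k\<^sup>-\<^sup>1 H A\<^sup>k\<^sup>-\<^sup>1\<close>,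
  written in Horner form.\<close>

fun stein_sum :: "nat \<Rightarrow> 'a::semiring_1 mat \<Rightarrow> 'a mat \<Rightarrow> 'a mat \<Rightarrow> 'a mat" where
  "stein_sum 0 N H A = 0\<^sub>m (dim_row H) (dim_col H)"
| "stein_sum (Suc k) N H A = H + N * stein_sum k N H A * A"

lemma stein_sum_carrier [simp]:
  assumes "H \<in> carrier_mat r c" "N \<in> carrier_mat r r" "A \<in> carrier_mat c c"
  shows "stein_sum k N H A \<in> carrier_mat r c"
  using assms by (induction k) auto

lemma pow_mat_commute:
  fixes A :: "'a::semiring_1 mat"
  assumes A: "A \<in> carrier_mat q q"
  shows "A * A ^\<^sub>m k = A ^\<^sub>m k * A"
proof (induction k)
  case (Suc k)
  have "A * A ^\<^sub>m Suc k = (A * A ^\<^sub>m k) * A"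
    using A by (simp add: assoc_mult_mat[of _ q q _ q _ q])
  then show ?case using Suc by simp
qed (use A in simp)

lemma mult_sandwich:
  fixes N :: "'a::semiring_1 mat"
  assumes N: "N \<in> carrier_mat r r" and P: "P \<in> carrier_mat r r" and H: "H \<in> carrier_mat r c"
    and Q: "Q \<in> carrier_mat c c" and A: "A \<in> carrier_mat c c"
  shows "N * (P * H * Q) * A = N * P * H * (Q * A)"
proof -
  note PH = mult_carrier_mat[OF P H] and NP = mult_carrier_mat[OF N P]
  have "N * (P * H * Q) = N * P * H * Q"
    by (simp only: assoc_mult_mat[OF N PH Q, symmetric] assoc_mult_mat[OF N P H, symmetric])
  then show ?thesis
    by (simp only: assoc_mult_mat[OF mult_carrier_mat[OF NP H] Q A])
qed

lemma stein_sum_Suc: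
  fixes H :: "'a::comm_ring_1 mat"
  assumes H: "H \<in> carrier_mat r c" and N: "N \<in> carrier_mat r r" and A: "A \<in> carrier_mat c c"
  shows "stein_sum (Suc k) N H A = stein_sum k N H A + N ^\<^sub>m k * H * A ^\<^sub>m k"
proof (induction k)
  case 0
  then show ?case using assms by simp
next
  case (Suc k)
  let ?Z = "stein_sum k N H A" and ?P = "N ^\<^sub>m k * H * A ^\<^sub>m k"
  have Z: "?Z \<in> carrier_mat r c" using assms by simp
  have Nk: "N ^\<^sub>m k \<in> carrier_mat r r" and Ak: "A ^\<^sub>m k \<in> carrier_mat c c" using N A by simp_all
  then have P: "?P \<in> carrier_mat r c" using H by auto
  have comm: "N * N ^\<^sub>m k = N ^\<^sub>m k * N" using N by (rule pow_mat_commute)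
  have "N * ?P * A = N * N ^\<^sub>m k * H * (A ^\<^sub>m k * A)"
    by (rule mult_sandwich[OF N Nk H Ak A])
  then have NPA: "N * ?P * A = N ^\<^sub>m Suc k * H * A ^\<^sub>m Suc k"
    using comm by simp
  have "stein_sum (Suc (Suc k)) N H A = H + N * (?Z + ?P) * A"
    using Suc by simp
  also have "\<dots> = H + (N * ?Z * A + N * ?P * A)"
    using N A Z P by (simp add: mult_add_distrib_mat[of _ r r _ c] add_mult_distrib_mat[of _ r c _ _ c])
  also have "\<dots> = stein_sum (Suc k) N H A + N * ?P * A"
    by (simp only: stein_sum.simps)
      (rule assoc_add_mat[OF H mult_carrier_mat[OF mult_carrier_mat[OF N Z] A]
         mult_carrier_mat[OF mult_carrier_mat[OF N P] A], symmetric])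
  finally show ?case by (simp only: NPA)
qed

text \<open>The difference of two consecutive truncations is \<open>N\<^sup>k H A\<^sup>k\<close>, which vanishes as soon as one of the two
  coefficients has nilpotency index at most \<open>k\<close>; the truncation then solves the Stein equation.\<close>

lemma stein_sum_fixed:
  fixes H :: "'a::comm_ring_1 mat"
  assumes H: "H \<in> carrier_mat r c" and N: "N \<in> carrier_mat r r" and A: "A \<in> carrier_mat c c"
    and nil: "N ^\<^sub>m k = 0\<^sub>m r r \<or> A ^\<^sub>m k = 0\<^sub>m c c"
  shows "stein_sum k N H A = H + N * stein_sum k N H A * A"
proof -
  have "N ^\<^sub>m k * H * A ^\<^sub>m k = 0\<^sub>m r c"
    using nil
  proof
    assume "N ^\<^sub>m k = 0\<^sub>m r r"
    then show ?thesis using H A by (simp add: left_mult_zero_mat[of _ c c])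
  next
    assume "A ^\<^sub>m k = 0\<^sub>m c c"
    moreover have "N ^\<^sub>m k * H \<in> carrier_mat r c" using H N by (intro mult_carrier_mat[of _ r r] pow_carrier_mat)
    ultimately show ?thesis by (simp only: right_mult_zero_mat)
  qed
  then have "stein_sum (Suc k) N H A = stein_sum k N H A"
    using stein_sum_Suc[OF H N A, of k] stein_sum_carrier[OF H N A, of k] by simp
  then show ?thesis by simp
qed

lemma stein_sum_norm:
  fixes H :: "'a::real_normed_field mat"
  assumes H: "H \<in> carrier_mat r c" and N: "N \<in> carrier_mat r r" and A: "A \<in> carrier_mat c c"
  shows "frobenius_norm (stein_sum k N H A)
    \<le> (\<Sum>j<k. (spectral_norm N * spectral_norm A) ^ j) * frobenius_norm H"
proof (induction k)
  case (Suc k)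
  let ?Z = "stein_sum k N H A" and ?t = "spectral_norm N * spectral_norm A"
  have Z: "?Z \<in> carrier_mat r c" using assms by simp
  have "frobenius_norm (N * ?Z * A) \<le> frobenius_norm (N * ?Z) * spectral_norm A"
    using N Z A by (intro frobenius_norm_mult_spectral_right[of _ r c]) auto
  also have "\<dots> \<le> (spectral_norm N * frobenius_norm ?Z) * spectral_norm A"
    using N Z by (intro mult_right_mono frobenius_norm_mult_spectral_left) auto
  also have "\<dots> = ?t * frobenius_norm ?Z" by simp
  also have "\<dots> \<le> ?t * ((\<Sum>j<k. ?t ^ j) * frobenius_norm H)"
    by (intro mult_left_mono Suc) simp
  finally have *: "frobenius_norm (N * ?Z * A) \<le> ?t * ((\<Sum>j<k. ?t ^ j) * frobenius_norm H)" .
  have "frobenius_norm (stein_sum (Suc k) N H A) \<le> frobenius_norm H + ?t * ((\<Sum>j<k. ?t ^ j) * frobenius_norm H)"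
    unfolding stein_sum.simps
    using * mult_carrier_mat[OF mult_carrier_mat[OF N Z] A]
    by (meson frobenius_norm_triangle[OF H] add_left_mono order_trans)
  also have "\<dots> = (\<Sum>j<Suc k. ?t ^ j) * frobenius_norm H"
    by (subst sum.lessThan_Suc_shift) (simp add: sum_distrib_left algebra_simps)
  finally show ?case .
qed simp

lemma stein_sum_norm_contraction:
  fixes H :: "'a::real_normed_field mat"
  assumes "H \<in> carrier_mat r c" "N \<in> carrier_mat r r" "A \<in> carrier_mat c c"
    and "spectral_norm N \<le> 1" "spectral_norm A \<le> 1"
  shows "frobenius_norm (stein_sum k N H A) \<le> real k * frobenius_norm H"
proof -
  have "(\<Sum>j<k. (spectral_norm N * spectral_norm A) ^ j) \<le> (\<Sum>j<k. 1)"
    using assms by (intro sum_mono power_le_one mult_le_one) auto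
  then show ?thesis
    using stein_sum_norm[OF assms(1-3), of k] mult_right_mono[OF _ frobenius_norm_nonneg[of H]]
    by fastforce
qed

lemma shift_mat_power: "shift_mat q q d ^\<^sub>m k = (shift_mat q q (k * d) :: 'a::comm_ring_1 mat)"
proof (induction k)
  case 0
  show ?case by (rule eq_matI) (auto simp: shift_mat_def)
next
  case (Suc k)
  have "shift_mat q q (k * d) * shift_mat q q d = (shift_mat q q (d + k * d) :: 'a mat)"
    by (rule eq_matI) (auto simp: mult_shift_index simp del: index_mult_mat(1), auto simp: shift_mat_def)
  then show ?case using Suc by simp
qed

lemma transpose_power:
  fixes A :: "'a::comm_ring_1 mat"
  assumes "A \<in> carrier_mat q q"
  shows "A\<^sup>T ^\<^sub>m k = (A ^\<^sub>m k)\<^sup>T"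
proof (induction k)
  case (Suc k)
  have "(A ^\<^sub>m Suc k)\<^sup>T = (A * A ^\<^sub>m k)\<^sup>T"
    using pow_mat_commute[OF assms] by simp
  then show ?case using Suc assms by (simp add: transpose_mult[of _ q q _ q])
qed (use assms in simp)

lemma shift_mat_nilpotent:
  "(shift_mat (k * r) (k * r) r :: 'a::comm_ring_1 mat) ^\<^sub>m k = 0\<^sub>m (k * r) (k * r)"
  "(shift_mat (k * r) (k * r) r :: 'a mat)\<^sup>T ^\<^sub>m k = 0\<^sub>m (k * r) (k * r)"
  by (auto simp: shift_mat_power transpose_power[OF shift_mat_carrier(1)]) (auto simp: shift_mat_def)

section \<open>Sylvester equations for Kronecker blocks\<close>

text \<open>The Frobenius norm of the pencil with coefficients \<open>G\<close> and \<open>H\<close>, whatever the signs of the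
  coefficients.\<close>

definition pair_norm :: "'a::real_normed_field mat \<Rightarrow> 'a mat \<Rightarrow> real" where
  "pair_norm G H = sqrt ((frobenius_norm G)\<^sup>2 + (frobenius_norm H)\<^sup>2)"

lemma pair_norm_nonneg [simp]: "0 \<le> pair_norm G H"
  by (simp add: pair_norm_def)

lemma pair_norm_ge: "frobenius_norm G \<le> pair_norm G H" "frobenius_norm H \<le> pair_norm G H"
  by (simp_all add: pair_norm_def real_le_rsqrt)

lemma pair_norm_transpose [simp]: "pair_norm (G\<^sup>T) (H\<^sup>T) = pair_norm G H"
  by (simp add: pair_norm_def)

lemma pair_norm_sum: "frobenius_norm G + frobenius_norm H \<le> sqrt 2 * pair_norm G H"
proof (rule power2_le_imp_le)
  show "(frobenius_norm G + frobenius_norm H)\<^sup>2 \<le> (sqrt 2 * pair_norm G H)\<^sup>2"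
    using sum_squares_bound[of "frobenius_norm G" "frobenius_norm H"]
    by (simp add: pair_norm_def power_mult_distrib power2_sum)
qed simp

lemma pair_norm_triangle:
  assumes "G0 \<in> carrier_mat r c" "H0 \<in> carrier_mat r c" "G1 \<in> carrier_mat r c" "H1 \<in> carrier_mat r c"
  shows "pair_norm (G0 + H0) (G1 + H1) \<le> pair_norm G0 G1 + pair_norm H0 H1"
proof -
  have "pair_norm (G0 + H0) (G1 + H1) \<le>
    sqrt ((frobenius_norm G0 + frobenius_norm H0)\<^sup>2 + (frobenius_norm G1 + frobenius_norm H1)\<^sup>2)"
    unfolding pair_norm_def using assms
    by (intro real_sqrt_le_mono add_mono power_mono frobenius_norm_triangle) auto
  also have "\<dots> \<le> pair_norm G0 G1 + pair_norm H0 H1"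
    unfolding pair_norm_def by (rule real_sqrt_sum_squares_triangle_ineq)
  finally show ?thesis .
qed

lemma pair_norm_triangle_minus:
  assumes "G0 \<in> carrier_mat r c" "H0 \<in> carrier_mat r c" "G1 \<in> carrier_mat r c" "H1 \<in> carrier_mat r c"
  shows "pair_norm (G0 - H0) (G1 - H1) \<le> pair_norm G0 G1 + pair_norm H0 H1"
proof -
  have "pair_norm (G0 - H0) (G1 - H1) \<le>
    sqrt ((frobenius_norm G0 + frobenius_norm H0)\<^sup>2 + (frobenius_norm G1 + frobenius_norm H1)\<^sup>2)"
    unfolding pair_norm_def using assms
    by (intro real_sqrt_le_mono add_mono power_mono frobenius_norm_triangle_minus) auto
  also have "\<dots> \<le> pair_norm G0 G1 + pair_norm H0 H1"
    unfolding pair_norm_def by (rule real_sqrt_sum_squares_triangle_ineq)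
  finally show ?thesis .
qed

text \<open>The coefficients of the Kronecker block are \<open>E\<^sub>k \<otimes> I\<^sub>r\<close> and \<open>- F\<^sub>k \<otimes> I\<^sub>r\<close>. As \<open>I\<^sub>r\<close> has ones at the places
  \<open>(i, i)\<close> only, \<open>E\<^sub>k \<otimes> I\<^sub>r\<close> and \<open>F\<^sub>k \<otimes> I\<^sub>r\<close> have their ones at the places \<open>(i, i)\<close> and \<open>(i, i + r)\<close>,
  and the hatted matrix \<open>e\<^sup>T \<otimes> I\<^sub>r\<close> has them at \<open>(i, i + k r)\<close>: all three are shift matrices.\<close>

definition K_low :: "nat \<Rightarrow> nat \<Rightarrow> 'a::zero_neq_one mat" where
  "K_low k r = shift_mat (k * r) ((k + 1) * r) 0"

definition K_high :: "nat \<Rightarrow> nat \<Rightarrow> 'a::zero_neq_one mat" where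
  "K_high k r = shift_mat (k * r) ((k + 1) * r) r"

definition K_last :: "nat \<Rightarrow> nat \<Rightarrow> 'a::zero_neq_one mat" where
  "K_last k r = shift_mat r ((k + 1) * r) (k * r)"

lemma K_carrier [simp]:
  "K_low k r \<in> carrier_mat (k * r) ((k + 1) * r)" "K_high k r \<in> carrier_mat (k * r) ((k + 1) * r)"
  "K_last k r \<in> carrier_mat r ((k + 1) * r)"
  "dim_row (K_low k r) = k * r" "dim_row (K_high k r) = k * r" "dim_row (K_last k r) = r"
  "dim_col (K_low k r) = (k + 1) * r" "dim_col (K_high k r) = (k + 1) * r" "dim_col (K_last k r) = (k + 1) * r"
  by (simp_all only: K_low_def K_high_def K_last_def shift_mat_carrier)

lemmas shift_index = shift_mult_index mult_shift_index shift_transpose_mult_index mult_shift_transpose_index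

text \<open>With \<open>X = [V 0]\<close> and \<open>Y\<close> the matrix \<open>Z\<close> below a zero block row, the two equations become
  \<open>V + N Z = W\<^sub>0\<close> and \<open>V M + Z = W\<^sub>1\<close>, where \<open>N\<close> and \<open>M\<close> are the nilpotent transposed shifts by one block.
  Eliminating \<open>Z\<close> leaves the Stein equation \<open>V = (W\<^sub>0 - N W\<^sub>1) + N V M\<close>. Since \<open>N\<^sup>e = 0\<close> and
  \<open>M\<^sup>h = 0\<close>, the smaller of \<open>e\<close> and \<open>h\<close> bounds the number of terms.\<close>

lemma solve_two_kronecker_blocks:
  fixes W0 W1 :: "'a::real_normed_field mat"
  assumes W0: "W0 \<in> carrier_mat (e * n) (h * m)" and W1: "W1 \<in> carrier_mat (e * n) (h * m)"
  obtains X Y where "X \<in> carrier_mat (e * n) ((h + 1) * m)" "Y \<in> carrier_mat ((e + 1) * n) (h * m)"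
    "X * (K_low h m)\<^sup>T + K_low e n * Y = W0" "X * (K_high h m)\<^sup>T + K_high e n * Y = W1"
    "frobenius_norm X \<le> sqrt 2 * real (min e h) * pair_norm W0 W1"
    "frobenius_norm Y \<le> pair_norm W0 W1 + sqrt 2 * real (min e h) * pair_norm W0 W1"
proof -
  let ?k = "min e h"
  let ?N = "(shift_mat (e * n) (e * n) n)\<^sup>T :: 'a mat" and ?M = "(shift_mat (h * m) (h * m) m)\<^sup>T :: 'a mat"
  define H where "H = W0 - ?N * W1"
  define V where "V = stein_sum ?k ?N H ?M"
  define Z where "Z = W1 - V * ?M"
  define X where "X = V * K_low h m"
  define Y where "Y = (K_high e n)\<^sup>T * Z"
  have H: "H \<in> carrier_mat (e * n) (h * m)" unfolding H_def using W1 by (simp add: minus_carrier_mat mult_carrier_mat[of _ _ "e * n"])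
  have V: "V \<in> carrier_mat (e * n) (h * m)" unfolding V_def using H by (intro stein_sum_carrier) auto
  have Z: "Z \<in> carrier_mat (e * n) (h * m)" unfolding Z_def using V by (simp add: minus_carrier_mat mult_carrier_mat[of _ _ "h * m"])
  have X: "X \<in> carrier_mat (e * n) ((h + 1) * m)" unfolding X_def using V by (rule mult_carrier_mat) (rule K_carrier)
  have Y: "Y \<in> carrier_mat ((e + 1) * n) (h * m)" unfolding Y_def
    using Z by (intro mult_carrier_mat[of _ _ "e * n"]) (simp_all only: transpose_carrier_mat K_carrier)
  \<comment> \<open>The shift with the smaller number of blocks is the one whose power vanishes.\<close>
  have "?N ^\<^sub>m ?k = 0\<^sub>m (e * n) (e * n) \<or> ?M ^\<^sub>m ?k = 0\<^sub>m (h * m) (h * m)"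
    by (cases "e \<le> h") (simp_all add: shift_mat_nilpotent min_def)
  then have fixed: "V = H + ?N * V * ?M"
    unfolding V_def using H by (intro stein_sum_fixed) auto
  have Zi: "Z $$ (i, j) = W1 $$ (i, j) - (if j + m < h * m then V $$ (i, j + m) else 0)"
    if "i < e * n" "j < h * m" for i j
    using that V W1 unfolding Z_def by (simp add: shift_index del: index_mult_mat(1))
  have Vi: "V $$ (i, j) = W0 $$ (i, j) - (if n \<le> i then Z $$ (i - n, j) else 0)"
    if "i < e * n" "j < h * m" for i j
  proof -
    have NV: "?N * V \<in> carrier_mat (e * n) (h * m)" using V by (simp add: mult_carrier_mat[of _ _ "e * n"])
    have "V $$ (i, j) = (H + ?N * V * ?M) $$ (i, j)" using fixed by simp
    also have "\<dots> = H $$ (i, j) + (?N * V * ?M) $$ (i, j)"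
      using that H V by simp
    also have "\<dots> = W0 $$ (i, j) - (if n \<le> i then Z $$ (i - n, j) else 0)"
      using that W0 W1 V NV Zi[of "i - n" j]
      by (auto simp: H_def shift_index mult_carrier_mat[of _ _ "e * n"] simp del: index_mult_mat(1))
    finally show ?thesis .
  qed
  have Xi: "X $$ (i, j) = (if j < h * m then V $$ (i, j) else 0)" if "i < e * n" "j < (h + 1) * m" for i j
    using that V unfolding X_def K_low_def by (simp add: shift_index del: index_mult_mat(1))
  have Yi: "Y $$ (i, j) = (if n \<le> i \<and> i - n < e * n then Z $$ (i - n, j) else 0)" if "i < (e + 1) * n" "j < h * m" for i j
    using that Z unfolding Y_def K_high_def by (simp add: shift_index del: index_mult_mat(1))
  have 1: "X * (K_low h m)\<^sup>T + K_low e n * Y = W0"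
  proof (rule eq_matI)
    fix i j assume "i < dim_row W0" "j < dim_col W0"
    then have ij: "i < e * n" "j < h * m" using W0 by auto
    then show "(X * (K_low h m)\<^sup>T + K_low e n * Y) $$ (i, j) = W0 $$ (i, j)"
      using X Y Xi[of i j] Yi[of i j] Vi[of i j] Zi[of i j]
      by (auto simp: K_low_def shift_index simp del: index_mult_mat(1))
  qed (use W0 X Y in auto)
  have 2: "X * (K_high h m)\<^sup>T + K_high e n * Y = W1"
  proof (rule eq_matI)
    fix i j assume "i < dim_row W1" "j < dim_col W1"
    then have ij: "i < e * n" "j < h * m" using W1 by auto
    then show "(X * (K_high h m)\<^sup>T + K_high e n * Y) $$ (i, j) = W1 $$ (i, j)"
      using X Y Xi[of i "j + m"] Yi[of "i + n" j] Zi[of i j]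
      by (auto simp: K_high_def shift_index simp del: index_mult_mat(1))
  qed (use W1 X Y in auto)
  have "frobenius_norm H \<le> frobenius_norm W0 + frobenius_norm W1"
    unfolding H_def
    using frobenius_norm_triangle_minus[of W0 "e * n" "h * m" "?N * W1"] W0 W1
      mult_carrier_mat[of ?N "e * n" "e * n" W1 "h * m"]
      frobenius_norm_shift_transpose_left[of W1 "e * n" "h * m" "e * n" n] by simp
  then have nH: "frobenius_norm H \<le> sqrt 2 * pair_norm W0 W1"
    using pair_norm_sum[of W0 W1] by linarith
  have "frobenius_norm V \<le> real ?k * frobenius_norm H"
    unfolding V_def using H by (intro stein_sum_norm_contraction) (auto simp: spectral_norm_shift)
  also have "\<dots> \<le> real ?k * (sqrt 2 * pair_norm W0 W1)"
    using nH by (intro mult_left_mono) auto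
  finally have nV: "frobenius_norm V \<le> sqrt 2 * real ?k * pair_norm W0 W1" by (simp add: mult_ac)
  have nX: "frobenius_norm X \<le> sqrt 2 * real ?k * pair_norm W0 W1"
    unfolding X_def K_low_def using frobenius_norm_shift_right[OF V] nV by (meson order_trans)
  have "frobenius_norm Y \<le> frobenius_norm Z"
    unfolding Y_def K_high_def using Z by (rule frobenius_norm_shift_transpose_left)
  also have "\<dots> \<le> frobenius_norm W1 + frobenius_norm V"
    unfolding Z_def
    using frobenius_norm_triangle_minus[of W1 "e * n" "h * m" "V * ?M"] V W1
      mult_carrier_mat[of V "e * n" "h * m" ?M "h * m"]
      frobenius_norm_shift_transpose_right[of V "e * n" "h * m" "h * m" m] by simp
  finally have nY: "frobenius_norm Y \<le> pair_norm W0 W1 + sqrt 2 * real ?k * pair_norm W0 W1"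
    using nV pair_norm_ge(2)[of W1 W0] by linarith
  show thesis using that[OF X Y 1 2 nX nY] .
qed

lemma power_le_max_one_power:
  fixes a :: real
  assumes "0 \<le> a" "j \<le> k"
  shows "a ^ j \<le> max 1 (a ^ k)"
proof (cases "a \<le> 1")
  case True
  then show ?thesis using assms power_le_one[of a j] by linarith
next
  case False
  then show ?thesis using assms power_increasing[of j k a] by linarith
qed

text \<open>The powers of \<open>a\<close> that occur have exponents between 0 and \<open>k\<close>, since the factor \<open>a\<close> in the bound for
  \<open>H\<close> raises the exponents of the second part by one. Hence a single maximum of 1 and \<open>a\<^sup>k\<close> covers both
  parts, with \<open>k\<close> summands.\<close>

lemma stein_sum_norm_power:
  fixes G0 :: "'a::real_normed_field mat"
  assumes H: "H \<in> carrier_mat r c" and N: "N \<in> carrier_mat r r" and A: "A \<in> carrier_mat c c"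
    and a: "spectral_norm N * spectral_norm A \<le> a"
    and h: "frobenius_norm H \<le> g + a * g'" "0 \<le> g" "0 \<le> g'"
  shows "frobenius_norm (stein_sum k N H A) \<le> real k * max 1 (a ^ k) * (g + g')"
proof -
  have a0: "0 \<le> a" using a order_trans[OF mult_nonneg_nonneg[OF spectral_norm_nonneg spectral_norm_nonneg]] by blast
  have s: "(\<Sum>j<k. (spectral_norm N * spectral_norm A) ^ j) \<le> (\<Sum>j<k. a ^ j)"
    using a by (intro sum_mono power_mono) auto
  have "frobenius_norm (stein_sum k N H A) \<le> (\<Sum>j<k. a ^ j) * frobenius_norm H"
    using stein_sum_norm[OF H N A, of k] mult_right_mono[OF s frobenius_norm_nonneg[of H]] by linarith
  also have "\<dots> \<le> (\<Sum>j<k. a ^ j) * (g + a * g')"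
    using h a0 by (intro mult_left_mono sum_nonneg) auto
  also have "\<dots> = (\<Sum>j<k. a ^ j * g + a ^ Suc j * g')"
    by (simp add: sum_distrib_right sum_distrib_left sum.distrib algebra_simps)
  also have "\<dots> \<le> (\<Sum>j<k. max 1 (a ^ k) * g + max 1 (a ^ k) * g')"
    using h a0 by (intro sum_mono add_mono mult_right_mono power_le_max_one_power) auto
  also have "\<dots> = real k * max 1 (a ^ k) * (g + g')"
    by (simp add: algebra_simps)
  finally show ?thesis .
qed

lemma minus_add_minus_add_cancel:
  fixes P :: "'a::ring mat"
  assumes "P \<in> carrier_mat r c" "Q \<in> carrier_mat r c" "G \<in> carrier_mat r c"
  shows "P - Q + (G - P + Q) = G"
  by (rule eq_matI) (use assms in auto)

text \<open>Taking the last block row of \<open>Y\<close> to be zero, with \<open>Z\<close> above it, gives \<open>X A + Z = G\<^sub>0\<close> and \<open>X + N Z = G\<^sub>1\<close>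
  with a nilpotent shift \<open>N\<close>; eliminating \<open>X\<close> leaves \<open>Z = (G\<^sub>0 - G\<^sub>1 A) + N Z A\<close>.\<close>

lemma solve_kronecker_state_block:
  fixes G0 G1 A :: "'a::real_normed_field mat"
  assumes G0: "G0 \<in> carrier_mat (k * r) l" and G1: "G1 \<in> carrier_mat (k * r) l"
    and A: "A \<in> carrier_mat l l"
  defines "b \<equiv> real k * max 1 (spectral_norm A ^ k) * (frobenius_norm G0 + frobenius_norm G1)"
  obtains X Y where "X \<in> carrier_mat (k * r) l" "Y \<in> carrier_mat ((k + 1) * r) l"
    "X * A + K_low k r * Y = G0" "X + K_high k r * Y = G1"
    "frobenius_norm X \<le> frobenius_norm G1 + b" "frobenius_norm Y \<le> b"
proof -
  let ?N = "shift_mat (k * r) (k * r) r :: 'a mat"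
  define H where "H = G0 - G1 * A"
  define Z where "Z = stein_sum k ?N H A"
  define Y where "Y = (K_low k r)\<^sup>T * Z"
  define X where "X = G1 - ?N * Z"
  have H: "H \<in> carrier_mat (k * r) l" unfolding H_def using G1 A by (simp add: minus_carrier_mat mult_carrier_mat[of _ _ l])
  have Z: "Z \<in> carrier_mat (k * r) l" unfolding Z_def using H A by (intro stein_sum_carrier) auto
  have NZ: "?N * Z \<in> carrier_mat (k * r) l" using Z by (intro mult_carrier_mat) auto
  have X: "X \<in> carrier_mat (k * r) l" unfolding X_def using NZ by (rule minus_carrier_mat)
  have Y: "Y \<in> carrier_mat ((k + 1) * r) l" unfolding Y_def
    using Z by (intro mult_carrier_mat[of _ _ "k * r"]) (simp_all only: transpose_carrier_mat K_carrier)
  have fixed: "Z = H + ?N * Z * A"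
    unfolding Z_def using H A by (intro stein_sum_fixed) (auto simp: shift_mat_nilpotent)
  have Yi: "Y $$ (i, j) = (if i < k * r then Z $$ (i, j) else 0)" if "i < (k + 1) * r" "j < l" for i j
    using that Z unfolding Y_def K_low_def by (simp add: shift_index del: index_mult_mat(1))
  have EY: "K_low k r * Y = Z"
    by (rule eq_matI) (use Y Yi Z in \<open>auto simp: K_low_def shift_index simp del: index_mult_mat(1)\<close>)
  have FY: "K_high k r * Y = ?N * Z"
    by (rule eq_matI) (use Y Yi Z in \<open>auto simp: K_high_def shift_index simp del: index_mult_mat(1)\<close>)
  have GA: "G1 * A \<in> carrier_mat (k * r) l" and NZA: "?N * Z * A \<in> carrier_mat (k * r) l"
    using G1 NZ A by (auto intro: mult_carrier_mat)
  have "X * A + Z = (G1 * A - ?N * Z * A) + (G0 - G1 * A + ?N * Z * A)"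
    unfolding X_def using fixed minus_mult_distrib_mat[OF G1 NZ A] H_def by simp
  also have "\<dots> = G0"
    by (rule minus_add_minus_add_cancel[OF GA NZA G0])
  finally have 1: "X * A + K_low k r * Y = G0" by (simp only: EY)
  have 2: "X + K_high k r * Y = G1"
    unfolding FY X_def by (rule eq_matI) (use G1 NZ in auto)
  have nH: "frobenius_norm H \<le> frobenius_norm G0 + spectral_norm A * frobenius_norm G1"
    unfolding H_def using frobenius_norm_triangle_minus[OF G0 GA]
      frobenius_norm_mult_spectral_right[OF G1 A] by (simp add: mult.commute)
  have "spectral_norm ?N * spectral_norm A \<le> spectral_norm A"
    using mult_right_mono[OF spectral_norm_shift spectral_norm_nonneg] by fastforce
  then have nZ: "frobenius_norm Z \<le> b"
    unfolding Z_def b_def using H A nH by (intro stein_sum_norm_power[of _ "k * r" l]) auto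
  then have nY: "frobenius_norm Y \<le> b"
    unfolding Y_def K_low_def using frobenius_norm_shift_transpose_left[OF Z] by (meson order_trans)
  have nX: "frobenius_norm X \<le> frobenius_norm G1 + b"
    unfolding X_def using frobenius_norm_triangle_minus[OF G1 NZ] nZ
      frobenius_norm_shift_left[OF Z, of "k * r" r] by linarith
  show thesis using that[OF X Y 1 2 nX nY] .
qed

lemma solve_state_kronecker_block:
  fixes G0 G1 A :: "'a::real_normed_field mat"
  assumes G0: "G0 \<in> carrier_mat l (k * r)" and G1: "G1 \<in> carrier_mat l (k * r)"
    and A: "A \<in> carrier_mat l l"
  defines "b \<equiv> real k * max 1 (spectral_norm A ^ k) * (frobenius_norm G0 + frobenius_norm G1)"
  obtains X Y where "X \<in> carrier_mat l ((k + 1) * r)" "Y \<in> carrier_mat l (k * r)"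
    "X * (K_low k r)\<^sup>T + A * Y = G0" "X * (K_high k r)\<^sup>T + Y = G1"
    "frobenius_norm X \<le> b" "frobenius_norm Y \<le> frobenius_norm G1 + b"
proof -
  obtain X Y where X: "X \<in> carrier_mat (k * r) l" and Y: "Y \<in> carrier_mat ((k + 1) * r) l"
    and 1: "X * A\<^sup>T + K_low k r * Y = G0\<^sup>T" and 2: "X + K_high k r * Y = G1\<^sup>T"
    and nX: "frobenius_norm X \<le> frobenius_norm G1 + b" and nY: "frobenius_norm Y \<le> b"
    using solve_kronecker_state_block[of "G0\<^sup>T" k r l "G1\<^sup>T" "A\<^sup>T"] assms by (auto simp: b_def)
  have KY: "K_low k r * Y \<in> carrier_mat (k * r) l" "K_high k r * Y \<in> carrier_mat (k * r) l"
    by (rule mult_carrier_mat[OF K_carrier(1) Y], rule mult_carrier_mat[OF K_carrier(2) Y])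
  have XA: "X * A\<^sup>T \<in> carrier_mat (k * r) l" using X A by auto
  have "G0 = (X * A\<^sup>T)\<^sup>T + (K_low k r * Y)\<^sup>T"
    using 1 G0 transpose_add[OF XA KY(1)] by (metis transpose_transpose)
  also have "\<dots> = A * X\<^sup>T + Y\<^sup>T * (K_low k r)\<^sup>T"
    using X A transpose_mult[OF X, of "A\<^sup>T" l] transpose_mult[OF K_carrier(1) Y] by simp
  also have "\<dots> = Y\<^sup>T * (K_low k r)\<^sup>T + A * X\<^sup>T"
    by (rule comm_add_mat[of _ l "k * r"]) (use X Y A in auto)
  finally have 1: "Y\<^sup>T * (K_low k r)\<^sup>T + A * X\<^sup>T = G0" by simp
  have "G1 = X\<^sup>T + (K_high k r * Y)\<^sup>T"
    using 2 G1 transpose_add[OF X KY(2)] by (metis transpose_transpose)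
  also have "\<dots> = X\<^sup>T + Y\<^sup>T * (K_high k r)\<^sup>T"
    using transpose_mult[OF K_carrier(2) Y] by simp
  also have "\<dots> = Y\<^sup>T * (K_high k r)\<^sup>T + X\<^sup>T"
    by (rule comm_add_mat[of _ l "k * r"]) (use X Y in auto)
  finally have 2: "Y\<^sup>T * (K_high k r)\<^sup>T + X\<^sup>T = G1" by simp
  show thesis
    by (rule that[of "Y\<^sup>T" "X\<^sup>T"]) (use X Y 1 2 nX nY in auto)
qed

text \<open>Combines bounds for two parts with disjoint supports into a bound for the whole without
  increasing the constant.\<close>

lemma sqrt_sum_squares_le:
  fixes a b t :: real
  assumes "a\<^sup>2 \<le> x\<^sup>2 + y\<^sup>2" "x \<le> t * u" "y \<le> t * v" "0 \<le> x" "0 \<le> y" "0 \<le> t" "u\<^sup>2 + v\<^sup>2 \<le> w\<^sup>2" "0 \<le> w"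
  shows "a \<le> t * w"
proof (rule power2_le_imp_le)
  have "x\<^sup>2 \<le> (t * u)\<^sup>2" "y\<^sup>2 \<le> (t * v)\<^sup>2" using assms by (auto intro: power_mono)
  then have "a\<^sup>2 \<le> t\<^sup>2 * (u\<^sup>2 + v\<^sup>2)" using assms(1) by (simp add: power_mult_distrib distrib_left)
  also have "\<dots> \<le> t\<^sup>2 * w\<^sup>2" using assms by (intro mult_left_mono) auto
  finally show "a\<^sup>2 \<le> (t * w)\<^sup>2" by (simp add: power_mult_distrib)
qed (use assms in auto)

text \<open>The matrix \<open>Y0\<close> takes its first \<open>k\<close> block rows from \<open>G0\<close> and the last one from \<open>G1\<close>. It solves the first
  equation with \<open>X = 0\<close> and leaves the error \<open>H\<close> in the second one. A correction \<open>(X, Y1)\<close> has to satisfy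
  \<open>X E + E Y1 = 0\<close> and \<open>X F + F Y1 = H\<close>; at position \<open>(i, j)\<close> this says that adding \<open>X\<close> shifted to the
  right by one block to \<open>Y1\<close> shifted up by one block gives \<open>H\<close>, while \<open>Y1\<close> is \<open>- X\<close> in the first \<open>k\<close>
  block rows and columns. The resulting recursion runs along diagonals and decouples into the entries on
  and above the diagonal, where it is followed towards the bottom right end of a diagonal (\<open>T\<close>), and those
  below it, where it is followed towards the top left end (\<open>Q\<close>). Both are Stein equations. Splitting
  \<open>H = H1 + H2\<close> accordingly keeps the supports disjoint, so that no constant is lost in the norms.\<close>

lemma solve_row_kronecker_block:
  fixes G0 G1 :: "'a::real_normed_field mat"
  assumes G0: "G0 \<in> carrier_mat (k * r) ((k + 1) * r)" and G1: "G1 \<in> carrier_mat (k * r) ((k + 1) * r)"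
  obtains X Y where "X \<in> carrier_mat (k * r) (k * r)" "Y \<in> carrier_mat ((k + 1) * r) ((k + 1) * r)"
    "X * K_low k r + K_low k r * Y = G0" "X * K_high k r + K_high k r * Y = G1"
    "frobenius_norm X \<le> sqrt 2 * real k * pair_norm G0 G1"
    "frobenius_norm Y \<le> pair_norm G0 G1 + sqrt 2 * real k * pair_norm G0 G1"
proof -
  let ?q = "k * r"
  define p where "p = (k + 1) * r"
  have p: "p = ?q + r" by (simp add: p_def)
  note G = G0[folded p_def] G1[folded p_def]
  have Kc: "(K_low k r :: 'a mat) \<in> carrier_mat ?q p" "(K_high k r :: 'a mat) \<in> carrier_mat ?q p"
    unfolding p_def by (simp_all only: K_carrier)
  let ?U = "shift_mat ?q ?q r :: 'a mat" and ?J = "shift_mat p p r :: 'a mat"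
  define Y0 where "Y0 = mat p p (\<lambda>(i, j). if i < ?q then G0 $$ (i, j) else if r \<le> i then G1 $$ (i - r, j) else 0)"
  define H where "H = mat ?q p (\<lambda>(i, j). if i + r < ?q then G1 $$ (i, j) - G0 $$ (i + r, j) else 0)"
  define H1 where "H1 = mat ?q p (\<lambda>(i, j). if i + r \<le> j then H $$ (i, j) else 0)"
  define H2 where "H2 = mat ?q p (\<lambda>(i, j). if i + r \<le> j then 0 else H $$ (i, j))"
  define T where "T = stein_sum k ?U H1 (?J\<^sup>T)"
  define Q where "Q = stein_sum k (?U\<^sup>T) H2 ?J"
  define X where "X = mat ?q ?q (\<lambda>(i, j). if i \<le> j then T $$ (i, j + r)
     else if r \<le> i then - Q $$ (i - r, j) else 0)"
  define Y1 where "Y1 = mat p p (\<lambda>(i, j). if i \<le> j then (if i < ?q \<and> j + r < p then - T $$ (i, j + r) else 0)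
     else if r \<le> i then Q $$ (i - r, j) else 0)"
  have c: "Y0 \<in> carrier_mat p p" "H \<in> carrier_mat ?q p" "H1 \<in> carrier_mat ?q p" "H2 \<in> carrier_mat ?q p"
    "X \<in> carrier_mat ?q ?q" "Y1 \<in> carrier_mat p p"
    by (simp_all add: Y0_def H_def H1_def H2_def X_def Y1_def)
  have T: "T \<in> carrier_mat ?q p" unfolding T_def using c by (intro stein_sum_carrier) auto
  have Q: "Q \<in> carrier_mat ?q p" unfolding Q_def using c by (intro stein_sum_carrier) auto
  have "T = H1 + ?U * T * ?J\<^sup>T"
    unfolding T_def using c by (intro stein_sum_fixed) (auto simp: shift_mat_nilpotent)
  then have Ti: "T $$ (i, j) = H1 $$ (i, j) + (if i + r < ?q \<and> j + r < p then T $$ (i + r, j + r) else 0)"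
    if "i < ?q" "j < p" for i j
  proof -
    assume *: "T = H1 + ?U * T * ?J\<^sup>T"
    have "T $$ (i, j) = (H1 + ?U * T * ?J\<^sup>T) $$ (i, j)" using * by simp
    then show ?thesis using that T c by (simp add: shift_index del: index_mult_mat(1))
  qed
  have "Q = H2 + ?U\<^sup>T * Q * ?J"
    unfolding Q_def using c by (intro stein_sum_fixed) (auto simp: shift_mat_nilpotent)
  then have Qi: "Q $$ (i, j) = H2 $$ (i, j) + (if r \<le> i \<and> r \<le> j then Q $$ (i - r, j - r) else 0)"
    if "i < ?q" "j < p" for i j
  proof -
    assume *: "Q = H2 + ?U\<^sup>T * Q * ?J"
    have "Q $$ (i, j) = (H2 + ?U\<^sup>T * Q * ?J) $$ (i, j)" using * by simp
    then show ?thesis using that Q c by (auto simp: shift_index simp del: index_mult_mat(1))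
  qed
  let ?Y = "Y0 + Y1"
  have Y: "?Y \<in> carrier_mat p p" using c by simp
  have 1: "X * K_low k r + K_low k r * ?Y = G0"
  proof (rule eq_matI)
    fix i j assume "i < dim_row G0" "j < dim_col G0"
    then have ij: "i < ?q" "j < p" using G by auto
    have "(X * K_low k r) $$ (i, j) = (if j < ?q then X $$ (i, j) else 0)"
      using ij c unfolding K_low_def p_def[symmetric] by (simp add: shift_index del: index_mult_mat(1))
    moreover have "(K_low k r * ?Y) $$ (i, j) = ?Y $$ (i, j)"
      using ij c p unfolding K_low_def p_def[symmetric] by (simp add: shift_index del: index_mult_mat(1))
    moreover have "(if j < ?q then X $$ (i, j) else 0) + ?Y $$ (i, j) = G0 $$ (i, j)"
      using ij p by (auto simp: X_def Y0_def Y1_def)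
    ultimately show "(X * K_low k r + K_low k r * ?Y) $$ (i, j) = G0 $$ (i, j)"
      using ij c Kc by simp
  qed (use G Kc c in auto)
  have 2: "X * K_high k r + K_high k r * ?Y = G1"
  proof (rule eq_matI)
    fix i j assume "i < dim_row G1" "j < dim_col G1"
    then have ij: "i < ?q" "j < p" using G by auto
    have "(X * K_high k r) $$ (i, j) = (if r \<le> j then X $$ (i, j - r) else 0)"
      using ij c p unfolding K_high_def p_def[symmetric] by (auto simp: shift_index simp del: index_mult_mat(1))
    moreover have "(K_high k r * ?Y) $$ (i, j) = ?Y $$ (i + r, j)"
      using ij c p unfolding K_high_def p_def[symmetric] by (simp add: shift_index del: index_mult_mat(1))
    moreover have "Y0 $$ (i + r, j) = G1 $$ (i, j) - H $$ (i, j)"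
      using ij p by (auto simp: Y0_def H_def)
    moreover have "(if r \<le> j then X $$ (i, j - r) else 0) = H $$ (i, j) - Y1 $$ (i + r, j)"
    proof (cases "i + r \<le> j")
      case True
      then have "X $$ (i, j - r) = T $$ (i, j)" using ij p by (auto simp: X_def)
      moreover have "Y1 $$ (i + r, j) = - (if i + r < ?q \<and> j + r < p then T $$ (i + r, j + r) else 0)"
        using True ij p by (auto simp: Y1_def)
      moreover have "H1 $$ (i, j) = H $$ (i, j)" using True ij by (simp add: H1_def)
      ultimately show ?thesis using True Ti[OF ij] by simp
    next
      case False
      then have "(if r \<le> j then X $$ (i, j - r) else 0) = - (if r \<le> i \<and> r \<le> j then Q $$ (i - r, j - r) else 0)"
        using ij p by (auto simp: X_def)
      moreover have "Y1 $$ (i + r, j) = Q $$ (i, j)"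
        using False ij p by (auto simp: Y1_def)
      moreover have "H2 $$ (i, j) = H $$ (i, j)" using False ij by (simp add: H2_def)
      ultimately show ?thesis using Qi[OF ij] by simp
    qed
    ultimately show "(X * K_high k r + K_high k r * ?Y) $$ (i, j) = G1 $$ (i, j)"
      using ij c Kc p by (simp del: index_mult_mat(1))
  qed (use G Kc c in auto)
  have UG: "?U * G0 \<in> carrier_mat ?q p" using G by (intro mult_carrier_mat) auto
  have "frobenius_norm H \<le> frobenius_norm (G1 - ?U * G0)"
    using c UG G by (intro frobenius_norm_le_entries[of _ ?q p])
      (auto simp: H_def shift_index minus_carrier_mat simp del: index_mult_mat(1))
  also have "\<dots> \<le> frobenius_norm G1 + frobenius_norm G0"
    using frobenius_norm_triangle_minus[OF G(2) UG] frobenius_norm_shift_left[OF G(1), of ?q r] by linarith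
  finally have nH: "frobenius_norm H \<le> sqrt 2 * pair_norm G0 G1"
    using pair_norm_sum[of G0 G1] by linarith
  have H12: "(frobenius_norm H1)\<^sup>2 + (frobenius_norm H2)\<^sup>2 \<le> (frobenius_norm H)\<^sup>2"
    unfolding frobenius_norm_sq_carrier[OF c(2)] frobenius_norm_sq_carrier[OF c(3)]
      frobenius_norm_sq_carrier[OF c(4)] sum.distrib[symmetric]
    by (intro sum_mono) (auto simp: H1_def H2_def)
  have nT: "frobenius_norm T \<le> real k * frobenius_norm H1"
    unfolding T_def using c by (intro stein_sum_norm_contraction) (auto simp: spectral_norm_shift)
  have nQ: "frobenius_norm Q \<le> real k * frobenius_norm H2"
    unfolding Q_def using c by (intro stein_sum_norm_contraction) (auto simp: spectral_norm_shift)
  \<comment> \<open>Shifted copies of \<open>T\<close> and \<open>Q\<close>, of no larger norm, from which the entries of \<open>X\<close> and \<open>Y1\<close> are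
    taken.\<close>
  let ?TX = "T * (K_high k r)\<^sup>T" and ?QX = "?U\<^sup>T * Q * (K_low k r)\<^sup>T"
  let ?TY = "(K_low k r)\<^sup>T * (T * ?J\<^sup>T)" and ?QY = "(K_high k r)\<^sup>T * Q"
  have UQ: "?U\<^sup>T * Q \<in> carrier_mat ?q p" and TJ: "T * ?J\<^sup>T \<in> carrier_mat ?q p"
    using T Q by (auto intro: mult_carrier_mat)
  have cX: "?TX \<in> carrier_mat ?q ?q" "?QX \<in> carrier_mat ?q ?q" "?TY \<in> carrier_mat p p" "?QY \<in> carrier_mat p p"
    using T Q Kc UQ TJ by auto
  have nTX: "frobenius_norm ?TX \<le> frobenius_norm T" "frobenius_norm ?TY \<le> frobenius_norm T"
    unfolding K_high_def K_low_def p_def[symmetric]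
    using frobenius_norm_shift_transpose_right[OF T]
      order_trans[OF frobenius_norm_shift_transpose_left[OF TJ] frobenius_norm_shift_transpose_right[OF T]]
    by auto
  have nQX: "frobenius_norm ?QX \<le> frobenius_norm Q" "frobenius_norm ?QY \<le> frobenius_norm Q"
    unfolding K_high_def K_low_def p_def[symmetric]
    using order_trans[OF frobenius_norm_shift_transpose_right[OF UQ] frobenius_norm_shift_transpose_left[OF Q]]
      frobenius_norm_shift_transpose_left[OF Q]
    by auto
  have "(frobenius_norm X)\<^sup>2 \<le> (frobenius_norm ?TX)\<^sup>2 + (frobenius_norm ?QX)\<^sup>2"
  proof (rule frobenius_norm_disjoint[OF cX(1,2) c(5)])
    fix i j assume ij: "i < ?q" "j < ?q"
    have "?TX $$ (i, j) = T $$ (i, j + r)"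
      using ij T p unfolding K_high_def p_def[symmetric] by (simp add: shift_index del: index_mult_mat(1))
    moreover have "?QX $$ (i, j) = (if r \<le> i then Q $$ (i - r, j) else 0)"
      using ij Q p unfolding K_low_def p_def[symmetric] by (auto simp: shift_index simp del: index_mult_mat(1))
    ultimately show "(norm (X $$ (i, j)))\<^sup>2 \<le> (norm (?TX $$ (i, j)))\<^sup>2 + (norm (?QX $$ (i, j)))\<^sup>2"
      using ij by (auto simp: X_def)
  qed
  then have "frobenius_norm X \<le> real k * frobenius_norm H"
    by (rule sqrt_sum_squares_le) (use nTX(1) nQX(1) nT nQ H12 in auto)
  then have nX: "frobenius_norm X \<le> sqrt 2 * real k * pair_norm G0 G1"
    using mult_left_mono[OF nH, of "real k"] by (simp add: mult_ac)
  have "(frobenius_norm Y1)\<^sup>2 \<le> (frobenius_norm ?TY)\<^sup>2 + (frobenius_norm ?QY)\<^sup>2"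
  proof (rule frobenius_norm_disjoint[OF cX(3,4) c(6)])
    fix i j assume ij: "i < p" "j < p"
    have "?TY $$ (i, j) = (if i < ?q \<and> j + r < p then T $$ (i, j + r) else 0)"
      using ij T p unfolding K_low_def p_def[symmetric] by (simp add: shift_index del: index_mult_mat(1))
    moreover have "?QY $$ (i, j) = (if r \<le> i then Q $$ (i - r, j) else 0)"
      using ij Q p unfolding K_high_def p_def[symmetric] by (auto simp: shift_index simp del: index_mult_mat(1))
    ultimately show "(norm (Y1 $$ (i, j)))\<^sup>2 \<le> (norm (?TY $$ (i, j)))\<^sup>2 + (norm (?QY $$ (i, j)))\<^sup>2"
      using ij by (auto simp: Y1_def)
  qed
  then have "frobenius_norm Y1 \<le> real k * frobenius_norm H"
    by (rule sqrt_sum_squares_le) (use nTX(2) nQX(2) nT nQ H12 in auto)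
  then have nY1: "frobenius_norm Y1 \<le> sqrt 2 * real k * pair_norm G0 G1"
    using mult_left_mono[OF nH, of "real k"] by (simp add: mult_ac)
  \<comment> \<open>In the same way \<open>Y0\<close> takes its entries from shifted copies of \<open>G0\<close> and \<open>G1\<close>.\<close>
  let ?A0 = "(K_low k r)\<^sup>T * G0" and ?A1 = "(K_high k r)\<^sup>T * G1"
  have cA: "?A0 \<in> carrier_mat p p" "?A1 \<in> carrier_mat p p" using G Kc by auto
  have "(frobenius_norm Y0)\<^sup>2 \<le> (frobenius_norm ?A0)\<^sup>2 + (frobenius_norm ?A1)\<^sup>2"
  proof (rule frobenius_norm_disjoint[OF cA c(1)])
    fix i j assume ij: "i < p" "j < p"
    have "?A0 $$ (i, j) = (if i < ?q then G0 $$ (i, j) else 0)"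
      using ij G p unfolding K_low_def p_def[symmetric] by (simp add: shift_index del: index_mult_mat(1))
    moreover have "?A1 $$ (i, j) = (if r \<le> i then G1 $$ (i - r, j) else 0)"
      using ij G p unfolding K_high_def p_def[symmetric] by (auto simp: shift_index simp del: index_mult_mat(1))
    ultimately show "(norm (Y0 $$ (i, j)))\<^sup>2 \<le> (norm (?A0 $$ (i, j)))\<^sup>2 + (norm (?A1 $$ (i, j)))\<^sup>2"
      using ij by (auto simp: Y0_def)
  qed
  moreover have "frobenius_norm ?A0 \<le> frobenius_norm G0" "frobenius_norm ?A1 \<le> frobenius_norm G1"
    unfolding K_low_def K_high_def p_def[symmetric]
    by (auto intro: frobenius_norm_shift_transpose_left G)
  ultimately have nY0: "frobenius_norm Y0 \<le> 1 * pair_norm G0 G1"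
    by (elim sqrt_sum_squares_le[where u = "frobenius_norm G0" and v = "frobenius_norm G1"])
      (auto simp: pair_norm_def)
  have nY: "frobenius_norm ?Y \<le> pair_norm G0 G1 + sqrt 2 * real k * pair_norm G0 G1"
    using frobenius_norm_triangle[OF c(1,6)] nY0 nY1 by linarith
  show thesis using that[OF c(5) Y[unfolded p_def] 1 2 nX nY] .
qed

lemma solve_column_kronecker_block:
  fixes G0 G1 :: "'a::real_normed_field mat"
  assumes G0: "G0 \<in> carrier_mat ((k + 1) * r) (k * r)" and G1: "G1 \<in> carrier_mat ((k + 1) * r) (k * r)"
  obtains X Y where "X \<in> carrier_mat ((k + 1) * r) ((k + 1) * r)" "Y \<in> carrier_mat (k * r) (k * r)"
    "X * (K_low k r)\<^sup>T + (K_low k r)\<^sup>T * Y = G0" "X * (K_high k r)\<^sup>T + (K_high k r)\<^sup>T * Y = G1"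
    "frobenius_norm X \<le> pair_norm G0 G1 + sqrt 2 * real k * pair_norm G0 G1"
    "frobenius_norm Y \<le> sqrt 2 * real k * pair_norm G0 G1"
proof -
  define p where "p = (k + 1) * r"
  have Kc: "(K_low k r :: 'a mat) \<in> carrier_mat (k * r) p" "(K_high k r :: 'a mat) \<in> carrier_mat (k * r) p"
    unfolding p_def by (simp_all only: K_carrier)
  obtain X Y where X: "X \<in> carrier_mat (k * r) (k * r)" and Y: "Y \<in> carrier_mat p p"
    and 1: "X * K_low k r + K_low k r * Y = G0\<^sup>T" and 2: "X * K_high k r + K_high k r * Y = G1\<^sup>T"
    and nX: "frobenius_norm X \<le> sqrt 2 * real k * pair_norm G0 G1"
    and nY: "frobenius_norm Y \<le> pair_norm G0 G1 + sqrt 2 * real k * pair_norm G0 G1"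
    using solve_row_kronecker_block[of "G0\<^sup>T" k r "G1\<^sup>T"] assms unfolding p_def by auto
  have tr: "Y\<^sup>T * K\<^sup>T + K\<^sup>T * X\<^sup>T = G"
    if K: "K \<in> carrier_mat (k * r) p" and eq: "X * K + K * Y = G\<^sup>T" for K G :: "'a mat"
  proof -
    have "G = (X * K)\<^sup>T + (K * Y)\<^sup>T"
      using eq transpose_add[OF mult_carrier_mat[OF X K] mult_carrier_mat[OF K Y]] by (metis transpose_transpose)
    also have "\<dots> = K\<^sup>T * X\<^sup>T + Y\<^sup>T * K\<^sup>T"
      by (simp add: transpose_mult[OF X K] transpose_mult[OF K Y])
    also have "\<dots> = Y\<^sup>T * K\<^sup>T + K\<^sup>T * X\<^sup>T"
      by (rule comm_add_mat[of _ p "k * r"]) (use X Y K in auto)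
    finally show ?thesis by simp
  qed
  have X': "X\<^sup>T \<in> carrier_mat (k * r) (k * r)" and Y': "Y\<^sup>T \<in> carrier_mat p p"
    using X Y by (simp_all only: transpose_carrier_mat)
  show thesis
    using that[OF Y'[unfolded p_def] X' tr[OF Kc(1) 1] tr[OF Kc(2) 2]] nX nY
    by (simp only: frobenius_norm_transpose)
qed

text \<open>Here only the columns outside the last block column have to match; what is left in the last one is
  absorbed by \<open>B\<close>. The second equation gives \<open>Y = G\<^sub>1 - X F\<close>, and the first one, restricted to the
  first \<open>k\<close> block columns, becomes the Stein equation \<open>X = H + A X N\<close> with a nilpotent shift \<open>N\<close>.\<close>

lemma solve_state_input_block:
  fixes G0 G1 A :: "'a::real_normed_field mat"
  assumes G0: "G0 \<in> carrier_mat l ((k + 1) * r)" and G1: "G1 \<in> carrier_mat l ((k + 1) * r)"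
    and A: "A \<in> carrier_mat l l"
  defines "b \<equiv> real k * max 1 (spectral_norm A ^ k) * (frobenius_norm G0 + frobenius_norm G1)"
  obtains X Y B where "X \<in> carrier_mat l (k * r)" "Y \<in> carrier_mat l ((k + 1) * r)" "B \<in> carrier_mat l r"
    "X * K_low k r + A * Y + B * K_last k r = G0" "X * K_high k r + Y = G1"
    "frobenius_norm X \<le> b" "frobenius_norm Y \<le> frobenius_norm G1 + b"
proof -
  let ?q = "k * r"
  define p where "p = (k + 1) * r"
  have p: "p = ?q + r" by (simp add: p_def)
  note G = G0[folded p_def] G1[folded p_def]
  have Kc: "(K_low k r :: 'a mat) \<in> carrier_mat ?q p" "(K_high k r :: 'a mat) \<in> carrier_mat ?q p" "(K_last k r :: 'a mat) \<in> carrier_mat r p"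
    unfolding p_def by (simp_all only: K_carrier)
  let ?N = "shift_mat ?q ?q r :: 'a mat"
  have AG: "A * G1 \<in> carrier_mat l p" by (rule mult_carrier_mat[OF A G(2)])
  then have GAG: "G0 - A * G1 \<in> carrier_mat l p" by (rule minus_carrier_mat)
  define H where "H = (G0 - A * G1) * (K_low k r)\<^sup>T"
  have H: "H \<in> carrier_mat l ?q" unfolding H_def using GAG Kc by auto
  define X where "X = stein_sum k A H ?N"
  have X: "X \<in> carrier_mat l ?q" unfolding X_def using H A by (intro stein_sum_carrier) auto
  have XF: "X * K_high k r \<in> carrier_mat l p" using X Kc by auto
  define Y where "Y = G1 - X * K_high k r"
  have Y: "Y \<in> carrier_mat l p" unfolding Y_def using XF by (rule minus_carrier_mat)
  have XE: "X * K_low k r \<in> carrier_mat l p" and AY: "A * Y \<in> carrier_mat l p" using X Y A Kc by auto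
  then have S: "X * K_low k r + A * Y \<in> carrier_mat l p" by auto
  define B where "B = mat l r (\<lambda>(i, j). G0 $$ (i, j + ?q) - (X * K_low k r + A * Y) $$ (i, j + ?q))"
  have B: "B \<in> carrier_mat l r" unfolding B_def by simp
  have fixed: "X = H + A * X * ?N"
    unfolding X_def using H A by (intro stein_sum_fixed) (auto simp: shift_mat_nilpotent)
  have first: "(X * K_low k r + A * Y) $$ (i, j) = G0 $$ (i, j)" if ij: "i < l" "j < ?q" for i j
  proof -
    have AX: "A * X \<in> carrier_mat l ?q" using A X by auto
    have "A * Y = A * G1 - A * X * K_high k r"
      unfolding Y_def using mult_minus_distrib_mat[OF A G(2) XF] assoc_mult_mat[OF A X Kc(2)] by simp
    moreover have "(A * X * K_high k r) $$ (i, j) = (A * X * ?N) $$ (i, j)"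
      using ij AX A X p unfolding K_high_def p_def[symmetric] by (auto simp: shift_index simp del: index_mult_mat(1))
    moreover have "X $$ (i, j) = H $$ (i, j) + (A * X * ?N) $$ (i, j)"
    proof -
      have "X $$ (i, j) = (H + A * X * ?N) $$ (i, j)" using fixed by simp
      then show ?thesis using ij A X H by (simp del: index_mult_mat(1))
    qed
    moreover have "H $$ (i, j) = G0 $$ (i, j) - (A * G1) $$ (i, j)"
      unfolding H_def K_low_def p_def[symmetric]
      using ij AG G A p by (auto simp: shift_index simp del: index_mult_mat(1))
    moreover have "(X * K_low k r) $$ (i, j) = X $$ (i, j)"
      using ij X p unfolding K_low_def p_def[symmetric] by (auto simp: shift_index simp del: index_mult_mat(1))
    ultimately show ?thesis
      using ij p A X Y Kc AY by (simp del: index_mult_mat(1))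
  qed
  have BK: "B * K_last k r \<in> carrier_mat l p" using B Kc by auto
  have 1: "X * K_low k r + A * Y + B * K_last k r = G0"
  proof (rule eq_matI)
    fix i j assume "i < dim_row G0" "j < dim_col G0"
    then have ij: "i < l" "j < p" using G by auto
    have "(B * K_last k r) $$ (i, j) = (if ?q \<le> j then B $$ (i, j - ?q) else 0)"
      using ij B p unfolding K_last_def p_def[symmetric] by (auto simp: shift_index simp del: index_mult_mat(1))
    also have "\<dots> = G0 $$ (i, j) - (X * K_low k r + A * Y) $$ (i, j)"
      using ij p first[of i j] by (auto simp: B_def)
    finally have "(B * K_last k r) $$ (i, j) = G0 $$ (i, j) - (X * K_low k r + A * Y) $$ (i, j)" .
    then show "(X * K_low k r + A * Y + B * K_last k r) $$ (i, j) = G0 $$ (i, j)"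
      using ij index_add_mat(1)[of i "B * K_last k r" j "X * K_low k r + A * Y"] BK B p
      by (simp del: index_mult_mat(1) index_add_mat(1))
  qed (use S BK G in auto)
  have 2: "X * K_high k r + Y = G1"
    unfolding Y_def by (rule eq_matI) (use G X XF in \<open>auto simp: K_high_def p_def simp del: index_mult_mat(1)\<close>)
  have "frobenius_norm H \<le> frobenius_norm (G0 - A * G1)"
    unfolding H_def K_low_def p_def[symmetric] by (rule frobenius_norm_shift_transpose_right[OF GAG])
  also have "\<dots> \<le> frobenius_norm G0 + spectral_norm A * frobenius_norm G1"
    using frobenius_norm_triangle_minus[OF G(1) AG] frobenius_norm_mult_spectral_left[OF A G(2)] by linarith
  finally have nH: "frobenius_norm H \<le> frobenius_norm G0 + spectral_norm A * frobenius_norm G1" .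
  have "spectral_norm A * spectral_norm ?N \<le> spectral_norm A"
    using mult_left_mono[OF spectral_norm_shift spectral_norm_nonneg] by fastforce
  then have nX: "frobenius_norm X \<le> b"
    unfolding X_def b_def using H A nH by (intro stein_sum_norm_power[of _ l ?q]) auto
  have "frobenius_norm (X * K_high k r) \<le> frobenius_norm X"
    unfolding K_high_def by (rule frobenius_norm_shift_right[OF X])
  then have nY: "frobenius_norm Y \<le> frobenius_norm G1 + b"
    unfolding Y_def using frobenius_norm_triangle_minus[OF G(2) XF] nX by linarith
  show thesis using that[OF X Y[unfolded p_def] B 1 2 nX nY] .
qed

lemma solve_output_state_block:
  fixes G0 G1 A :: "'a::real_normed_field mat"
  assumes G0: "G0 \<in> carrier_mat ((k + 1) * r) l" and G1: "G1 \<in> carrier_mat ((k + 1) * r) l"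
    and A: "A \<in> carrier_mat l l"
  defines "b \<equiv> real k * max 1 (spectral_norm A ^ k) * (frobenius_norm G0 + frobenius_norm G1)"
  obtains X Y C where "X \<in> carrier_mat ((k + 1) * r) l" "Y \<in> carrier_mat (k * r) l" "C \<in> carrier_mat r l"
    "X * A + (K_low k r)\<^sup>T * Y + (K_last k r)\<^sup>T * C = G0" "X + (K_high k r)\<^sup>T * Y = G1"
    "frobenius_norm X \<le> frobenius_norm G1 + b" "frobenius_norm Y \<le> b"
proof -
  define p where "p = (k + 1) * r"
  have Kc: "(K_low k r :: 'a mat) \<in> carrier_mat (k * r) p" "(K_high k r :: 'a mat) \<in> carrier_mat (k * r) p" "(K_last k r :: 'a mat) \<in> carrier_mat r p"
    unfolding p_def by (simp_all only: K_carrier)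
  obtain X Y B where X: "X \<in> carrier_mat l (k * r)" and Y: "Y \<in> carrier_mat l p" and B: "B \<in> carrier_mat l r"
    and 1: "X * K_low k r + A\<^sup>T * Y + B * K_last k r = G0\<^sup>T" and 2: "X * K_high k r + Y = G1\<^sup>T"
    and nX: "frobenius_norm X \<le> b" and nY: "frobenius_norm Y \<le> frobenius_norm G1 + b"
    using solve_state_input_block[of "G0\<^sup>T" l k r "G1\<^sup>T" "A\<^sup>T"] assms unfolding p_def by auto
  have c: "X * K_low k r \<in> carrier_mat l p" "A\<^sup>T * Y \<in> carrier_mat l p" "B * K_last k r \<in> carrier_mat l p"
    "X * K_high k r \<in> carrier_mat l p" "X * K_low k r + A\<^sup>T * Y \<in> carrier_mat l p"
    using X Y B A Kc by auto
  have "G0 = (X * K_low k r)\<^sup>T + (A\<^sup>T * Y)\<^sup>T + (B * K_last k r)\<^sup>T"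
    using 1 transpose_add[OF c(5,3)] transpose_add[OF c(1,2)] by (metis transpose_transpose)
  also have "\<dots> = (K_low k r)\<^sup>T * X\<^sup>T + Y\<^sup>T * A + (K_last k r)\<^sup>T * B\<^sup>T"
    using transpose_mult[OF X Kc(1)] transpose_mult[OF B Kc(3)] transpose_mult[of "A\<^sup>T" l l Y p] A Y by simp
  also have "(K_low k r)\<^sup>T * X\<^sup>T + Y\<^sup>T * A = Y\<^sup>T * A + (K_low k r)\<^sup>T * X\<^sup>T"
    by (rule comm_add_mat[of _ p l]) (use X Y A Kc in auto)
  finally have 1: "Y\<^sup>T * A + (K_low k r)\<^sup>T * X\<^sup>T + (K_last k r)\<^sup>T * B\<^sup>T = G0" by simp
  have "G1 = (X * K_high k r)\<^sup>T + Y\<^sup>T"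
    using 2 transpose_add[OF c(4) Y] by (metis transpose_transpose)
  also have "\<dots> = (K_high k r)\<^sup>T * X\<^sup>T + Y\<^sup>T" by (simp add: transpose_mult[OF X Kc(2)])
  also have "\<dots> = Y\<^sup>T + (K_high k r)\<^sup>T * X\<^sup>T"
    by (rule comm_add_mat[of _ p l]) (use X Y Kc in auto)
  finally have 2: "Y\<^sup>T + (K_high k r)\<^sup>T * X\<^sup>T = G1" by simp
  have "X\<^sup>T \<in> carrier_mat (k * r) l" "Y\<^sup>T \<in> carrier_mat p l" "B\<^sup>T \<in> carrier_mat r l"
    using X Y B by (simp_all only: transpose_carrier_mat)
  then show thesis
    using that[of "Y\<^sup>T" "X\<^sup>T" "B\<^sup>T", folded p_def, OF _ _ _ 1 2] nX nY
    by (simp only: frobenius_norm_transpose)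
qed

section \<open>Three by three block matrices\<close>

text \<open>A matrix is cut into nine blocks by the lists \<open>rs\<close> and \<open>cs\<close> of the numbers of rows and columns of its
  parts, and blocks are addressed by a pair of numbers less than 3. In this form the block of a product
  is one formula (\<open>blk_mult\<close>) instead of nine. The \<open>a\<close>-th part begins at index \<open>off rs a\<close>.\<close>

definition off :: "nat list \<Rightarrow> nat \<Rightarrow> nat" where
  "off rs a = sum_list (take a rs)"

definition blk :: "nat list \<Rightarrow> nat list \<Rightarrow> nat \<Rightarrow> nat \<Rightarrow> 'a mat \<Rightarrow> 'a mat" where
  "blk rs cs a b G = mat (rs ! a) (cs ! b) (\<lambda>(i, j). G $$ (off rs a + i, off cs b + j))"

definition block_of :: "nat list \<Rightarrow> nat \<Rightarrow> nat" where
  "block_of rs i = (if i < rs ! 0 then 0 else if i < rs ! 0 + rs ! 1 then 1 else 2)"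

definition assemble :: "nat list \<Rightarrow> nat list \<Rightarrow> (nat \<Rightarrow> nat \<Rightarrow> 'a mat) \<Rightarrow> 'a mat" where
  "assemble rs cs f = mat (sum_list rs) (sum_list cs)
     (\<lambda>(i, j). f (block_of rs i) (block_of cs j) $$ (i - off rs (block_of rs i), j - off cs (block_of cs j)))"

lemma blk_carrier [simp]: "blk rs cs a b G \<in> carrier_mat (rs ! a) (cs ! b)"
  "dim_row (blk rs cs a b G) = rs ! a" "dim_col (blk rs cs a b G) = cs ! b"
  by (simp_all add: blk_def)

lemma assemble_carrier [simp]: "assemble rs cs f \<in> carrier_mat (sum_list rs) (sum_list cs)"
  by (simp add: assemble_def)

lemma less_3_cases: "(a::nat) < 3 \<longleftrightarrow> a = 0 \<or> a = 1 \<or> a = 2"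
  by auto

lemma length_3_eq: "length rs = 3 \<Longrightarrow> rs = [rs ! 0, rs ! 1, rs ! 2]"
  by (auto simp: numeral_3_eq_3 length_Suc_conv)

lemma off_simps:
  assumes "length rs = 3"
  shows "off rs 0 = 0" "off rs 1 = rs ! 0" "off rs (Suc 0) = rs ! 0" "off rs 2 = rs ! 0 + rs ! 1" "sum_list rs = rs ! 0 + rs ! 1 + rs ! 2"
proof -
  obtain x y z where "rs = [x, y, z]" using length_3_eq[OF assms] by blast
  then show "off rs 0 = 0" "off rs 1 = rs ! 0" "off rs (Suc 0) = rs ! 0" "off rs 2 = rs ! 0 + rs ! 1" "sum_list rs = rs ! 0 + rs ! 1 + rs ! 2"
    by (simp_all add: off_def)
qed

lemma off_less:
  assumes "length rs = 3" "a < 3" "i < rs ! a"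
  shows "off rs a + i < sum_list rs"
  using assms off_simps[OF assms(1)] unfolding less_3_cases by (elim disjE) simp_all

lemma block_of_off:
  assumes "length rs = 3" "a < 3" "i < rs ! a"
  shows "block_of rs (off rs a + i) = a"
  using assms off_simps[OF assms(1)] unfolding less_3_cases block_of_def by (elim disjE) simp_all

lemma block_decomp:
  assumes "length rs = 3" "i < sum_list rs"
  obtains a i' where "a < 3" "i' < rs ! a" "i = off rs a + i'"
proof -
  note o = off_simps[OF assms(1)]
  consider "i < rs ! 0" | "rs ! 0 \<le> i" "i < rs ! 0 + rs ! 1" | "rs ! 0 + rs ! 1 \<le> i" by linarith
  then show thesis
  proof cases
    case 1
    then show ?thesis using that[of 0 i] o by simp
  next
    case 2
    then show ?thesis using that[of 1 "i - rs ! 0"] o by simp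
  next
    case 3
    then show ?thesis using that[of 2 "i - (rs ! 0 + rs ! 1)"] o assms(2) by simp
  qed
qed

lemma blk_assemble:
  assumes "length rs = 3" "length cs = 3" "a < 3" "b < 3" "f a b \<in> carrier_mat (rs ! a) (cs ! b)"
  shows "blk rs cs a b (assemble rs cs f) = f a b"
  by (rule eq_matI) (use assms in \<open>auto simp: blk_def assemble_def off_less block_of_off\<close>)

lemma blk_eqI:
  assumes len: "length rs = 3" "length cs = 3"
    and G: "G \<in> carrier_mat (sum_list rs) (sum_list cs)" and H: "H \<in> carrier_mat (sum_list rs) (sum_list cs)"
    and eq: "\<And>a b. a < 3 \<Longrightarrow> b < 3 \<Longrightarrow> blk rs cs a b G = blk rs cs a b H"
  shows "G = H"
proof (rule eq_matI)
  fix i j assume "i < dim_row H" "j < dim_col H"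
  then have "i < sum_list rs" "j < sum_list cs" using H by auto
  then obtain a i' b j' where "a < 3" "i' < rs ! a" "i = off rs a + i'" "b < 3" "j' < cs ! b" "j = off cs b + j'"
    using block_decomp[OF len(1)] block_decomp[OF len(2)] by metis
  then show "G $$ (i, j) = H $$ (i, j)"
    using arg_cong[OF eq[of a b], of "\<lambda>Z. Z $$ (i', j')"] by (simp add: blk_def)
qed (use G H in auto)

lemma sum_lessThan_add:
  fixes g :: "nat \<Rightarrow> 'a::comm_monoid_add"
  shows "(\<Sum>k<p + q. g k) = (\<Sum>k<p. g k) + (\<Sum>k<q. g (p + k))"
  by (induction q) (simp_all add: add.assoc)

lemma sum_blocks:
  fixes g :: "nat \<Rightarrow> 'a::comm_monoid_add"
  assumes "length rs = 3"
  shows "(\<Sum>k<sum_list rs. g k) =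
    (\<Sum>k<rs ! 0. g (off rs 0 + k)) + (\<Sum>k<rs ! 1. g (off rs 1 + k)) + (\<Sum>k<rs ! 2. g (off rs 2 + k))"
  by (simp add: off_simps[OF assms] sum_lessThan_add)

lemma blk_add:
  assumes "length rs = 3" "length cs = 3" "a < 3" "b < 3"
    and "G \<in> carrier_mat (sum_list rs) (sum_list cs)" "H \<in> carrier_mat (sum_list rs) (sum_list cs)"
  shows "blk rs cs a b (G + H) = blk rs cs a b G + blk rs cs a b H"
  by (rule eq_matI) (use assms in \<open>auto simp: blk_def off_less\<close>)

lemma blk_minus:
  assumes "length rs = 3" "length cs = 3" "a < 3" "b < 3"
    and "G \<in> carrier_mat (sum_list rs) (sum_list cs)" "H \<in> carrier_mat (sum_list rs) (sum_list cs)"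
  shows "blk rs cs a b (G - H) = blk rs cs a b G - blk rs cs a b H"
  by (rule eq_matI) (use assms in \<open>auto simp: blk_def off_less\<close>)

lemma blk_mult:
  fixes G :: "'a::comm_ring_1 mat"
  assumes len: "length rs = 3" "length ps = 3" "length cs = 3" and ab: "a < 3" "b < 3"
    and G: "G \<in> carrier_mat (sum_list rs) (sum_list ps)" and H: "H \<in> carrier_mat (sum_list ps) (sum_list cs)"
  shows "blk rs cs a b (G * H) = blk rs ps a 0 G * blk ps cs 0 b H + blk rs ps a 1 G * blk ps cs 1 b H
    + blk rs ps a 2 G * blk ps cs 2 b H" (is "?L = ?R")
proof (rule eq_matI)
  fix i j assume "i < dim_row ?R" "j < dim_col ?R"
  then have ij: "i < rs ! a" "j < cs ! b" by auto
  have "?L $$ (i, j) = (G * H) $$ (off rs a + i, off cs b + j)"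
    using ij by (simp add: blk_def)
  also have "\<dots> = (\<Sum>k<sum_list ps. G $$ (off rs a + i, k) * H $$ (k, off cs b + j))"
    using off_less[OF len(1) ab(1) ij(1)] off_less[OF len(3) ab(2) ij(2)] G H
    by (simp add: scalar_prod_def atLeast0LessThan)
  also have "\<dots> = ?R $$ (i, j)"
    using ij by (simp add: sum_blocks[OF len(2)] scalar_prod_def atLeast0LessThan blk_def)
  finally show "?L $$ (i, j) = ?R $$ (i, j)" .
qed auto

lemma frobenius_norm_sq_blocks:
  assumes len: "length rs = 3" "length cs = 3" and G: "G \<in> carrier_mat (sum_list rs) (sum_list cs)"
  shows "(frobenius_norm G)\<^sup>2 = (\<Sum>a<3. \<Sum>b<3. (frobenius_norm (blk rs cs a b G))\<^sup>2)"
proof -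
  have blk: "(frobenius_norm (blk rs cs a b G))\<^sup>2 =
    (\<Sum>i<rs ! a. \<Sum>j<cs ! b. (norm (G $$ (off rs a + i, off cs b + j)))\<^sup>2)" for a b
    unfolding frobenius_norm_sq by (simp add: blk_def)
  show ?thesis
    unfolding frobenius_norm_sq_carrier[OF G] blk sum_blocks[OF len(1)] sum_blocks[OF len(2)]
    by (simp add: sum.distrib numeral_3_eq_3 numeral_2_eq_2 add_ac)
qed

lemma frobenius_norm_sq_assemble:
  assumes "length rs = 3" "length cs = 3"
    and "\<And>a b. a < 3 \<Longrightarrow> b < 3 \<Longrightarrow> f a b \<in> carrier_mat (rs ! a) (cs ! b)"
  shows "(frobenius_norm (assemble rs cs f))\<^sup>2 = (\<Sum>a<3. \<Sum>b<3. (frobenius_norm (f a b))\<^sup>2)"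
  by (subst frobenius_norm_sq_blocks[OF assms(1,2)]) (auto simp: blk_assemble assms intro!: sum.cong)

lemma sum_less_3: "(\<Sum>a<3. g a) = g 0 + g 1 + g (2::nat)"
  by (simp add: numeral_3_eq_3 numeral_2_eq_2)

definition grid :: "'a \<Rightarrow> 'a \<Rightarrow> 'a \<Rightarrow> 'a \<Rightarrow> 'a \<Rightarrow> 'a \<Rightarrow> 'a \<Rightarrow> 'a \<Rightarrow> 'a \<Rightarrow> nat \<Rightarrow> nat \<Rightarrow> 'a" where
  "grid x00 x01 x02 x10 x11 x12 x20 x21 x22 =
     (\<lambda>a b. [[x00, x01, x02], [x10, x11, x12], [x20, x21, x22]] ! a ! b)"

lemma grid_simps [simp]:
  "grid x00 x01 x02 x10 x11 x12 x20 x21 x22 0 0 = x00"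
  "grid x00 x01 x02 x10 x11 x12 x20 x21 x22 0 (Suc 0) = x01"
  "grid x00 x01 x02 x10 x11 x12 x20 x21 x22 0 2 = x02"
  "grid x00 x01 x02 x10 x11 x12 x20 x21 x22 (Suc 0) 0 = x10"
  "grid x00 x01 x02 x10 x11 x12 x20 x21 x22 (Suc 0) (Suc 0) = x11"
  "grid x00 x01 x02 x10 x11 x12 x20 x21 x22 (Suc 0) 2 = x12"
  "grid x00 x01 x02 x10 x11 x12 x20 x21 x22 2 0 = x20"
  "grid x00 x01 x02 x10 x11 x12 x20 x21 x22 2 (Suc 0) = x21"
  "grid x00 x01 x02 x10 x11 x12 x20 x21 x22 2 2 = x22"
  by (simp_all add: grid_def)

lemma grid_carrier:
  assumes "x00 \<in> carrier_mat (rs ! 0) (cs ! 0)" "x01 \<in> carrier_mat (rs ! 0) (cs ! 1)"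
    "x02 \<in> carrier_mat (rs ! 0) (cs ! 2)" "x10 \<in> carrier_mat (rs ! 1) (cs ! 0)"
    "x11 \<in> carrier_mat (rs ! 1) (cs ! 1)" "x12 \<in> carrier_mat (rs ! 1) (cs ! 2)"
    "x20 \<in> carrier_mat (rs ! 2) (cs ! 0)" "x21 \<in> carrier_mat (rs ! 2) (cs ! 1)"
    "x22 \<in> carrier_mat (rs ! 2) (cs ! 2)" and "a < 3" "b < 3"
  shows "grid x00 x01 x02 x10 x11 x12 x20 x21 x22 a b \<in> carrier_mat (rs ! a) (cs ! b)"
  using assms unfolding less_3_cases by (elim disjE) simp_all

section \<open>The linearized problem\<close>

definition row_sizes :: "nat \<Rightarrow> nat \<Rightarrow> nat \<Rightarrow> nat \<Rightarrow> nat \<Rightarrow> nat list" where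
  "row_sizes m n l e h = [(h + 1) * m, l, e * n]"

definition col_sizes :: "nat \<Rightarrow> nat \<Rightarrow> nat \<Rightarrow> nat \<Rightarrow> nat \<Rightarrow> nat list" where
  "col_sizes m n l e h = [(e + 1) * n, l, h * m]"

lemma cauchy_schwarz_3:
  fixes a b c u v w :: real
  shows "(a * u + b * v + c * w)\<^sup>2 \<le> (a\<^sup>2 + b\<^sup>2 + c\<^sup>2) * (u\<^sup>2 + v\<^sup>2 + w\<^sup>2)"
proof -
  have "(a\<^sup>2 + b\<^sup>2 + c\<^sup>2) * (u\<^sup>2 + v\<^sup>2 + w\<^sup>2) - (a * u + b * v + c * w)\<^sup>2
    = (a * v - b * u)\<^sup>2 + (a * w - c * u)\<^sup>2 + (b * w - c * v)\<^sup>2"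
    by (simp add: power2_eq_square algebra_simps)
  then show ?thesis by (smt (verit) zero_le_power2)
qed

text \<open>The sum of the bounds for all unknown blocks of the first stage, where \<open>u\<close>, \<open>v\<close>, \<open>w\<close> stand for the norms
  of the three blocks to be removed, \<open>g\<close> for the norm of the whole pair, \<open>al\<close>, \<open>be\<close>, \<open>ga\<close> for the three
  constants of the same names, and \<open>b\<close>, \<open>c\<close> for the spectral norms of the input and the output matrix.
  The Cauchy-Schwarz inequality gives the constant \<open>\<surd>((4 + \<surd>2)\<^sup>2 + 2 + 2)\<close>, which is less than 6.\<close>

lemma elimination_bound:
  fixes u v w g al be ga b c :: real
  assumes sq: "u\<^sup>2 + v\<^sup>2 + w\<^sup>2 \<le> g\<^sup>2" and nn: "0 \<le> u" "0 \<le> v" "0 \<le> w" "0 \<le> g" "0 \<le> ga" "0 \<le> al" "0 \<le> be" "0 \<le> b" "0 \<le> c"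
  shows "2 * ga * u + (2 + sqrt 2) * ga * u + (sqrt 2 * al * v + al * (2 * ga * u * c))
     + (sqrt 2 * be * w + be * ((2 + sqrt 2) * ga * u * b))
    \<le> 6 * (max al (max be ga) + ga * (be * b + al * c)) * g"
proof -
  let ?m = "max al (max be ga)"
  have m: "0 \<le> ?m" "al \<le> ?m" "be \<le> ?m" "ga \<le> ?m" using nn by auto
  have s2: "sqrt 2 \<le> 3 / 2" by (rule real_le_lsqrt) (auto simp: power2_eq_square)
  have ug: "u \<le> g" by (rule power2_le_imp_le) (use sq nn zero_le_power2[of v] zero_le_power2[of w] in linarith)+
  have "((4 + sqrt 2) * u + sqrt 2 * v + sqrt 2 * w)\<^sup>2 \<le> ((4 + sqrt 2)\<^sup>2 + (sqrt 2)\<^sup>2 + (sqrt 2)\<^sup>2) * (u\<^sup>2 + v\<^sup>2 + w\<^sup>2)"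
    by (rule cauchy_schwarz_3)
  also have "\<dots> \<le> 36 * g\<^sup>2"
    using s2 sq by (intro mult_mono) (auto simp: power2_sum)
  finally have "((4 + sqrt 2) * u + sqrt 2 * v + sqrt 2 * w)\<^sup>2 \<le> (6 * g)\<^sup>2" by (simp add: power_mult_distrib)
  then have "(4 + sqrt 2) * u + sqrt 2 * v + sqrt 2 * w \<le> 6 * g"
    by (rule power2_le_imp_le) (use nn in auto)
  from mult_left_mono[OF this m(1)]
  have 1: "?m * ((4 + sqrt 2) * u) + ?m * (sqrt 2 * v) + ?m * (sqrt 2 * w) \<le> 6 * ?m * g"
    by (simp add: algebra_simps)
  have "ga * ((4 + sqrt 2) * u) \<le> ?m * ((4 + sqrt 2) * u)" "al * (sqrt 2 * v) \<le> ?m * (sqrt 2 * v)"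
    "be * (sqrt 2 * w) \<le> ?m * (sqrt 2 * w)"
    using m nn by (intro mult_right_mono; simp)+
  with 1 have 2: "ga * ((4 + sqrt 2) * u) + al * (sqrt 2 * v) + be * (sqrt 2 * w) \<le> 6 * ?m * g" by linarith
  have z: "0 \<le> ga * al * c" "0 \<le> ga * be * b" using nn by auto
  have "(2 + sqrt 2) * u \<le> 6 * g"
    using mult_right_mono[of "2 + sqrt 2" 4 u] s2 ug nn by simp
  from mult_left_mono[OF this z(2)] mult_left_mono[OF _ z(1), of "2 * u" "6 * g"] ug nn
  have "ga * al * c * (2 * u) \<le> ga * al * c * (6 * g)" "ga * be * b * ((2 + sqrt 2) * u) \<le> ga * be * b * (6 * g)"
    by linarith+
  with 2 show ?thesis by (simp add: algebra_simps)
qed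

text \<open>Two matrices that look, outside the corner block \<open>(0, 0)\<close>, like the coefficients of a block Kronecker
  pencil with parameters \<open>e\<close>, \<open>h\<close> and state-space data \<open>A\<close>, \<open>B\<close>, \<open>C\<close>.\<close>

locale kronecker_coefficients =
  fixes m n l e h :: nat
    and A B C S0 S1 :: "'a::real_normed_field mat"
  assumes A: "A \<in> carrier_mat l l" and B: "B \<in> carrier_mat l n" and C: "C \<in> carrier_mat m l"
    and S0: "S0 \<in> carrier_mat ((h + 1) * m + l + e * n) ((e + 1) * n + l + h * m)"
    and S1: "S1 \<in> carrier_mat ((h + 1) * m + l + e * n) ((e + 1) * n + l + h * m)"
    and S0_blocks:
      "blk (row_sizes m n l e h) (col_sizes m n l e h) 0 1 S0 = (K_last h m)\<^sup>T * C"
      "blk (row_sizes m n l e h) (col_sizes m n l e h) 0 2 S0 = (K_low h m)\<^sup>T"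
      "blk (row_sizes m n l e h) (col_sizes m n l e h) 1 0 S0 = B * K_last e n"
      "blk (row_sizes m n l e h) (col_sizes m n l e h) 1 1 S0 = A"
      "blk (row_sizes m n l e h) (col_sizes m n l e h) 1 2 S0 = 0\<^sub>m l (h * m)"
      "blk (row_sizes m n l e h) (col_sizes m n l e h) 2 0 S0 = K_low e n"
      "blk (row_sizes m n l e h) (col_sizes m n l e h) 2 1 S0 = 0\<^sub>m (e * n) l"
      "blk (row_sizes m n l e h) (col_sizes m n l e h) 2 2 S0 = 0\<^sub>m (e * n) (h * m)"
    and S1_blocks:
      "blk (row_sizes m n l e h) (col_sizes m n l e h) 0 1 S1 = 0\<^sub>m ((h + 1) * m) l"
      "blk (row_sizes m n l e h) (col_sizes m n l e h) 0 2 S1 = - (K_high h m)\<^sup>T"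
      "blk (row_sizes m n l e h) (col_sizes m n l e h) 1 0 S1 = 0\<^sub>m l ((e + 1) * n)"
      "blk (row_sizes m n l e h) (col_sizes m n l e h) 1 1 S1 = - 1\<^sub>m l"
      "blk (row_sizes m n l e h) (col_sizes m n l e h) 1 2 S1 = 0\<^sub>m l (h * m)"
      "blk (row_sizes m n l e h) (col_sizes m n l e h) 2 0 S1 = - K_high e n"
      "blk (row_sizes m n l e h) (col_sizes m n l e h) 2 1 S1 = 0\<^sub>m (e * n) l"
      "blk (row_sizes m n l e h) (col_sizes m n l e h) 2 2 S1 = 0\<^sub>m (e * n) (h * m)"
begin

definition p where "p = (h + 1) * m"
definition q where "q = (e + 1) * n"

abbreviation "rs \<equiv> row_sizes m n l e h"
abbreviation "cs \<equiv> col_sizes m n l e h"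
abbreviation "nr \<equiv> p + l + e * n"
abbreviation "nc \<equiv> q + l + h * m"

abbreviation residual :: "'a mat \<Rightarrow> 'a mat \<Rightarrow> 'a mat \<Rightarrow> 'a mat \<Rightarrow> 'a mat" where
  "residual S X Y G \<equiv> G - (X * S + S * Y)"

lemma sizes [simp]: "length rs = 3" "length cs = 3" "sum_list rs = nr" "sum_list cs = nc"
  "rs ! 0 = p" "rs ! 1 = l" "rs ! Suc 0 = l" "rs ! 2 = e * n"
  "cs ! 0 = q" "cs ! 1 = l" "cs ! Suc 0 = l" "cs ! 2 = h * m"
  by (simp_all add: row_sizes_def col_sizes_def p_def q_def)

lemmas S_carrier = S0[folded p_def q_def] S1[folded p_def q_def]

lemmas S_blocks = S0_blocks[folded p_def q_def] S1_blocks[folded p_def q_def]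
  S0_blocks[folded p_def q_def, unfolded One_nat_def] S1_blocks[folded p_def q_def, unfolded One_nat_def]

lemma K_sizes:
  "(K_low h m :: 'a mat) \<in> carrier_mat (h * m) p" "(K_high h m :: 'a mat) \<in> carrier_mat (h * m) p"
  "(K_last h m :: 'a mat) \<in> carrier_mat m p" "(K_low e n :: 'a mat) \<in> carrier_mat (e * n) q"
  "(K_high e n :: 'a mat) \<in> carrier_mat (e * n) q" "(K_last e n :: 'a mat) \<in> carrier_mat n q"
  unfolding p_def q_def by (simp_all only: K_carrier)

lemma K_dims: "dim_row (K_low h m) = h * m" "dim_col (K_low h m) = p" "dim_row (K_high h m) = h * m" "dim_col (K_high h m) = p"
  "dim_row (K_last h m) = m" "dim_col (K_last h m) = p"
  "dim_row (K_low e n) = e * n" "dim_col (K_low e n) = q" "dim_row (K_high e n) = e * n" "dim_col (K_high e n) = q"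
  "dim_row (K_last e n) = n" "dim_col (K_last e n) = q"
  by (simp_all add: p_def q_def)

lemma zero_mult_dim:
  fixes P :: "'a mat"
  shows "dim_col P = k \<Longrightarrow> P * 0\<^sub>m k r = 0\<^sub>m (dim_row P) r"
  by (auto intro: right_mult_zero_mat)

lemma uminus_zero_block: "- 0\<^sub>m r c = (0\<^sub>m r c :: 'a mat)"
  by (rule eq_matI) auto

lemma blk_residual:
  assumes "a < 3" "b < 3" and S: "S \<in> carrier_mat nr nc" and X: "X \<in> carrier_mat nr nr"
    and Y: "Y \<in> carrier_mat nc nc" and G: "G \<in> carrier_mat nr nc"
  shows "blk rs cs a b (residual S X Y G) = blk rs cs a b G -
    (blk rs rs a 0 X * blk rs cs 0 b S + blk rs rs a 1 X * blk rs cs 1 b S + blk rs rs a 2 X * blk rs cs 2 b S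
     + (blk rs cs a 0 S * blk cs cs 0 b Y + blk rs cs a 1 S * blk cs cs 1 b Y + blk rs cs a 2 S * blk cs cs 2 b Y))"
proof -
  note c = X[folded sizes(3)] S[folded sizes(3,4)] Y[folded sizes(4)] G[folded sizes(3,4)]
  have XS: "X * S \<in> carrier_mat (sum_list rs) (sum_list cs)" and SY: "S * Y \<in> carrier_mat (sum_list rs) (sum_list cs)"
    by (rule mult_carrier_mat[OF c(1,2)], rule mult_carrier_mat[OF c(2,3)])
  show ?thesis
    by (simp only: blk_minus[OF sizes(1,2) assms(1,2) c(4) add_carrier_mat[OF SY]]
        blk_add[OF sizes(1,2) assms(1,2) XS SY] blk_mult[OF sizes(1,1,2) assms(1,2) c(1,2)]
        blk_mult[OF sizes(1,2,2) assms(1,2) c(2,3)])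
qed

lemma blk_residual_assemble:
  assumes "a < 3" "b < 3" and S: "S \<in> carrier_mat nr nc" and G: "G \<in> carrier_mat nr nc"
    and f: "\<And>a b. a < 3 \<Longrightarrow> b < 3 \<Longrightarrow> f a b \<in> carrier_mat (rs ! a) (rs ! b)"
    and g: "\<And>a b. a < 3 \<Longrightarrow> b < 3 \<Longrightarrow> g a b \<in> carrier_mat (cs ! a) (cs ! b)"
  shows "blk rs cs a b (residual S (assemble rs rs f) (assemble cs cs g) G) = blk rs cs a b G -
    (f a 0 * blk rs cs 0 b S + f a 1 * blk rs cs 1 b S + f a 2 * blk rs cs 2 b S
     + (blk rs cs a 0 S * g 0 b + blk rs cs a 1 S * g 1 b + blk rs cs a 2 S * g 2 b))"
proof -
  have "assemble rs rs f \<in> carrier_mat nr nr" "assemble cs cs g \<in> carrier_mat nc nc"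
    using assemble_carrier[of rs rs f] assemble_carrier[of cs cs g] by (simp_all only: sizes)
  moreover have "blk rs rs a k (assemble rs rs f) = f a k" "blk cs cs k b (assemble cs cs g) = g k b" if "k < 3" for k
    using f g assms(1,2) that by (simp_all add: blk_assemble)
  ultimately show ?thesis
    by (simp add: blk_residual[OF assms(1,2) S _ _ G])
qed

lemma uminus_mult_carrier:
  fixes P :: "'a mat"
  assumes "P \<in> carrier_mat r k" "Q \<in> carrier_mat k c"
  shows "P * - Q = - (P * Q)" "- P * Q = - (P * Q)"
  using assms by (auto intro!: uminus_mult_left_mat uminus_mult_right_mat)

lemma cancel_block:
  fixes G :: "'a mat"
  assumes "P \<in> carrier_mat r c" "G \<in> carrier_mat r c"
  shows "G - (P + (G - P)) = 0\<^sub>m r c"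
  by (rule eq_matI) (use assms in auto)

lemma add_left_commute_block:
  fixes P :: "'a mat"
  assumes "P \<in> carrier_mat r c" "Q \<in> carrier_mat r c" "R \<in> carrier_mat r c"
  shows "P + (Q + R) = Q + (P + R)"
  by (rule eq_matI) (use assms in auto)

abbreviation vanish :: "nat \<Rightarrow> nat \<Rightarrow> 'a mat \<Rightarrow> 'a mat \<Rightarrow> bool" where
  "vanish a b G H \<equiv> blk rs cs a b G = 0\<^sub>m (rs ! a) (cs ! b) \<and> blk rs cs a b H = 0\<^sub>m (rs ! a) (cs ! b)"

lemma pair_norm_sq_blocks:
  assumes "G0 \<in> carrier_mat nr nc" "G1 \<in> carrier_mat nr nc"
  shows "(pair_norm G0 G1)\<^sup>2 = (\<Sum>a<3. \<Sum>b<3. (pair_norm (blk rs cs a b G0) (blk rs cs a b G1))\<^sup>2)"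
  using frobenius_norm_sq_blocks[of rs cs G0] frobenius_norm_sq_blocks[of rs cs G1] assms
  by (simp add: pair_norm_def sum.distrib sum_nonneg)

lemma cancel_sum_block:
  fixes P :: "'a mat"
  assumes "P \<in> carrier_mat r c" "Q \<in> carrier_mat r c" "R \<in> carrier_mat r c"
  shows "P + (Q + R) - (P + Q) = R" "P + Q + R - (P + Q) = R"
  by (rule eq_matI; use assms in auto)+

lemma uminus_add_block:
  fixes P :: "'a mat"
  assumes "P \<in> carrier_mat r c" "Q \<in> carrier_mat r c"
  shows "- P + - Q = - (P + Q)"
  by (rule eq_matI) (use assms in auto)

text \<open>The first stage. The blocks \<open>(2, 2)\<close>, \<open>(2, 1)\<close> and \<open>(1, 2)\<close> of a block Kronecker pencil are zero.
  The unknowns below are named by their positions counted from 1. Block \<open>(2, 2)\<close> involves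
  \<open>X31\<close> and \<open>Y13\<close> only. These enter the other two blocks through the products \<open>P32\<close> and \<open>P23\<close> with the
  blocks that contain \<open>C\<close> and \<open>B\<close>; this coupling is the reason for the products in the constant \<open>s\<close>.
  Then block \<open>(2, 1)\<close> determines \<open>X32\<close>, \<open>Y12\<close>, and block \<open>(1, 2)\<close> determines \<open>X21\<close>, \<open>Y23\<close>.\<close>

lemma eliminate_zero_blocks:
  assumes G0: "G0 \<in> carrier_mat nr nc" and G1: "G1 \<in> carrier_mat nr nc"
  obtains X Y where "X \<in> carrier_mat nr nr" "Y \<in> carrier_mat nc nc"
    "vanish 1 2 (residual S0 X Y G0) (residual S1 X Y G1)"
    "vanish 2 1 (residual S0 X Y G0) (residual S1 X Y G1)"
    "vanish 2 2 (residual S0 X Y G0) (residual S1 X Y G1)"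
    "frobenius_norm X + frobenius_norm Y \<le> 6 * s_const e h A B C * pair_norm G0 G1"
proof -
  let ?G0 = "\<lambda>a b. blk rs cs a b G0" and ?G1 = "\<lambda>a b. blk rs cs a b G1"
  have Gc: "?G0 a b \<in> carrier_mat (rs ! a) (cs ! b)" "?G1 a b \<in> carrier_mat (rs ! a) (cs ! b)" for a b
    by simp_all
  note Gc = Gc[of 1 2, unfolded sizes] Gc[of 2 1, unfolded sizes] Gc[of 2 2, unfolded sizes]
  have W: "?G0 2 2 \<in> carrier_mat (e * n) (h * m)" "- ?G1 2 2 \<in> carrier_mat (e * n) (h * m)"
    using Gc by (simp_all only: uminus_carrier_iff_mat)
  obtain X31 Y13 where X31: "X31 \<in> carrier_mat (e * n) p" and Y13: "Y13 \<in> carrier_mat q (h * m)"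
    and e33: "X31 * (K_low h m)\<^sup>T + K_low e n * Y13 = ?G0 2 2"
      "X31 * (K_high h m)\<^sup>T + K_high e n * Y13 = - ?G1 2 2"
    and n33: "frobenius_norm X31 \<le> sqrt 2 * real (min e h) * pair_norm (?G0 2 2) (- ?G1 2 2)"
      "frobenius_norm Y13 \<le> pair_norm (?G0 2 2) (- ?G1 2 2)
         + sqrt 2 * real (min e h) * pair_norm (?G0 2 2) (- ?G1 2 2)"
    using solve_two_kronecker_blocks[OF W] unfolding p_def q_def by metis
  define P32 where "P32 = X31 * ((K_last h m)\<^sup>T * C)"
  have P32: "P32 \<in> carrier_mat (e * n) l" unfolding P32_def using X31 C K_sizes by auto
  then have W: "?G0 2 1 - P32 \<in> carrier_mat (e * n) l" "- ?G1 2 1 \<in> carrier_mat (e * n) l"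
    using Gc by (simp_all only: uminus_carrier_iff_mat minus_carrier_mat)
  obtain X32 Y12 where X32: "X32 \<in> carrier_mat (e * n) l" and Y12: "Y12 \<in> carrier_mat q l"
    and e32: "X32 * A + K_low e n * Y12 = ?G0 2 1 - P32" "X32 + K_high e n * Y12 = - ?G1 2 1"
    and n32: "frobenius_norm X32 \<le> frobenius_norm (- ?G1 2 1) + real e * max 1 (spectral_norm A ^ e) *
         (frobenius_norm (?G0 2 1 - P32) + frobenius_norm (- ?G1 2 1))"
      "frobenius_norm Y12 \<le> real e * max 1 (spectral_norm A ^ e) *
         (frobenius_norm (?G0 2 1 - P32) + frobenius_norm (- ?G1 2 1))"
    using solve_kronecker_state_block[OF W A] unfolding q_def by metis
  define P23 where "P23 = (B * K_last e n) * Y13"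
  have P23: "P23 \<in> carrier_mat l (h * m)" unfolding P23_def using Y13 B K_sizes by auto
  then have W: "?G0 1 2 - P23 \<in> carrier_mat l (h * m)" "- ?G1 1 2 \<in> carrier_mat l (h * m)"
    using Gc by (simp_all only: uminus_carrier_iff_mat minus_carrier_mat)
  obtain X21 Y23 where X21: "X21 \<in> carrier_mat l p" and Y23: "Y23 \<in> carrier_mat l (h * m)"
    and e23: "X21 * (K_low h m)\<^sup>T + A * Y23 = ?G0 1 2 - P23" "X21 * (K_high h m)\<^sup>T + Y23 = - ?G1 1 2"
    and n23: "frobenius_norm X21 \<le> real h * max 1 (spectral_norm A ^ h) *
         (frobenius_norm (?G0 1 2 - P23) + frobenius_norm (- ?G1 1 2))"
      "frobenius_norm Y23 \<le> frobenius_norm (- ?G1 1 2) + real h * max 1 (spectral_norm A ^ h) *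
         (frobenius_norm (?G0 1 2 - P23) + frobenius_norm (- ?G1 1 2))"
    using solve_state_kronecker_block[OF W A] unfolding p_def by metis
  let ?f = "grid (0\<^sub>m p p) (0\<^sub>m p l) (0\<^sub>m p (e * n)) X21 (0\<^sub>m l l) (0\<^sub>m l (e * n))
    X31 X32 (0\<^sub>m (e * n) (e * n))"
  let ?g = "grid (0\<^sub>m q q) Y12 Y13 (0\<^sub>m l q) (0\<^sub>m l l) Y23
    (0\<^sub>m (h * m) q) (0\<^sub>m (h * m) l) (0\<^sub>m (h * m) (h * m))"
  have f: "?f a b \<in> carrier_mat (rs ! a) (rs ! b)" and g: "?g a b \<in> carrier_mat (cs ! a) (cs ! b)"
    if "a < 3" "b < 3" for a b
    using that by (auto intro!: grid_carrier simp: X31 Y13 X21 Y23 X32 Y12)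
  note r0 = blk_residual_assemble[OF _ _ S_carrier(1) G0 f g]
    and r1 = blk_residual_assemble[OF _ _ S_carrier(2) G1 f g]
  have prod: "X31 * (K_low h m)\<^sup>T \<in> carrier_mat (e * n) (h * m)" "X31 * (K_high h m)\<^sup>T \<in> carrier_mat (e * n) (h * m)"
    "K_low e n * Y13 \<in> carrier_mat (e * n) (h * m)" "K_high e n * Y13 \<in> carrier_mat (e * n) (h * m)"
    "X32 * A \<in> carrier_mat (e * n) l" "K_low e n * Y12 \<in> carrier_mat (e * n) l" "K_high e n * Y12 \<in> carrier_mat (e * n) l"
    "X21 * (K_low h m)\<^sup>T \<in> carrier_mat l (h * m)" "X21 * (K_high h m)\<^sup>T \<in> carrier_mat l (h * m)"
    "A * Y23 \<in> carrier_mat l (h * m)"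
    using X31 Y13 X32 Y12 X21 Y23 A K_sizes by auto
  note facts = K_sizes X31 Y13 X32 Y12 X21 Y23 A B C prod Gc P32 P23
  let ?X = "assemble rs rs ?f" and ?Y = "assemble cs cs ?g"
  have 1: "blk rs cs 1 2 (residual S0 ?X ?Y G0) = 0\<^sub>m l (h * m)"
    using facts by (simp add: r0 S_blocks e23 P23_def[symmetric] cancel_block
        add_left_commute_block[OF prod(8) P23 prod(10)])
  have 2: "blk rs cs 1 2 (residual S1 ?X ?Y G1) = 0\<^sub>m l (h * m)"
    using facts by (simp add: r1 S_blocks e23 uminus_add_block[OF prod(9) Y23] uminus_mult_carrier)
  have 3: "blk rs cs 2 1 (residual S0 ?X ?Y G0) = 0\<^sub>m (e * n) l"
    using facts by (simp add: r0 S_blocks e32 P32_def[symmetric] cancel_block)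
  have 4: "blk rs cs 2 1 (residual S1 ?X ?Y G1) = 0\<^sub>m (e * n) l"
    using facts by (simp add: r1 S_blocks e32 uminus_add_block[OF X32 prod(7)] uminus_mult_carrier)
  have 5: "blk rs cs 2 2 (residual S0 ?X ?Y G0) = 0\<^sub>m (e * n) (h * m)"
    using facts by (simp add: r0 S_blocks e33)
  have 6: "blk rs cs 2 2 (residual S1 ?X ?Y G1) = 0\<^sub>m (e * n) (h * m)"
    using facts by (simp add: r1 S_blocks e33 uminus_add_block[OF prod(2,4)] uminus_mult_carrier)
  have X: "?X \<in> carrier_mat nr nr" and Y: "?Y \<in> carrier_mat nc nc"
    using assemble_carrier[of rs rs ?f] assemble_carrier[of cs cs ?g] by (simp_all only: sizes)
  have nX: "frobenius_norm ?X \<le> frobenius_norm X31 + frobenius_norm X32 + frobenius_norm X21"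
    by (rule power2_le_imp_le)
      (simp_all add: frobenius_norm_sq_assemble f sum_less_3 power2_sum add_nonneg_nonneg)
  have nY: "frobenius_norm ?Y \<le> frobenius_norm Y13 + frobenius_norm Y12 + frobenius_norm Y23"
    by (rule power2_le_imp_le)
      (simp_all add: frobenius_norm_sq_assemble g sum_less_3 power2_sum add_nonneg_nonneg)
  have "frobenius_norm P32 \<le> frobenius_norm X31 * spectral_norm C"
  proof -
    have XK: "X31 * (K_last h m)\<^sup>T \<in> carrier_mat (e * n) m" using X31 K_sizes by auto
    have "P32 = X31 * (K_last h m)\<^sup>T * C"
      unfolding P32_def using X31 K_sizes C by (simp add: assoc_mult_mat[of _ "e * n" p _ m _ l])
    also have "frobenius_norm \<dots> \<le> frobenius_norm (X31 * (K_last h m)\<^sup>T) * spectral_norm C"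
      by (rule frobenius_norm_mult_spectral_right[OF XK C])
    also have "frobenius_norm (X31 * (K_last h m)\<^sup>T) \<le> frobenius_norm X31"
      unfolding K_last_def p_def[symmetric] by (rule frobenius_norm_shift_transpose_right[OF X31])
    finally show ?thesis by (simp add: mult_right_mono)
  qed
  have "frobenius_norm P23 \<le> spectral_norm B * frobenius_norm Y13"
  proof -
    have KY: "K_last e n * Y13 \<in> carrier_mat n (h * m)" using Y13 K_sizes by auto
    have "P23 = B * (K_last e n * Y13)"
      unfolding P23_def using Y13 K_sizes B by (simp add: assoc_mult_mat[of _ l n _ q _ "h * m"])
    also have "frobenius_norm \<dots> \<le> spectral_norm B * frobenius_norm (K_last e n * Y13)"
      by (rule frobenius_norm_mult_spectral_left[OF B KY])
    also have "frobenius_norm (K_last e n * Y13) \<le> frobenius_norm Y13"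
      unfolding K_last_def q_def[symmetric] by (rule frobenius_norm_shift_left[OF Y13])
    finally show ?thesis by (simp add: mult_left_mono)
  qed
  let ?g = "\<lambda>a b. pair_norm (?G0 a b) (?G1 a b)"
  have norms: "frobenius_norm X31 \<le> sqrt 2 * real (min e h) * ?g 2 2"
    "frobenius_norm Y13 \<le> ?g 2 2 + sqrt 2 * real (min e h) * ?g 2 2"
    using n33 by (simp_all add: pair_norm_def)
  \<comment> \<open>If one parameter is 0, block \<open>(2, 2)\<close> is empty. Otherwise \<open>\<gamma> \<ge> 1 / \<surd>2\<close>, so that the single
    summand \<open>?g 2 2\<close> in the bound for \<open>Y13\<close> is absorbed by a multiple of \<open>\<gamma>\<close>.\<close>
  have degenerate: "min e h = 0 \<Longrightarrow> ?g 2 2 = 0"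
    by (auto simp: pair_norm_def frobenius_norm_def min_def split: if_splits)
  define x y where "x = 2 * gamma_const e h * ?g 2 2" and "y = (2 + sqrt 2) * gamma_const e h * ?g 2 2"
  have xy: "frobenius_norm X31 \<le> x" "frobenius_norm Y13 \<le> y"
  proof -
    have "sqrt 2 * real (min e h) \<le> 2 * gamma_const e h"
      by (simp add: gamma_const_def field_simps real_sqrt_mult[symmetric] min_def)
    from mult_right_mono[OF this pair_norm_nonneg[of "?G0 2 2" "?G1 2 2"]]
    have L: "sqrt 2 * real (min e h) * ?g 2 2 \<le> x" unfolding x_def by simp
    have "?g 2 2 \<le> sqrt 2 * gamma_const e h * ?g 2 2"
    proof (cases "min e h = 0")
      case False
      then have "2 \<le> real e + real h" by simp
      then have "1 \<le> sqrt 2 * gamma_const e h"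
        by (simp add: gamma_const_def add_divide_distrib[symmetric])
      then show ?thesis using mult_right_mono[OF _ pair_norm_nonneg[of "?G0 2 2" "?G1 2 2"]] by fastforce
    qed (simp add: degenerate)
    then show "frobenius_norm X31 \<le> x" "frobenius_norm Y13 \<le> y"
      using norms L unfolding x_def y_def by (simp_all add: algebra_simps)
  qed
  have x0: "0 \<le> x" "0 \<le> y" by (simp_all add: x_def y_def gamma_const_def)
  \<comment> \<open>The two unknowns of a block equation with the Stein constant \<open>mu\<close> together, for data that include a
    coupling term of size \<open>z\<close>; then \<open>k = 1 + 2 mu\<close> is \<open>\<alpha>\<close> or \<open>\<beta>\<close>.\<close>
  have half: "t + u \<le> sqrt 2 * k * g + k * z"
    if "t \<le> b1 + mu * (b0 + b1)" "u \<le> mu * (b0 + b1)" "b0 \<le> c0 + z" "c0 + b1 \<le> sqrt 2 * g"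
      "b1 \<le> g" "0 \<le> mu" "0 \<le> z" "k = 1 + 2 * mu" "0 \<le> g" for t u b0 b1 c0 mu g z k :: real
  proof -
    have "mu * (b0 + b1) \<le> mu * (sqrt 2 * g + z)" using that by (intro mult_left_mono) auto
    then have "t + u \<le> g + 2 * (mu * (sqrt 2 * g + z))" using that by linarith
    also have "\<dots> \<le> sqrt 2 * k * g + k * z"
    proof -
      have "1 * g \<le> sqrt 2 * g" using that by (intro mult_right_mono) auto
      then show ?thesis using that by (simp add: algebra_simps)
    qed
    finally show ?thesis .
  qed
  have b32: "frobenius_norm X32 + frobenius_norm Y12
    \<le> sqrt 2 * ab_const e A * ?g 2 1 + ab_const e A * (x * spectral_norm C)"
  proof (rule half[OF n32])
    show "frobenius_norm (?G0 2 1 - P32) \<le> frobenius_norm (?G0 2 1) + x * spectral_norm C"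
      using frobenius_norm_triangle_minus[OF Gc(3) P32] mult_right_mono[OF xy(1) spectral_norm_nonneg[of C]]
        \<open>frobenius_norm P32 \<le> _\<close> by linarith
  qed (use pair_norm_sum[of "?G0 2 1" "?G1 2 1"] pair_norm_ge[where H = "?G1 2 1"] x0 in
      \<open>auto simp: ab_const_def\<close>)
  have b23: "frobenius_norm Y23 + frobenius_norm X21
    \<le> sqrt 2 * ab_const h A * ?g 1 2 + ab_const h A * (y * spectral_norm B)"
  proof (rule half[OF n23(2,1)])
    show "frobenius_norm (?G0 1 2 - P23) \<le> frobenius_norm (?G0 1 2) + y * spectral_norm B"
      using frobenius_norm_triangle_minus[OF Gc(1) P23] mult_right_mono[OF xy(2) spectral_norm_nonneg[of B]]
        \<open>frobenius_norm P23 \<le> _\<close> by (simp add: mult.commute)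
  qed (use pair_norm_sum[of "?G0 1 2" "?G1 1 2"] pair_norm_ge[where H = "?G1 1 2"] x0 in
      \<open>auto simp: ab_const_def\<close>)
  have "(?g 2 2)\<^sup>2 + (?g 2 1)\<^sup>2 + (?g 1 2)\<^sup>2 \<le> (pair_norm G0 G1)\<^sup>2"
    unfolding pair_norm_sq_blocks[OF G0 G1] by (simp add: sum_less_3)
  then have "x + y + (sqrt 2 * ab_const e A * ?g 2 1 + ab_const e A * (x * spectral_norm C))
     + (sqrt 2 * ab_const h A * ?g 1 2 + ab_const h A * (y * spectral_norm B))
    \<le> 6 * s_const e h A B C * pair_norm G0 G1"
    unfolding x_def y_def s_const_def Let_def
    by (intro elimination_bound) (simp_all add: gamma_const_def ab_const_def)
  then have n: "frobenius_norm ?X + frobenius_norm ?Y \<le> 6 * s_const e h A B C * pair_norm G0 G1"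
    using nX nY xy b32 b23 by linarith
  show thesis
    by (rule that[OF X Y _ _ _ n]) (simp_all only: 1 2 3 4 5 6 sizes simp_thms)
qed

text \<open>Both later stages consist of two independent block equations, whose solutions are bounded by \<open>1 + a\<close>
  and by \<open>a\<close> times their data \<open>u\<close> or \<open>v\<close>, and possibly one more block bounded by its datum \<open>w\<close>. The constant
  is the square root of \<open>2 ((1 + a)\<^sup>2 + a\<^sup>2)\<close>.\<close>

lemma joint_bound:
  assumes X: "(frobenius_norm X)\<^sup>2 \<le> x1\<^sup>2 + x2\<^sup>2 + x3\<^sup>2" and Y: "(frobenius_norm Y)\<^sup>2 \<le> y1\<^sup>2 + y2\<^sup>2"
    and x: "0 \<le> x1" "x1 \<le> (1 + a) * u" "0 \<le> y1" "y1 \<le> a * u" "0 \<le> x2" "x2 \<le> a * v" "0 \<le> y2" "y2 \<le> (1 + a) * v"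
      "0 \<le> x3" "x3 \<le> w"
    and g: "u\<^sup>2 + v\<^sup>2 + w\<^sup>2 \<le> g\<^sup>2" "0 \<le> g" "0 \<le> a"
  shows "frobenius_norm X + frobenius_norm Y \<le> sqrt (4 * a\<^sup>2 + 4 * a + 2) * g"
proof (rule power2_le_imp_le)
  have "x1\<^sup>2 \<le> ((1 + a) * u)\<^sup>2" "y1\<^sup>2 \<le> (a * u)\<^sup>2" "x2\<^sup>2 \<le> (a * v)\<^sup>2" "y2\<^sup>2 \<le> ((1 + a) * v)\<^sup>2" "x3\<^sup>2 \<le> w\<^sup>2"
    using x by (auto intro: power_mono)
  then have "(frobenius_norm X)\<^sup>2 + (frobenius_norm Y)\<^sup>2 \<le> (2 * a\<^sup>2 + 2 * a + 1) * (u\<^sup>2 + v\<^sup>2) + w\<^sup>2"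
  proof -
    have "((1 + a) * u)\<^sup>2 + (a * u)\<^sup>2 + (a * v)\<^sup>2 + ((1 + a) * v)\<^sup>2 = (2 * a\<^sup>2 + 2 * a + 1) * (u\<^sup>2 + v\<^sup>2)"
      by (simp add: power2_eq_square algebra_simps)
    moreover assume "x1\<^sup>2 \<le> ((1 + a) * u)\<^sup>2" "y1\<^sup>2 \<le> (a * u)\<^sup>2" "x2\<^sup>2 \<le> (a * v)\<^sup>2" "y2\<^sup>2 \<le> ((1 + a) * v)\<^sup>2" "x3\<^sup>2 \<le> w\<^sup>2"
    ultimately show ?thesis using X Y by linarith
  qed
  also have "\<dots> \<le> (2 * a\<^sup>2 + 2 * a + 1) * (u\<^sup>2 + v\<^sup>2) + (2 * a\<^sup>2 + 2 * a + 1) * w\<^sup>2"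
    using g mult_right_mono[of 1 "2 * a\<^sup>2 + 2 * a + 1" "w\<^sup>2"] by simp
  also have "\<dots> = (2 * a\<^sup>2 + 2 * a + 1) * (u\<^sup>2 + v\<^sup>2 + w\<^sup>2)" by (simp add: algebra_simps)
  also have "\<dots> \<le> (2 * a\<^sup>2 + 2 * a + 1) * g\<^sup>2"
    using g by (intro mult_left_mono) auto
  finally have "2 * ((frobenius_norm X)\<^sup>2 + (frobenius_norm Y)\<^sup>2) \<le> (4 * a\<^sup>2 + 4 * a + 2) * g\<^sup>2"
    by (simp add: algebra_simps)
  moreover have "(frobenius_norm X + frobenius_norm Y)\<^sup>2 \<le> 2 * ((frobenius_norm X)\<^sup>2 + (frobenius_norm Y)\<^sup>2)"
    using sum_squares_bound[of "frobenius_norm X" "frobenius_norm Y"] by (simp add: power2_sum)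
  ultimately show "(frobenius_norm X + frobenius_norm Y)\<^sup>2 \<le> (sqrt (4 * a\<^sup>2 + 4 * a + 2) * g)\<^sup>2"
    using g by (simp add: power_mult_distrib)
qed (use g in auto)

text \<open>The second stage. Block diagonal \<open>X\<close> and \<open>Y\<close> do not reintroduce anything into the three blocks that have been
  cleared, because \<open>X S + S Y\<close> then vanishes there like \<open>S\<close> itself. The middle part of \<open>X\<close> cancels
  the perturbation of the coefficient \<open>- I\<close> in the state block.\<close>

lemma restore_kronecker_blocks:
  assumes G0: "G0 \<in> carrier_mat nr nc" and G1: "G1 \<in> carrier_mat nr nc"
    and van: "vanish 1 2 G0 G1" "vanish 2 1 G0 G1" "vanish 2 2 G0 G1"
  defines "a \<equiv> sqrt 2 * real (max e h)"
  obtains X Y where "X \<in> carrier_mat nr nr" "Y \<in> carrier_mat nc nc"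
    "vanish 1 2 (residual S0 X Y G0) (residual S1 X Y G1)"
    "vanish 2 1 (residual S0 X Y G0) (residual S1 X Y G1)"
    "vanish 2 2 (residual S0 X Y G0) (residual S1 X Y G1)"
    "vanish 0 2 (residual S0 X Y G0) (residual S1 X Y G1)"
    "vanish 2 0 (residual S0 X Y G0) (residual S1 X Y G1)"
    "blk rs cs 1 1 (residual S1 X Y G1) = 0\<^sub>m l l"
    "frobenius_norm X + frobenius_norm Y \<le> sqrt (4 * a\<^sup>2 + 4 * a + 2) * pair_norm G0 G1"
proof -
  let ?G0 = "\<lambda>a b. blk rs cs a b G0" and ?G1 = "\<lambda>a b. blk rs cs a b G1"
  let ?g = "\<lambda>a b. pair_norm (?G0 a b) (?G1 a b)"
  have Gc: "?G0 a b \<in> carrier_mat (rs ! a) (cs ! b)" "?G1 a b \<in> carrier_mat (rs ! a) (cs ! b)" for a b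
    by simp_all
  note Gc = Gc[of 0 2, unfolded sizes] Gc[of 2 0, unfolded sizes] Gc[of 1 1, unfolded sizes]
  have W: "?G0 0 2 \<in> carrier_mat p (h * m)" "- ?G1 0 2 \<in> carrier_mat p (h * m)"
    using Gc by (simp_all only: uminus_carrier_iff_mat)
  obtain X11 Y33 where X11: "X11 \<in> carrier_mat p p" and Y33: "Y33 \<in> carrier_mat (h * m) (h * m)"
    and e13: "X11 * (K_low h m)\<^sup>T + (K_low h m)\<^sup>T * Y33 = ?G0 0 2"
      "X11 * (K_high h m)\<^sup>T + (K_high h m)\<^sup>T * Y33 = - ?G1 0 2"
    and n13: "frobenius_norm X11 \<le> pair_norm (?G0 0 2) (- ?G1 0 2) + sqrt 2 * real h * pair_norm (?G0 0 2) (- ?G1 0 2)"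
      "frobenius_norm Y33 \<le> sqrt 2 * real h * pair_norm (?G0 0 2) (- ?G1 0 2)"
    using solve_column_kronecker_block[OF W[unfolded p_def]] unfolding p_def by metis
  have W: "?G0 2 0 \<in> carrier_mat (e * n) q" "- ?G1 2 0 \<in> carrier_mat (e * n) q"
    using Gc by (simp_all only: uminus_carrier_iff_mat)
  obtain X33 Y11 where X33: "X33 \<in> carrier_mat (e * n) (e * n)" and Y11: "Y11 \<in> carrier_mat q q"
    and e31: "X33 * K_low e n + K_low e n * Y11 = ?G0 2 0"
      "X33 * K_high e n + K_high e n * Y11 = - ?G1 2 0"
    and n31: "frobenius_norm X33 \<le> sqrt 2 * real e * pair_norm (?G0 2 0) (- ?G1 2 0)"
      "frobenius_norm Y11 \<le> pair_norm (?G0 2 0) (- ?G1 2 0) + sqrt 2 * real e * pair_norm (?G0 2 0) (- ?G1 2 0)"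
    using solve_row_kronecker_block[OF W[unfolded q_def]] unfolding q_def by metis
  \<comment> \<open>The block of \<open>S1\<close> at \<open>(1, 1)\<close> is \<open>- I\<close>.\<close>
  define X22 where "X22 = - ?G1 1 1"
  have X22: "X22 \<in> carrier_mat l l" "frobenius_norm X22 \<le> ?g 1 1" and e22: "X22 = - blk rs cs (Suc 0) (Suc 0) G1"
    unfolding X22_def using Gc by (simp_all add: pair_norm_ge)
  let ?f = "grid X11 (0\<^sub>m p l) (0\<^sub>m p (e * n)) (0\<^sub>m l p) X22 (0\<^sub>m l (e * n))
    (0\<^sub>m (e * n) p) (0\<^sub>m (e * n) l) X33"
  let ?g' = "grid Y11 (0\<^sub>m q l) (0\<^sub>m q (h * m)) (0\<^sub>m l q) (0\<^sub>m l l) (0\<^sub>m l (h * m))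
    (0\<^sub>m (h * m) q) (0\<^sub>m (h * m) l) Y33"
  have f: "?f a b \<in> carrier_mat (rs ! a) (rs ! b)" and g: "?g' a b \<in> carrier_mat (cs ! a) (cs ! b)"
    if "a < 3" "b < 3" for a b
    using that Gc by (auto intro!: grid_carrier simp: X11 X33 Y11 Y33 X22)
  note r0 = blk_residual_assemble[OF _ _ S_carrier(1) G0 f g]
    and r1 = blk_residual_assemble[OF _ _ S_carrier(2) G1 f g]
  have prod: "X11 * (K_high h m)\<^sup>T \<in> carrier_mat p (h * m)" "(K_high h m)\<^sup>T * Y33 \<in> carrier_mat p (h * m)"
    "X33 * K_high e n \<in> carrier_mat (e * n) q" "K_high e n * Y11 \<in> carrier_mat (e * n) q"
    using X11 X33 Y11 Y33 K_sizes by auto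
  note facts = K_sizes X11 X33 Y11 Y33 X22(1) A B C prod Gc van
  let ?X = "assemble rs rs ?f" and ?Y = "assemble cs cs ?g'"
  have 1: "blk rs cs 1 2 (residual S0 ?X ?Y G0) = 0\<^sub>m l (h * m)" "blk rs cs 1 2 (residual S1 ?X ?Y G1) = 0\<^sub>m l (h * m)"
    "blk rs cs 2 1 (residual S0 ?X ?Y G0) = 0\<^sub>m (e * n) l" "blk rs cs 2 1 (residual S1 ?X ?Y G1) = 0\<^sub>m (e * n) l"
    "blk rs cs 2 2 (residual S0 ?X ?Y G0) = 0\<^sub>m (e * n) (h * m)" "blk rs cs 2 2 (residual S1 ?X ?Y G1) = 0\<^sub>m (e * n) (h * m)"
    using facts by (simp_all add: r0 r1 S_blocks zero_mult_dim uminus_zero_block K_dims del: K_carrier)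
  have 2: "blk rs cs 0 2 (residual S0 ?X ?Y G0) = 0\<^sub>m p (h * m)" "blk rs cs 2 0 (residual S0 ?X ?Y G0) = 0\<^sub>m (e * n) q"
    using facts by (simp_all add: r0 S_blocks e13 e31 zero_mult_dim uminus_zero_block K_dims del: K_carrier)
  have 3: "blk rs cs 0 2 (residual S1 ?X ?Y G1) = 0\<^sub>m p (h * m)"
    using facts by (simp add: r1 S_blocks zero_mult_dim uminus_zero_block K_dims e13 uminus_add_block[OF prod(1,2)] uminus_mult_carrier del: K_carrier)
  have 4: "blk rs cs 2 0 (residual S1 ?X ?Y G1) = 0\<^sub>m (e * n) q"
    using facts by (simp add: r1 S_blocks zero_mult_dim uminus_zero_block K_dims e31 uminus_add_block[OF prod(3,4)] uminus_mult_carrier del: K_carrier)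
  have 5: "blk rs cs 1 1 (residual S1 ?X ?Y G1) = 0\<^sub>m l l"
    using facts by (simp add: r1 S_blocks zero_mult_dim uminus_zero_block K_dims uminus_mult_carrier[of _ l l _ l] del: K_carrier)
      (simp add: e22)
  have X: "?X \<in> carrier_mat nr nr" and Y: "?Y \<in> carrier_mat nc nc"
    using assemble_carrier[of rs rs ?f] assemble_carrier[of cs cs ?g'] by (simp_all only: sizes)
  have nX: "(frobenius_norm ?X)\<^sup>2 \<le> (frobenius_norm X11)\<^sup>2 + (frobenius_norm X33)\<^sup>2 + (frobenius_norm X22)\<^sup>2"
    by (simp add: frobenius_norm_sq_assemble f sum_less_3)
  have nY: "(frobenius_norm ?Y)\<^sup>2 \<le> (frobenius_norm Y33)\<^sup>2 + (frobenius_norm Y11)\<^sup>2"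
    by (simp add: frobenius_norm_sq_assemble g sum_less_3)
  have scale: "sqrt 2 * real k * t \<le> a * t" if "k \<le> max e h" "0 \<le> t" for k t
    unfolding a_def using that by (intro mult_right_mono mult_left_mono) auto
  have sq: "(?g 0 2)\<^sup>2 + (?g 2 0)\<^sup>2 + (?g 1 1)\<^sup>2 \<le> (pair_norm G0 G1)\<^sup>2"
    unfolding pair_norm_sq_blocks[OF G0 G1] by (simp add: sum_less_3)
  have "frobenius_norm X11 \<le> (1 + a) * ?g 0 2" "frobenius_norm Y33 \<le> a * ?g 0 2"
    "frobenius_norm X33 \<le> a * ?g 2 0" "frobenius_norm Y11 \<le> (1 + a) * ?g 2 0"
    using n13 n31 scale[of h "?g 0 2"] scale[of e "?g 2 0"]
    by (simp_all add: pair_norm_def distrib_right)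
  then have n: "frobenius_norm ?X + frobenius_norm ?Y \<le> sqrt (4 * a\<^sup>2 + 4 * a + 2) * pair_norm G0 G1"
    by (intro joint_bound[OF nX nY _ _ _ _ _ _ _ _ _ _ sq]) (simp_all add: X22(2)[unfolded One_nat_def] a_def)
  show thesis
    by (rule that[OF X Y _ _ _ _ _ _ n]) (simp_all only: 1 2 3 4 5 sizes simp_thms)
qed

text \<open>The third stage. The only nonzero parts of \<open>X\<close> and \<open>Y\<close> are \<open>X12\<close>, \<open>X23\<close>, \<open>Y21\<close> and \<open>Y32\<close>. In the
  blocks that have been dealt with they are multiplied by zero blocks of \<open>S\<close>, so that these blocks are
  preserved. What
  remains in the two blocks under consideration has the form of the blocks that contain \<open>C\<close> and \<open>B\<close>.\<close>

lemma restore_state_blocks: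
  assumes G0: "G0 \<in> carrier_mat nr nc" and G1: "G1 \<in> carrier_mat nr nc"
    and van: "vanish 1 2 G0 G1" "vanish 2 1 G0 G1" "vanish 2 2 G0 G1" "vanish 0 2 G0 G1" "vanish 2 0 G0 G1"
      "blk rs cs 1 1 G1 = 0\<^sub>m l l"
  defines "a \<equiv> sqrt 2 * (real (max e h) * max 1 (spectral_norm A ^ max e h))"
  obtains X Y B' C' where "X \<in> carrier_mat nr nr" "Y \<in> carrier_mat nc nc"
    "B' \<in> carrier_mat l n" "C' \<in> carrier_mat m l"
    "vanish 1 2 (residual S0 X Y G0) (residual S1 X Y G1)"
    "vanish 2 1 (residual S0 X Y G0) (residual S1 X Y G1)"
    "vanish 2 2 (residual S0 X Y G0) (residual S1 X Y G1)"
    "vanish 0 2 (residual S0 X Y G0) (residual S1 X Y G1)"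
    "vanish 2 0 (residual S0 X Y G0) (residual S1 X Y G1)"
    "blk rs cs 1 1 (residual S1 X Y G1) = 0\<^sub>m l l"
    "blk rs cs 0 1 (residual S0 X Y G0) = (K_last h m)\<^sup>T * C'" "blk rs cs 0 1 (residual S1 X Y G1) = 0\<^sub>m p l"
    "blk rs cs 1 0 (residual S0 X Y G0) = B' * K_last e n" "blk rs cs 1 0 (residual S1 X Y G1) = 0\<^sub>m l q"
    "frobenius_norm X + frobenius_norm Y \<le> sqrt (4 * a\<^sup>2 + 4 * a + 2) * pair_norm G0 G1"
proof -
  let ?G0 = "\<lambda>a b. blk rs cs a b G0" and ?G1 = "\<lambda>a b. blk rs cs a b G1"
  let ?g = "\<lambda>a b. pair_norm (?G0 a b) (?G1 a b)"
  have Gc: "?G0 a b \<in> carrier_mat (rs ! a) (cs ! b)" "?G1 a b \<in> carrier_mat (rs ! a) (cs ! b)" for a b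
    by simp_all
  note Gc = Gc[of 0 1, unfolded sizes] Gc[of 1 0, unfolded sizes] Gc[of 1 1, unfolded sizes]
  have W: "?G0 0 1 \<in> carrier_mat p l" "- ?G1 0 1 \<in> carrier_mat p l"
    using Gc by (simp_all only: uminus_carrier_iff_mat)
  obtain X12 Y32 C' where X12: "X12 \<in> carrier_mat p l" and Y32: "Y32 \<in> carrier_mat (h * m) l"
    and C': "C' \<in> carrier_mat m l"
    and e12: "X12 * A + (K_low h m)\<^sup>T * Y32 + (K_last h m)\<^sup>T * C' = ?G0 0 1"
      "X12 + (K_high h m)\<^sup>T * Y32 = - ?G1 0 1"
    and n12: "frobenius_norm X12 \<le> frobenius_norm (- ?G1 0 1) + real h * max 1 (spectral_norm A ^ h) *
        (frobenius_norm (?G0 0 1) + frobenius_norm (- ?G1 0 1))"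
      "frobenius_norm Y32 \<le> real h * max 1 (spectral_norm A ^ h) *
        (frobenius_norm (?G0 0 1) + frobenius_norm (- ?G1 0 1))"
    using solve_output_state_block[OF W[unfolded p_def] A] unfolding p_def by metis
  have W: "?G0 1 0 \<in> carrier_mat l q" "- ?G1 1 0 \<in> carrier_mat l q"
    using Gc by (simp_all only: uminus_carrier_iff_mat)
  obtain X23 Y21 B' where X23: "X23 \<in> carrier_mat l (e * n)" and Y21: "Y21 \<in> carrier_mat l q"
    and B': "B' \<in> carrier_mat l n"
    and e21: "X23 * K_low e n + A * Y21 + B' * K_last e n = ?G0 1 0"
      "X23 * K_high e n + Y21 = - ?G1 1 0"
    and n21: "frobenius_norm X23 \<le> real e * max 1 (spectral_norm A ^ e) *
        (frobenius_norm (?G0 1 0) + frobenius_norm (- ?G1 1 0))"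
      "frobenius_norm Y21 \<le> frobenius_norm (- ?G1 1 0) + real e * max 1 (spectral_norm A ^ e) *
        (frobenius_norm (?G0 1 0) + frobenius_norm (- ?G1 1 0))"
    using solve_state_input_block[OF W[unfolded q_def] A] unfolding q_def by metis
  let ?f = "grid (0\<^sub>m p p) X12 (0\<^sub>m p (e * n)) (0\<^sub>m l p) (0\<^sub>m l l) X23
    (0\<^sub>m (e * n) p) (0\<^sub>m (e * n) l) (0\<^sub>m (e * n) (e * n))"
  let ?g' = "grid (0\<^sub>m q q) (0\<^sub>m q l) (0\<^sub>m q (h * m)) Y21 (0\<^sub>m l l) (0\<^sub>m l (h * m))
    (0\<^sub>m (h * m) q) Y32 (0\<^sub>m (h * m) (h * m))"
  have f: "?f a b \<in> carrier_mat (rs ! a) (rs ! b)" and g: "?g' a b \<in> carrier_mat (cs ! a) (cs ! b)"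
    if "a < 3" "b < 3" for a b
    using that Gc by (auto intro!: grid_carrier simp: X12 X23 Y21 Y32)
  note r0 = blk_residual_assemble[OF _ _ S_carrier(1) G0 f g]
    and r1 = blk_residual_assemble[OF _ _ S_carrier(2) G1 f g]
  have prod: "X12 * A \<in> carrier_mat p l" "(K_low h m)\<^sup>T * Y32 \<in> carrier_mat p l" "(K_last h m)\<^sup>T * C' \<in> carrier_mat p l"
    "(K_high h m)\<^sup>T * Y32 \<in> carrier_mat p l"
    "X23 * K_low e n \<in> carrier_mat l q" "A * Y21 \<in> carrier_mat l q" "B' * K_last e n \<in> carrier_mat l q"
    "X23 * K_high e n \<in> carrier_mat l q"
    using X12 X23 Y21 Y32 A B' C' K_sizes by auto
  note facts = K_sizes X12 X23 Y21 Y32 A B C B' C' prod Gc van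
  let ?X = "assemble rs rs ?f" and ?Y = "assemble cs cs ?g'"
  have 1: "blk rs cs 1 2 (residual S0 ?X ?Y G0) = 0\<^sub>m l (h * m)" "blk rs cs 1 2 (residual S1 ?X ?Y G1) = 0\<^sub>m l (h * m)"
    "blk rs cs 2 1 (residual S0 ?X ?Y G0) = 0\<^sub>m (e * n) l" "blk rs cs 2 1 (residual S1 ?X ?Y G1) = 0\<^sub>m (e * n) l"
    "blk rs cs 2 2 (residual S0 ?X ?Y G0) = 0\<^sub>m (e * n) (h * m)" "blk rs cs 2 2 (residual S1 ?X ?Y G1) = 0\<^sub>m (e * n) (h * m)"
    "blk rs cs 0 2 (residual S0 ?X ?Y G0) = 0\<^sub>m p (h * m)" "blk rs cs 0 2 (residual S1 ?X ?Y G1) = 0\<^sub>m p (h * m)"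
    "blk rs cs 2 0 (residual S0 ?X ?Y G0) = 0\<^sub>m (e * n) q" "blk rs cs 2 0 (residual S1 ?X ?Y G1) = 0\<^sub>m (e * n) q"
    "blk rs cs 1 1 (residual S1 ?X ?Y G1) = 0\<^sub>m l l"
    using facts by (simp_all add: r0 r1 S_blocks zero_mult_dim uminus_zero_block K_dims del: K_carrier)
  have 2: "blk rs cs 0 1 (residual S0 ?X ?Y G0) = (K_last h m)\<^sup>T * C'"
    using facts by (simp add: r0 S_blocks zero_mult_dim uminus_zero_block K_dims e12(1)[symmetric, unfolded One_nat_def] cancel_sum_block[OF prod(1,2,3)] del: K_carrier)
  have 3: "blk rs cs 1 0 (residual S0 ?X ?Y G0) = B' * K_last e n"
    using facts by (simp add: r0 S_blocks zero_mult_dim uminus_zero_block K_dims e21(1)[symmetric, unfolded One_nat_def] cancel_sum_block[OF prod(5,6,7)] del: K_carrier)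
  have 4: "blk rs cs 0 1 (residual S1 ?X ?Y G1) = 0\<^sub>m p l"
    using facts by (simp add: r1 S_blocks zero_mult_dim uminus_zero_block K_dims e12 uminus_add_block[OF X12 prod(4)] uminus_mult_carrier del: K_carrier)
  have 5: "blk rs cs 1 0 (residual S1 ?X ?Y G1) = 0\<^sub>m l q"
    using facts by (simp add: r1 S_blocks zero_mult_dim uminus_zero_block K_dims e21 uminus_add_block[OF prod(8) Y21] uminus_mult_carrier del: K_carrier)
  have X: "?X \<in> carrier_mat nr nr" and Y: "?Y \<in> carrier_mat nc nc"
    using assemble_carrier[of rs rs ?f] assemble_carrier[of cs cs ?g'] by (simp_all only: sizes)
  have nX: "(frobenius_norm ?X)\<^sup>2 \<le> (frobenius_norm X12)\<^sup>2 + (frobenius_norm X23)\<^sup>2 + 0\<^sup>2"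
    by (simp add: frobenius_norm_sq_assemble f sum_less_3)
  have nY: "(frobenius_norm ?Y)\<^sup>2 \<le> (frobenius_norm Y32)\<^sup>2 + (frobenius_norm Y21)\<^sup>2"
    by (simp add: frobenius_norm_sq_assemble g sum_less_3)
  have scale: "real k * max 1 (spectral_norm A ^ k) * (frobenius_norm U + frobenius_norm V) \<le> a * pair_norm U V"
    if "k \<le> max e h" for k U V
  proof -
    have "max 1 (spectral_norm A ^ k) \<le> max 1 (spectral_norm A ^ max e h)"
      using power_le_max_one_power[OF spectral_norm_nonneg that, of A] by simp
    then have "real k * max 1 (spectral_norm A ^ k) \<le> real (max e h) * max 1 (spectral_norm A ^ max e h)"
      using that by (intro mult_mono)
        (assumption | simp only: of_nat_le_iff of_nat_0_le_iff | simp only: le_max_iff_disj zero_le_one simp_thms)+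
    then have "real k * max 1 (spectral_norm A ^ k) * (frobenius_norm U + frobenius_norm V)
      \<le> (real (max e h) * max 1 (spectral_norm A ^ max e h)) * (sqrt 2 * pair_norm U V)"
      by (rule mult_mono[OF _ pair_norm_sum]) (auto simp: le_max_iff_disj)
    then show ?thesis unfolding a_def by (simp add: mult_ac)
  qed
  have sq: "(?g 0 1)\<^sup>2 + (?g 1 0)\<^sup>2 + 0\<^sup>2 \<le> (pair_norm G0 G1)\<^sup>2"
    unfolding pair_norm_sq_blocks[OF G0 G1] by (simp add: sum_less_3)
  have "frobenius_norm X12 \<le> (1 + a) * ?g 0 1" "frobenius_norm Y32 \<le> a * ?g 0 1"
    "frobenius_norm X23 \<le> a * ?g 1 0" "frobenius_norm Y21 \<le> (1 + a) * ?g 1 0"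
    using n12 n21 scale[of h "?G0 0 1" "?G1 0 1"] scale[of e "?G0 1 0" "?G1 1 0"]
      pair_norm_ge(2)[of "?G1 0 1" "?G0 0 1"] pair_norm_ge(2)[of "?G1 1 0" "?G0 1 0"]
    by (simp_all add: distrib_right)
  then have n: "frobenius_norm ?X + frobenius_norm ?Y \<le> sqrt (4 * a\<^sup>2 + 4 * a + 2) * pair_norm G0 G1"
    by (intro joint_bound[OF nX nY _ _ _ _ _ _ _ _ _ _ sq]) (simp_all add: a_def le_max_iff_disj)
  show thesis
    by (rule that[OF X Y B' C' _ _ _ _ _ _ _ _ _ _ n]) (simp_all only: 1 2 3 4 5 sizes simp_thms)
qed

text \<open>The places of the constant coefficient that a change of \<open>A\<close>, \<open>B\<close>, \<open>C\<close>, \<open>M\<close> can affect: the corner block, the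
  last block row of the block containing \<open>C\<close> together with the last block column of the block containing
  \<open>B\<close>, and the state block. In the other coefficient it is the corner block alone. Describing structured
  pairs by vanishing entries makes it evident that they form a closed linear subspace.\<close>

definition free0 :: "nat \<Rightarrow> nat \<Rightarrow> bool" where
  "free0 i j \<longleftrightarrow> (i < p \<and> j < q) \<or> (h * m \<le> i \<and> i < p \<and> q \<le> j \<and> j < q + l)
     \<or> (p \<le> i \<and> i < p + l \<and> e * n \<le> j \<and> j < q + l)"

definition free1 :: "nat \<Rightarrow> nat \<Rightarrow> bool" where
  "free1 i j \<longleftrightarrow> i < p \<and> j < q"

definition structured :: "'a mat \<Rightarrow> 'a mat \<Rightarrow> bool" where
  "structured R0 R1 \<longleftrightarrow> R0 \<in> carrier_mat nr nc \<and> R1 \<in> carrier_mat nr nc \<and>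
     (\<forall>i<nr. \<forall>j<nc. (\<not> free0 i j \<longrightarrow> R0 $$ (i, j) = 0) \<and> (\<not> free1 i j \<longrightarrow> R1 $$ (i, j) = 0))"

definition spectral_size :: real where
  "spectral_size = sqrt ((spectral_norm S0)\<^sup>2 + (spectral_norm S1)\<^sup>2)"

lemma residual_carrier:
  assumes "S \<in> carrier_mat nr nc" "X \<in> carrier_mat nr nr" "Y \<in> carrier_mat nc nc"
  shows "X * S \<in> carrier_mat nr nc" "S * Y \<in> carrier_mat nr nc" "X * S + S * Y \<in> carrier_mat nr nc"
    "residual S X Y G \<in> carrier_mat nr nc"
  using assms by (auto intro!: minus_carrier_mat)

lemma residual_norm:
  assumes G: "G0 \<in> carrier_mat nr nc" "G1 \<in> carrier_mat nr nc"
    and X: "X \<in> carrier_mat nr nr" and Y: "Y \<in> carrier_mat nc nc"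
    and b: "frobenius_norm X + frobenius_norm Y \<le> k * pair_norm G0 G1"
  shows "pair_norm (residual S0 X Y G0) (residual S1 X Y G1) \<le> (1 + k * spectral_size) * pair_norm G0 G1"
proof -
  let ?t = "frobenius_norm X + frobenius_norm Y"
  have D: "frobenius_norm (X * S + S * Y) \<le> ?t * spectral_norm S" if S: "S \<in> carrier_mat nr nc" for S
  proof -
    note rc = residual_carrier[OF S X Y]
    have "frobenius_norm (X * S + S * Y) \<le> frobenius_norm (X * S) + frobenius_norm (S * Y)"
      by (rule frobenius_norm_triangle[OF rc(1,2)])
    also have "\<dots> \<le> frobenius_norm X * spectral_norm S + spectral_norm S * frobenius_norm Y"
      by (intro add_mono frobenius_norm_mult_spectral_right[OF X S] frobenius_norm_mult_spectral_left[OF S Y])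
    finally show ?thesis by (simp add: algebra_simps)
  qed
  have "pair_norm (X * S0 + S0 * Y) (X * S1 + S1 * Y) \<le> sqrt ((?t * spectral_norm S0)\<^sup>2 + (?t * spectral_norm S1)\<^sup>2)"
    unfolding pair_norm_def
    by (intro real_sqrt_le_mono add_mono power_mono D S_carrier) simp_all
  also have "\<dots> = ?t * spectral_size"
    unfolding spectral_size_def power_mult_distrib distrib_left[symmetric] real_sqrt_mult by simp
  also have "\<dots> \<le> k * pair_norm G0 G1 * spectral_size"
    using b by (intro mult_right_mono) (simp_all add: spectral_size_def)
  finally have "pair_norm (X * S0 + S0 * Y) (X * S1 + S1 * Y) \<le> k * pair_norm G0 G1 * spectral_size" .
  moreover have "pair_norm (residual S0 X Y G0) (residual S1 X Y G1)
    \<le> pair_norm G0 G1 + pair_norm (X * S0 + S0 * Y) (X * S1 + S1 * Y)"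
    by (intro pair_norm_triangle_minus[of _ nr nc] G residual_carrier(3)[OF S_carrier(1) X Y] residual_carrier(3)[OF S_carrier(2) X Y])
  ultimately show ?thesis by (simp add: algebra_simps)
qed

text \<open>Remainders compose additively, so that the corrections of the three stages can be added up.\<close>

lemma residual_residual:
  assumes S: "S \<in> carrier_mat nr nc" and G: "G \<in> carrier_mat nr nc"
    and X: "X \<in> carrier_mat nr nr" "X' \<in> carrier_mat nr nr" and Y: "Y \<in> carrier_mat nc nc" "Y' \<in> carrier_mat nc nc"
  shows "residual S X' Y' (residual S X Y G) = residual S (X + X') (Y + Y') G"
proof -
  note c = residual_carrier(1,2)[OF S X(1) Y(1)] residual_carrier(1,2)[OF S X(2) Y(2)]
  have "residual S (X + X') (Y + Y') G = G - (X * S + X' * S + (S * Y + S * Y'))"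
    by (simp only: add_mult_distrib_mat[OF X S] mult_add_distrib_mat[OF S Y])
  also have "\<dots> = G - (X * S + S * Y) - (X' * S + S * Y')"
    using c G S X Y by (intro eq_matI) (auto simp del: index_mult_mat(1))
  finally show ?thesis ..
qed

lemma first_order_solver:
  assumes G0: "G0 \<in> carrier_mat nr nc" and G1: "G1 \<in> carrier_mat nr nc"
  defines "c1 \<equiv> 6 * s_const e h A B C"
    and "a2 \<equiv> sqrt 2 * real (max e h)"
    and "a3 \<equiv> sqrt 2 * (real (max e h) * max 1 (spectral_norm A ^ max e h))"
  defines "c2 \<equiv> sqrt (4 * a2\<^sup>2 + 4 * a2 + 2)" and "c3 \<equiv> sqrt (4 * a3\<^sup>2 + 4 * a3 + 2)"
  defines "b1 \<equiv> 1 + c1 * spectral_size" and "b2 \<equiv> 1 + c2 * spectral_size" and "b3 \<equiv> 1 + c3 * spectral_size"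
  obtains X Y where "X \<in> carrier_mat nr nr" "Y \<in> carrier_mat nc nc"
    "structured (residual S0 X Y G0) (residual S1 X Y G1)"
    "frobenius_norm X + frobenius_norm Y \<le> (c1 + c2 * b1 + c3 * b2 * b1) * pair_norm G0 G1"
    "pair_norm (residual S0 X Y G0) (residual S1 X Y G1) \<le> b3 * b2 * b1 * pair_norm G0 G1"
proof -
  obtain X1 Y1 where X1: "X1 \<in> carrier_mat nr nr" and Y1: "Y1 \<in> carrier_mat nc nc"
    and v1: "vanish 1 2 (residual S0 X1 Y1 G0) (residual S1 X1 Y1 G1)"
      "vanish 2 1 (residual S0 X1 Y1 G0) (residual S1 X1 Y1 G1)"
      "vanish 2 2 (residual S0 X1 Y1 G0) (residual S1 X1 Y1 G1)"
    and n1: "frobenius_norm X1 + frobenius_norm Y1 \<le> c1 * pair_norm G0 G1"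
    using eliminate_zero_blocks[OF G0 G1] unfolding c1_def by metis
  define H0 H1 where "H0 = residual S0 X1 Y1 G0" and "H1 = residual S1 X1 Y1 G1"
  have H: "H0 \<in> carrier_mat nr nc" "H1 \<in> carrier_mat nr nc"
    unfolding H0_def H1_def using residual_carrier(4)[OF _ X1 Y1] S_carrier by blast+
  note v1 = v1[folded H0_def H1_def]
  obtain X2 Y2 where X2: "X2 \<in> carrier_mat nr nr" and Y2: "Y2 \<in> carrier_mat nc nc"
    and v2: "vanish 1 2 (residual S0 X2 Y2 H0) (residual S1 X2 Y2 H1)"
      "vanish 2 1 (residual S0 X2 Y2 H0) (residual S1 X2 Y2 H1)"
      "vanish 2 2 (residual S0 X2 Y2 H0) (residual S1 X2 Y2 H1)"
      "vanish 0 2 (residual S0 X2 Y2 H0) (residual S1 X2 Y2 H1)"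
      "vanish 2 0 (residual S0 X2 Y2 H0) (residual S1 X2 Y2 H1)"
      "blk rs cs 1 1 (residual S1 X2 Y2 H1) = 0\<^sub>m l l"
    and n2: "frobenius_norm X2 + frobenius_norm Y2 \<le> c2 * pair_norm H0 H1"
    using restore_kronecker_blocks[OF H v1] unfolding c2_def a2_def by metis
  define J0 J1 where "J0 = residual S0 X2 Y2 H0" and "J1 = residual S1 X2 Y2 H1"
  have J: "J0 \<in> carrier_mat nr nc" "J1 \<in> carrier_mat nr nc"
    unfolding J0_def J1_def using residual_carrier(4)[OF _ X2 Y2] S_carrier by blast+
  note v2 = v2[folded J0_def J1_def]
  obtain X3 Y3 B' C' where X3: "X3 \<in> carrier_mat nr nr" and Y3: "Y3 \<in> carrier_mat nc nc"
    and BC: "B' \<in> carrier_mat l n" "C' \<in> carrier_mat m l"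
    and v3: "vanish 1 2 (residual S0 X3 Y3 J0) (residual S1 X3 Y3 J1)"
      "vanish 2 1 (residual S0 X3 Y3 J0) (residual S1 X3 Y3 J1)"
      "vanish 2 2 (residual S0 X3 Y3 J0) (residual S1 X3 Y3 J1)"
      "vanish 0 2 (residual S0 X3 Y3 J0) (residual S1 X3 Y3 J1)"
      "vanish 2 0 (residual S0 X3 Y3 J0) (residual S1 X3 Y3 J1)"
      "blk rs cs 1 1 (residual S1 X3 Y3 J1) = 0\<^sub>m l l"
      "blk rs cs 0 1 (residual S0 X3 Y3 J0) = (K_last h m)\<^sup>T * C'" "blk rs cs 0 1 (residual S1 X3 Y3 J1) = 0\<^sub>m p l"
      "blk rs cs 1 0 (residual S0 X3 Y3 J0) = B' * K_last e n" "blk rs cs 1 0 (residual S1 X3 Y3 J1) = 0\<^sub>m l q"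
    and n3: "frobenius_norm X3 + frobenius_norm Y3 \<le> c3 * pair_norm J0 J1"
    using restore_state_blocks[OF J v2] unfolding c3_def a3_def by metis
  define R0 R1 where "R0 = residual S0 X3 Y3 J0" and "R1 = residual S1 X3 Y3 J1"
  have R: "R0 \<in> carrier_mat nr nc" "R1 \<in> carrier_mat nr nc"
    unfolding R0_def R1_def using residual_carrier(4)[OF _ X3 Y3] S_carrier by blast+
  note v3 = v3[folded R0_def R1_def]
  define X Y where "X = X1 + X2 + X3" and "Y = Y1 + Y2 + Y3"
  have X: "X \<in> carrier_mat nr nr" and Y: "Y \<in> carrier_mat nc nc"
    unfolding X_def Y_def using X1 X2 X3 Y1 Y2 Y3 by auto
  have eq: "residual S X3 Y3 (residual S X2 Y2 (residual S X1 Y1 G)) = residual S X Y G"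
    if "S \<in> carrier_mat nr nc" "G \<in> carrier_mat nr nc" for S G
    unfolding X_def Y_def using that X1 X2 X3 Y1 Y2 Y3 by (simp only: residual_residual add_carrier_mat)
  have R_eq: "R0 = residual S0 X Y G0" "R1 = residual S1 X Y G1"
    unfolding R0_def R1_def J0_def J1_def H0_def H1_def by (rule eq; fact S_carrier G0 G1)+
  have st: "structured R0 R1"
    unfolding structured_def
  proof (intro conjI allI impI R)
    fix i j assume ij: "i < nr" "j < nc"
    then obtain a i' b j' where ab: "a < 3" "i' < rs ! a" "i = off rs a + i'" "b < 3" "j' < cs ! b" "j = off cs b + j'"
      using block_decomp[of rs i] block_decomp[of cs j] by (metis sizes(1,2,3,4))
    have R0e: "R0 $$ (i, j) = blk rs cs a b R0 $$ (i', j')" and R1e: "R1 $$ (i, j) = blk rs cs a b R1 $$ (i', j')"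
      using ab by (simp_all add: blk_def)
    note o = off_simps[OF sizes(1), unfolded sizes] off_simps[OF sizes(2), unfolded sizes]
    { assume nf: "\<not> free0 i j"
      have "blk rs cs a b R0 $$ (i', j') = 0"
        using ab(1,4) unfolding less_3_cases
      proof (elim disjE)
        assume "a = 0" "b = 1"
        then show ?thesis using nf ab o v3(7) BC K_dims p_def unfolding free0_def K_last_def p_def[symmetric]
          by (auto simp: shift_index simp del: index_mult_mat(1))
      next
        assume "a = 1" "b = 0"
        then show ?thesis using nf ab o v3(9) BC q_def unfolding free0_def K_last_def q_def[symmetric]
          by (auto simp: shift_index simp del: index_mult_mat(1))
      qed (use nf ab o v3 in \<open>auto simp: free0_def q_def\<close>)
      then show "R0 $$ (i, j) = 0" using R0e by simp }
    { assume nf: "\<not> free1 i j"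
      have "blk rs cs a b R1 $$ (i', j') = 0"
        using ab(1,4) unfolding less_3_cases
        by (elim disjE) (use nf ab o v3 in \<open>auto simp: free1_def\<close>)
      then show "R1 $$ (i, j) = 0" using R1e by simp }
  qed
  have nH: "pair_norm H0 H1 \<le> b1 * pair_norm G0 G1"
    unfolding H0_def H1_def b1_def by (rule residual_norm[OF G0 G1 X1 Y1 n1])
  have nJ: "pair_norm J0 J1 \<le> b2 * pair_norm H0 H1"
    unfolding J0_def J1_def b2_def by (rule residual_norm[OF H X2 Y2 n2])
  have nR: "pair_norm R0 R1 \<le> b3 * pair_norm J0 J1"
    unfolding R0_def R1_def b3_def by (rule residual_norm[OF J X3 Y3 n3])
  have pos: "0 \<le> c2" "0 \<le> c3" "0 \<le> b2" "0 \<le> b3"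
    by (simp_all add: c2_def c3_def b2_def b3_def a2_def a3_def spectral_size_def le_max_iff_disj)
  have nJ': "pair_norm J0 J1 \<le> b2 * b1 * pair_norm G0 G1"
    using nJ mult_left_mono[OF nH pos(3)] by (simp add: mult_ac)
  have nR': "pair_norm R0 R1 \<le> b3 * b2 * b1 * pair_norm G0 G1"
    using nR mult_left_mono[OF nJ' pos(4)] by (simp add: mult_ac)
  have "frobenius_norm X \<le> frobenius_norm X1 + frobenius_norm X2 + frobenius_norm X3"
    unfolding X_def using frobenius_norm_triangle[OF X1 X2] frobenius_norm_triangle[of "X1 + X2" nr nr X3] X1 X2 X3 by simp
  moreover have "frobenius_norm Y \<le> frobenius_norm Y1 + frobenius_norm Y2 + frobenius_norm Y3"
    unfolding Y_def using frobenius_norm_triangle[OF Y1 Y2] frobenius_norm_triangle[of "Y1 + Y2" nc nc Y3] Y1 Y2 Y3 by simp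
  ultimately have "frobenius_norm X + frobenius_norm Y \<le> (c1 + c2 * b1 + c3 * b2 * b1) * pair_norm G0 G1"
    using n1 n2 n3 mult_left_mono[OF nH pos(1)] mult_left_mono[OF nJ' pos(2)]
    by (simp add: algebra_simps)
  then show thesis
    using that[OF X Y] st nR' unfolding R_eq by blast
qed

end

section \<open>Entrywise limits of matrices\<close>

definition mat_tendsto ::
  "nat \<Rightarrow> nat \<Rightarrow> (nat \<Rightarrow> 'a::real_normed_field mat) \<Rightarrow> 'a mat \<Rightarrow> bool" where
  "mat_tendsto r c X L \<longleftrightarrow> (\<forall>k. X k \<in> carrier_mat r c) \<and> L \<in> carrier_mat r c \<and>
     (\<forall>i<r. \<forall>j<c. (\<lambda>k. X k $$ (i, j)) \<longlonglongrightarrow> L $$ (i, j))"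

lemma mat_tendsto_const: "L \<in> carrier_mat r c \<Longrightarrow> mat_tendsto r c (\<lambda>_. L) L"
  by (simp add: mat_tendsto_def)

lemma mat_tendsto_add:
  assumes "mat_tendsto r c X L" "mat_tendsto r c Y M"
  shows "mat_tendsto r c (\<lambda>k. X k + Y k) (L + M)"
proof -
  have "(X k + Y k) $$ (i, j) = X k $$ (i, j) + Y k $$ (i, j)" if "i < r" "j < c" for k i j
    using that assms unfolding mat_tendsto_def by (metis carrier_matD index_add_mat(1))
  then show ?thesis using assms unfolding mat_tendsto_def by (auto intro!: tendsto_add)
qed

lemma mat_tendsto_minus:
  assumes "mat_tendsto r c X L" "mat_tendsto r c Y M"
  shows "mat_tendsto r c (\<lambda>k. X k - Y k) (L - M)"
proof -
  have "(X k - Y k) $$ (i, j) = X k $$ (i, j) - Y k $$ (i, j)" if "i < r" "j < c" for k i j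
    using that assms unfolding mat_tendsto_def by (metis carrier_matD index_minus_mat(1))
  then show ?thesis using assms unfolding mat_tendsto_def
    by (auto intro!: tendsto_diff minus_carrier_mat)
qed

lemma mat_tendsto_mult:
  assumes X: "mat_tendsto r s X L" and Y: "mat_tendsto s c Y M"
  shows "mat_tendsto r c (\<lambda>k. X k * Y k) (L * M)"
proof -
  have XY: "(P * Q) $$ (i, j) = (\<Sum>t<s. P $$ (i, t) * Q $$ (t, j))"
    if "i < r" "j < c" "P \<in> carrier_mat r s" "Q \<in> carrier_mat s c" for P Q :: "'a mat" and i j
    using that by (simp add: scalar_prod_def atLeast0LessThan)
  have c: "X k \<in> carrier_mat r s" "Y k \<in> carrier_mat s c" for k
    using X Y by (simp_all add: mat_tendsto_def)
  have cL: "L \<in> carrier_mat r s" "M \<in> carrier_mat s c" using X Y by (simp_all add: mat_tendsto_def)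
  show ?thesis
    unfolding mat_tendsto_def
  proof (intro conjI allI impI)
    fix i j assume ij: "i < r" "j < c"
    have "(\<lambda>k. \<Sum>t<s. X k $$ (i, t) * Y k $$ (t, j)) \<longlonglongrightarrow> (\<Sum>t<s. L $$ (i, t) * M $$ (t, j))"
      using X Y ij unfolding mat_tendsto_def by (intro tendsto_sum tendsto_mult) auto
    then show "(\<lambda>k. (X k * Y k) $$ (i, j)) \<longlonglongrightarrow> (L * M) $$ (i, j)"
      by (simp only: XY[OF ij c] XY[OF ij cL])
  qed (use cL in \<open>auto intro!: mult_carrier_mat[OF c]\<close>)
qed

lemma mat_tendsto_frobenius_norm:
  assumes "mat_tendsto r c X L"
  shows "(\<lambda>k. frobenius_norm (X k)) \<longlonglongrightarrow> frobenius_norm L"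
proof -
  have "frobenius_norm P = sqrt (\<Sum>i<r. \<Sum>j<c. (norm (P $$ (i, j)))\<^sup>2)" if "P \<in> carrier_mat r c" for P :: "'a mat"
    using that by (simp add: frobenius_norm_def)
  moreover have "(\<lambda>k. sqrt (\<Sum>i<r. \<Sum>j<c. (norm (X k $$ (i, j)))\<^sup>2))
    \<longlonglongrightarrow> sqrt (\<Sum>i<r. \<Sum>j<c. (norm (L $$ (i, j)))\<^sup>2)"
    using assms unfolding mat_tendsto_def
    by (intro tendsto_real_sqrt tendsto_sum tendsto_power tendsto_norm) auto
  ultimately show ?thesis using assms unfolding mat_tendsto_def by simp
qed

lemma mat_tendsto_of_norm:
  assumes X: "\<And>k. X k \<in> carrier_mat r c" and L: "L \<in> carrier_mat r c"
    and lim: "(\<lambda>k. frobenius_norm (X k - L)) \<longlonglongrightarrow> 0"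
  shows "mat_tendsto r c X L"
  unfolding mat_tendsto_def
proof (intro conjI allI impI X L)
  fix i j assume ij: "i < r" "j < c"
  have "norm (X k $$ (i, j) - L $$ (i, j)) \<le> frobenius_norm (X k - L)" for k
    using norm_entry_le_frobenius[of i "X k - L" j] ij X[of k] L by auto
  then have "(\<lambda>k. norm (X k $$ (i, j) - L $$ (i, j))) \<longlonglongrightarrow> 0"
    by (intro tendsto_sandwich[OF _ _ tendsto_const lim]) simp_all
  then have "(\<lambda>k. X k $$ (i, j) - L $$ (i, j)) \<longlonglongrightarrow> 0" by (rule tendsto_norm_zero_cancel)
  then show "(\<lambda>k. X k $$ (i, j)) \<longlonglongrightarrow> L $$ (i, j)" by (simp add: LIM_zero_iff)
qed

text \<open>Completeness is reduced to that of the reals: the coordinates of \<open>u\<close> with respect to the basis converge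
  because their steps are summable.\<close>

lemma geometric_steps_convergent:
  fixes u :: "nat \<Rightarrow> 'a::euclidean_space"
  assumes step: "\<And>k. norm (u (Suc k) - u k) \<le> b * t ^ k" and t: "0 \<le> t" "t < 1"
  shows "convergent u"
proof -
  have "\<exists>x. (\<lambda>k. inner (u k) i) \<longlonglongrightarrow> x" if i: "i \<in> Basis" for i
  proof -
    have "summable (\<lambda>k. b * t ^ k)" using t by (intro summable_mult summable_geometric) simp
    moreover have "norm (inner (u (Suc k) - u k) i) \<le> b * t ^ k" for k
      using Basis_le_norm[OF i, of "u (Suc k) - u k"] step[of k] by simp
    ultimately have "summable (\<lambda>k. inner (u (Suc k) - u k) i)"
      using summable_comparison_test'[of "\<lambda>k. b * t ^ k" 0 "\<lambda>k. inner (u (Suc k) - u k) i"] by blast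
    then have "(\<lambda>n. \<Sum>k<n. inner (u (Suc k) - u k) i) \<longlonglongrightarrow> suminf (\<lambda>k. inner (u (Suc k) - u k) i)"
      by (rule summable_LIMSEQ)
    moreover have "(\<Sum>k<n. inner (u (Suc k) - u k) i) = inner (u n) i - inner (u 0) i" for n
      unfolding inner_diff_left by (rule sum_lessThan_telescope)
    ultimately have "(\<lambda>n. inner (u n) i - inner (u 0) i + inner (u 0) i)
      \<longlonglongrightarrow> suminf (\<lambda>k. inner (u (Suc k) - u k) i) + inner (u 0) i"
      by (intro tendsto_add tendsto_const) simp
    then show ?thesis unfolding diff_add_cancel by blast
  qed
  then obtain x where x: "\<And>i. i \<in> Basis \<Longrightarrow> (\<lambda>k. inner (u k) i) \<longlonglongrightarrow> x i" by metis
  have "(\<lambda>k. \<Sum>i\<in>Basis. (inner (u k) i) *\<^sub>R i) \<longlonglongrightarrow> (\<Sum>i\<in>Basis. x i *\<^sub>R i)"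
    using x by (intro tendsto_sum tendsto_scaleR tendsto_const) auto
  then show ?thesis by (auto simp: euclidean_representation convergent_def)
qed

lemma mat_geometric_steps_convergent:
  fixes X :: "nat \<Rightarrow> 'a::{real_normed_field, euclidean_space} mat"
  assumes X: "\<And>k. X k \<in> carrier_mat r c"
    and step: "\<And>k. frobenius_norm (X (Suc k) - X k) \<le> b * t ^ k" and t: "0 \<le> t" "t < 1"
  obtains L where "mat_tendsto r c X L"
proof -
  have "convergent (\<lambda>k. X k $$ (i, j))" if ij: "i < r" "j < c" for i j
  proof (rule geometric_steps_convergent[OF _ t])
    fix k
    have "norm ((X (Suc k) - X k) $$ (i, j)) \<le> frobenius_norm (X (Suc k) - X k)"
      using ij X[of k] X[of "Suc k"] by (intro norm_entry_le_frobenius) auto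
    then show "norm (X (Suc k) $$ (i, j) - X k $$ (i, j)) \<le> b * t ^ k"
      using ij X[of k] X[of "Suc k"] step[of k] by auto
  qed
  then have "(\<lambda>k. X k $$ (i, j)) \<longlonglongrightarrow> lim (\<lambda>k. X k $$ (i, j))" if "i < r" "j < c" for i j
    using that by (simp add: convergent_LIMSEQ_iff)
  then have "mat_tendsto r c X (mat r c (\<lambda>(i, j). lim (\<lambda>k. X k $$ (i, j))))"
    unfolding mat_tendsto_def using X by simp
  then show thesis by (rule that)
qed

section \<open>Newton iteration\<close>

lemma pair_norm_mult_left:
  assumes "X \<in> carrier_mat r s" "G0 \<in> carrier_mat s c" "G1 \<in> carrier_mat s c"
  shows "pair_norm (X * G0) (X * G1) \<le> frobenius_norm X * pair_norm G0 G1"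
proof -
  have "pair_norm (X * G0) (X * G1)
    \<le> sqrt ((frobenius_norm X * frobenius_norm G0)\<^sup>2 + (frobenius_norm X * frobenius_norm G1)\<^sup>2)"
    unfolding pair_norm_def using assms
    by (intro real_sqrt_le_mono add_mono power_mono frobenius_norm_mult) auto
  also have "\<dots> = frobenius_norm X * pair_norm G0 G1"
    unfolding pair_norm_def power_mult_distrib distrib_left[symmetric] real_sqrt_mult by simp
  finally show ?thesis .
qed

lemma pair_norm_mult_right:
  assumes "X \<in> carrier_mat c s" "G0 \<in> carrier_mat r c" "G1 \<in> carrier_mat r c"
  shows "pair_norm (G0 * X) (G1 * X) \<le> pair_norm G0 G1 * frobenius_norm X"
proof -
  have "pair_norm (G0 * X) (G1 * X)
    \<le> sqrt ((frobenius_norm G0 * frobenius_norm X)\<^sup>2 + (frobenius_norm G1 * frobenius_norm X)\<^sup>2)"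
    unfolding pair_norm_def using assms
    by (intro real_sqrt_le_mono add_mono power_mono frobenius_norm_mult) auto
  also have "\<dots> = pair_norm G0 G1 * frobenius_norm X"
    unfolding pair_norm_def power_mult_distrib distrib_right[symmetric] real_sqrt_mult by simp
  finally show ?thesis .
qed

text \<open>The error after a correction \<open>U - X\<close>, \<open>V - Y\<close>, when \<open>X\<close>, \<open>Y\<close>, \<open>T\<close> solve the linear problem at \<open>S\<close> for the
  present error. The linear parts cancel up to the differences \<open>S - P V\<close> and \<open>S - U P\<close>, which are of the size
  of the perturbation.\<close>

lemma mult_residual_identity:
  fixes U :: "'a::comm_ring_1 mat"
  assumes U: "U \<in> carrier_mat r r" and V: "V \<in> carrier_mat c c" and X: "X \<in> carrier_mat r r"
    and Y: "Y \<in> carrier_mat c c" and P: "P \<in> carrier_mat r c" and S: "S \<in> carrier_mat r c"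
    and R: "R \<in> carrier_mat r c" and T: "T \<in> carrier_mat r c"
    and eq: "U * P * V - S - R = X * S + S * Y + T"
  shows "(U - X) * P * (V - Y) - S - (R + T) = X * (S - P * V) + (S - U * P) * Y + X * (P * Y)"
proof -
  have PV: "P * V \<in> carrier_mat r c" and PY: "P * Y \<in> carrier_mat r c" and UP: "U * P \<in> carrier_mat r c"
    and XP: "X * P \<in> carrier_mat r c" using U V X Y P by auto
  have c: "U * P * V \<in> carrier_mat r c" "X * S \<in> carrier_mat r c" "S * Y \<in> carrier_mat r c"
    "U * P * Y \<in> carrier_mat r c" "X * P * V \<in> carrier_mat r c" "X * P * Y \<in> carrier_mat r c"
    using PV PY UP XP U V X Y P S by auto
  have "(U - X) * P * (V - Y) = (U * P - X * P) * (V - Y)"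
    by (simp only: minus_mult_distrib_mat[OF U X P])
  also have "\<dots> = (U * P - X * P) * V - (U * P - X * P) * Y"
    by (rule mult_minus_distrib_mat[OF minus_carrier_mat[OF XP] V Y])
  also have "\<dots> = (U * P * V - X * P * V) - (U * P * Y - X * P * Y)"
    by (simp only: minus_mult_distrib_mat[OF UP XP V] minus_mult_distrib_mat[OF UP XP Y])
  finally have L: "(U - X) * P * (V - Y) = (U * P * V - X * P * V) - (U * P * Y - X * P * Y)" .
  have M: "X * (S - P * V) = X * S - X * P * V" "(S - U * P) * Y = S * Y - U * P * Y" "X * (P * Y) = X * P * Y"
    using mult_minus_distrib_mat[OF X S PV] minus_mult_distrib_mat[OF S UP Y]
      assoc_mult_mat[OF X P V] assoc_mult_mat[OF X P Y] by simp_all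
  show ?thesis
    unfolding L M
  proof (rule eq_matI)
    fix i j assume "i < dim_row (X * S - X * P * V + (S * Y - U * P * Y) + X * P * Y)"
      "j < dim_col (X * S - X * P * V + (S * Y - U * P * Y) + X * P * Y)"
    then have ij: "i < r" "j < c" using c X Y P by auto
    have "(U * P * V - S - R) $$ (i, j) = (X * S + S * Y + T) $$ (i, j)" using eq by simp
    then have e: "(U * P * V) $$ (i, j) - S $$ (i, j) - R $$ (i, j) = (X * S) $$ (i, j) + (S * Y) $$ (i, j) + T $$ (i, j)"
      using ij c S R T U V X Y by (simp del: index_mult_mat(1))
    show "(U * P * V - X * P * V - (U * P * Y - X * P * Y) - S - (R + T)) $$ (i, j)
      = (X * S - X * P * V + (S * Y - U * P * Y) + X * P * Y) $$ (i, j)"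
      using ij c S R T U V X Y P e by (simp add: algebra_simps del: index_mult_mat(1))
  qed (use c S R T U V X Y P in auto)
qed

lemma geometric_sum_bound:
  fixes t :: real
  assumes "0 \<le> t" "t \<le> 1 / 2"
  shows "(\<Sum>j<k. t ^ j) \<le> 1 + 2 * t"
proof -
  have "(\<Sum>j<k. t ^ j) = (1 - t ^ k) / (1 - t)"
    using assms by (simp add: sum_gp_strict)
  also have "\<dots> \<le> 1 / (1 - t)"
    using assms by (intro divide_right_mono) auto
  also have "\<dots> \<le> 1 + 2 * t"
  proof -
    have "1 + 0 \<le> 1 + t * (1 - 2 * t)" using assms by (intro add_left_mono mult_nonneg_nonneg) auto
    then show ?thesis using assms by (simp add: divide_le_eq algebra_simps)
  qed
  finally show ?thesis .
qed

lemma pair_norm_eq_0_tendsto: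
  assumes E0: "mat_tendsto r c E0 L0" and E1: "mat_tendsto r c E1 L1"
    and b: "\<And>k. pair_norm (E0 k) (E1 k) \<le> b * t ^ k" and t: "0 \<le> t" "t < 1"
  shows "L0 = 0\<^sub>m r c" "L1 = 0\<^sub>m r c"
proof -
  have lim: "(\<lambda>k. b * t ^ k) \<longlonglongrightarrow> 0"
    using t by (intro tendsto_mult_right_zero LIMSEQ_power_zero) simp
  have "(\<lambda>k. frobenius_norm (E0 k)) \<longlonglongrightarrow> 0" "(\<lambda>k. frobenius_norm (E1 k)) \<longlonglongrightarrow> 0"
    by (rule tendsto_sandwich[OF _ _ tendsto_const lim];
        use b pair_norm_ge order_trans in \<open>fastforce intro!: always_eventually\<close>)+
  then have "frobenius_norm L0 = 0" "frobenius_norm L1 = 0"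
    using LIMSEQ_unique[OF mat_tendsto_frobenius_norm[OF E0]] LIMSEQ_unique[OF mat_tendsto_frobenius_norm[OF E1]]
    by blast+
  then show "L0 = 0\<^sub>m r c" "L1 = 0\<^sub>m r c"
    using E0 E1 by (auto simp: mat_tendsto_def intro: frobenius_norm_eq_0)
qed

text \<open>A quantitative open mapping argument. Every step solves the linear problem for the current error
  \<open>E\<close> at the fixed point \<open>S\<close> and not at the current iterate, so that one solver with constants \<open>k\<close> and \<open>rho\<close>
  suffices. Only the bounds of the solver enter. The error after \<open>j\<close> steps is
  at most \<open>d t\<^sup>j\<close>, where \<open>d\<close> is the size of the perturbation and \<open>t = L d\<close>. The sum of the structured parts
  is at most \<open>rho d\<close> times a geometric sum, which is \<open>1 + O(t)\<close>; this gives the sharp constant in the linear term.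
  The predicate \<open>Q\<close> stands for being structured.\<close>

lemma newton_iteration:
  fixes S0 S1 :: "'a::{real_normed_field, euclidean_space} mat"
    and Q :: "'a mat \<Rightarrow> 'a mat \<Rightarrow> bool"
  assumes S: "S0 \<in> carrier_mat r c" "S1 \<in> carrier_mat r c" and k: "0 < k" and rho: "0 \<le> rho"
    and solver: "\<And>G0 G1. G0 \<in> carrier_mat r c \<Longrightarrow> G1 \<in> carrier_mat r c \<Longrightarrow>
      \<exists>X Y T0 T1. X \<in> carrier_mat r r \<and> Y \<in> carrier_mat c c \<and> T0 \<in> carrier_mat r c \<and> T1 \<in> carrier_mat r c \<and>
        Q T0 T1 \<and> G0 = X * S0 + S0 * Y + T0 \<and> G1 = X * S1 + S1 * Y + T1 \<and>
        frobenius_norm X \<le> k * pair_norm G0 G1 \<and> frobenius_norm Y \<le> k * pair_norm G0 G1 \<and>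
        pair_norm T0 T1 \<le> rho * pair_norm G0 G1"
    and Q_zero: "Q (0\<^sub>m r c) (0\<^sub>m r c)"
    and Q_add: "\<And>T0 T1 U0 U1. T0 \<in> carrier_mat r c \<Longrightarrow> T1 \<in> carrier_mat r c \<Longrightarrow> U0 \<in> carrier_mat r c \<Longrightarrow>
      U1 \<in> carrier_mat r c \<Longrightarrow> Q T0 T1 \<Longrightarrow> Q U0 U1 \<Longrightarrow> Q (T0 + U0) (T1 + U1)"
    and Q_closed: "\<And>T0 T1 L0 L1. mat_tendsto r c T0 L0 \<Longrightarrow> mat_tendsto r c T1 L1 \<Longrightarrow>
      (\<And>j. Q (T0 j) (T1 j)) \<Longrightarrow> Q L0 L1"
  obtains \<tau> K where "0 < \<tau>" "0 < K"
    "\<And>D0 D1. D0 \<in> carrier_mat r c \<Longrightarrow> D1 \<in> carrier_mat r c \<Longrightarrow> pair_norm D0 D1 < \<tau> \<Longrightarrow>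
      \<exists>X Y T0 T1. X \<in> carrier_mat r r \<and> Y \<in> carrier_mat c c \<and> T0 \<in> carrier_mat r c \<and> T1 \<in> carrier_mat r c \<and>
        frobenius_norm X < 1 \<and> frobenius_norm Y < 1 \<and> Q T0 T1 \<and>
        (1\<^sub>m r + X) * (S0 + D0) * (1\<^sub>m c + Y) = S0 + T0 \<and>
        (1\<^sub>m r + X) * (S1 + D1) * (1\<^sub>m c + Y) = S1 + T1 \<and>
        pair_norm T0 T1 \<le> rho * (pair_norm D0 D1 + K * (pair_norm D0 D1)\<^sup>2)"
proof -
  \<comment> \<open>For \<open>d < 1\<close> this bounds the norm of the perturbed pair.\<close>
  define s where "s = pair_norm S0 S1 + 1"
  define L where "L = k * (2 + 5 * k * s)"
  have s: "1 \<le> s" by (simp add: s_def)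
  have L: "0 < L" unfolding L_def using k s by (intro mult_pos_pos add_pos_pos) auto
  \<comment> \<open>The second bound makes the ratio \<open>t\<close> at most 1/2; the third one keeps the norms of \<open>X\<close> and \<open>Y\<close>,
    which are at most \<open>2 k d\<close>, below 1.\<close>
  define \<tau> where "\<tau> = min 1 (min (1 / (2 * L)) (1 / (4 * k)))"
  have \<tau>: "0 < \<tau>" using L k by (simp add: \<tau>_def)
  have "\<exists>X Y T0 T1. X \<in> carrier_mat r r \<and> Y \<in> carrier_mat c c \<and> T0 \<in> carrier_mat r c \<and> T1 \<in> carrier_mat r c \<and>
        frobenius_norm X < 1 \<and> frobenius_norm Y < 1 \<and> Q T0 T1 \<and>
        (1\<^sub>m r + X) * (S0 + D0) * (1\<^sub>m c + Y) = S0 + T0 \<and>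
        (1\<^sub>m r + X) * (S1 + D1) * (1\<^sub>m c + Y) = S1 + T1 \<and>
        pair_norm T0 T1 \<le> rho * (pair_norm D0 D1 + 2 * L * (pair_norm D0 D1)\<^sup>2)"
    if D: "D0 \<in> carrier_mat r c" "D1 \<in> carrier_mat r c" and small: "pair_norm D0 D1 < \<tau>" for D0 D1
  proof -
    define d where "d = pair_norm D0 D1"
    define t where "t = L * d"
    have d: "0 \<le> d" "d < 1" "d < 1 / (2 * L)" "d < 1 / (4 * k)"
      using small unfolding d_def \<tau>_def by auto
    have t: "0 \<le> t" "t \<le> 1 / 2" "t < 1" using d L unfolding t_def by (auto simp: field_simps)
    have kd: "4 * (k * d) < 1" using d k by (simp add: field_simps)
    define P0 P1 where "P0 = S0 + D0" and "P1 = S1 + D1"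
    have P: "P0 \<in> carrier_mat r c" "P1 \<in> carrier_mat r c" using S D by (simp_all add: P0_def P1_def)
    have nP: "pair_norm P0 P1 \<le> s"
      using pair_norm_triangle[OF S(1) D(1) S(2) D(2)] d unfolding P0_def P1_def s_def d_def by linarith
    define I J where "I = (1\<^sub>m r :: 'a mat)" and "J = (1\<^sub>m c :: 'a mat)"
    have IJ: "I \<in> carrier_mat r r" "J \<in> carrier_mat c c" by (simp_all add: I_def J_def)
    define err where "err = (\<lambda>P S U V T. U * P * V - S - T :: 'a mat)"
    obtain fX fY fT0 fT1 where sol: "\<And>G0 G1. G0 \<in> carrier_mat r c \<Longrightarrow> G1 \<in> carrier_mat r c \<Longrightarrow>
      fX G0 G1 \<in> carrier_mat r r \<and> fY G0 G1 \<in> carrier_mat c c \<and> fT0 G0 G1 \<in> carrier_mat r c \<and> fT1 G0 G1 \<in> carrier_mat r c \<and>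
        Q (fT0 G0 G1) (fT1 G0 G1) \<and> G0 = fX G0 G1 * S0 + S0 * fY G0 G1 + fT0 G0 G1 \<and>
        G1 = fX G0 G1 * S1 + S1 * fY G0 G1 + fT1 G0 G1 \<and>
        frobenius_norm (fX G0 G1) \<le> k * pair_norm G0 G1 \<and> frobenius_norm (fY G0 G1) \<le> k * pair_norm G0 G1 \<and>
        pair_norm (fT0 G0 G1) (fT1 G0 G1) \<le> rho * pair_norm G0 G1"
      using solver by metis
    define step where "step = (\<lambda>(X, Y, T0, T1).
      let E0 = err P0 S0 (I + X) (J + Y) T0; E1 = err P1 S1 (I + X) (J + Y) T1
      in (X - fX E0 E1, Y - fY E0 E1, T0 + fT0 E0 E1, T1 + fT1 E0 E1))"
    define st where "st = (\<lambda>j. (step ^^ j) (0\<^sub>m r r, 0\<^sub>m c c, 0\<^sub>m r c, 0\<^sub>m r c))"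
    define X Y T0 T1 where "X = (\<lambda>j. fst (st j))" and "Y = (\<lambda>j. fst (snd (st j)))"
      and "T0 = (\<lambda>j. fst (snd (snd (st j))))" and "T1 = (\<lambda>j. snd (snd (snd (st j))))"
    define E0 E1 where "E0 = (\<lambda>j. err P0 S0 (I + X j) (J + Y j) (T0 j))"
      and "E1 = (\<lambda>j. err P1 S1 (I + X j) (J + Y j) (T1 j))"
    have start: "X 0 = 0\<^sub>m r r" "Y 0 = 0\<^sub>m c c" "T0 0 = 0\<^sub>m r c" "T1 0 = 0\<^sub>m r c"
      by (simp_all add: X_def Y_def T0_def T1_def st_def)
    have st_Suc: "st (Suc j) = step (X j, Y j, T0 j, T1 j)" for j
      by (simp add: st_def X_def Y_def T0_def T1_def)
    have iter: "X (Suc j) = X j - fX (E0 j) (E1 j)" "Y (Suc j) = Y j - fY (E0 j) (E1 j)"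
      "T0 (Suc j) = T0 j + fT0 (E0 j) (E1 j)" "T1 (Suc j) = T1 j + fT1 (E0 j) (E1 j)" for j
    proof -
      have "st (Suc j) = (X j - fX (E0 j) (E1 j), Y j - fY (E0 j) (E1 j), T0 j + fT0 (E0 j) (E1 j), T1 j + fT1 (E0 j) (E1 j))"
        unfolding st_Suc step_def E0_def E1_def by (simp add: Let_def)
      moreover have "X (Suc j) = fst (st (Suc j))" "Y (Suc j) = fst (snd (st (Suc j)))"
        "T0 (Suc j) = fst (snd (snd (st (Suc j))))" "T1 (Suc j) = snd (snd (snd (st (Suc j))))"
        by (simp_all only: X_def Y_def T0_def T1_def)
      ultimately show "X (Suc j) = X j - fX (E0 j) (E1 j)" "Y (Suc j) = Y j - fY (E0 j) (E1 j)"
        "T0 (Suc j) = T0 j + fT0 (E0 j) (E1 j)" "T1 (Suc j) = T1 j + fT1 (E0 j) (E1 j)"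
        by (simp_all only: fst_conv snd_conv)
    qed
    define g where "g = (\<lambda>j. \<Sum>i<j. t ^ i)"
    have g2: "g j \<le> 1 + 2 * t" "g j \<le> 2" for j
      using geometric_sum_bound[OF t(1,2), of j] t unfolding g_def by auto
    have g_Suc: "g (Suc j) = g j + t ^ j" for j by (simp add: g_def)
    have inv: "X j \<in> carrier_mat r r \<and> Y j \<in> carrier_mat c c \<and> T0 j \<in> carrier_mat r c \<and> T1 j \<in> carrier_mat r c \<and>
      E0 j \<in> carrier_mat r c \<and> E1 j \<in> carrier_mat r c \<and> Q (T0 j) (T1 j) \<and>
      frobenius_norm (X j) \<le> k * d * g j \<and> frobenius_norm (Y j) \<le> k * d * g j \<and>
      pair_norm (T0 j) (T1 j) \<le> rho * d * g j \<and> pair_norm (E0 j) (E1 j) \<le> d * t ^ j" for j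
    proof (induction j)
      case 0
      have "E0 0 = D0" "E1 0 = D1"
        unfolding E0_def E1_def err_def start I_def J_def P0_def P1_def
        by (rule eq_matI; use S D in auto)+
      then show ?case using D Q_zero by (simp add: start g_def d_def pair_norm_def)
    next
      case (Suc j)
      then have c: "X j \<in> carrier_mat r r" "Y j \<in> carrier_mat c c" "T0 j \<in> carrier_mat r c" "T1 j \<in> carrier_mat r c"
        "E0 j \<in> carrier_mat r c" "E1 j \<in> carrier_mat r c" and QT: "Q (T0 j) (T1 j)"
        and nX: "frobenius_norm (X j) \<le> k * d * g j" "frobenius_norm (Y j) \<le> k * d * g j"
        and nT: "pair_norm (T0 j) (T1 j) \<le> rho * d * g j" and nE: "pair_norm (E0 j) (E1 j) \<le> d * t ^ j"
        by auto
      define x y u0 u1 where "x = fX (E0 j) (E1 j)" and "y = fY (E0 j) (E1 j)"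
        and "u0 = fT0 (E0 j) (E1 j)" and "u1 = fT1 (E0 j) (E1 j)"
      have xy: "x \<in> carrier_mat r r" "y \<in> carrier_mat c c" "u0 \<in> carrier_mat r c" "u1 \<in> carrier_mat r c" and Qu: "Q u0 u1"
        and eq: "E0 j = x * S0 + S0 * y + u0" "E1 j = x * S1 + S1 * y + u1"
        and nx: "frobenius_norm x \<le> k * pair_norm (E0 j) (E1 j)" "frobenius_norm y \<le> k * pair_norm (E0 j) (E1 j)"
        and nu: "pair_norm u0 u1 \<le> rho * pair_norm (E0 j) (E1 j)"
        using sol[OF c(5,6)] unfolding x_def y_def u0_def u1_def by auto
      note S' = iter[of j, folded x_def y_def u0_def u1_def]
      define U V where "U = I + X j" and "V = J + Y j"
      have UV: "U \<in> carrier_mat r r" "V \<in> carrier_mat c c" unfolding U_def V_def using IJ c by auto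
      have UV': "I + (X j - x) = U - x" "J + (Y j - y) = V - y"
        unfolding U_def V_def by (rule eq_matI; use IJ c xy in auto)+
      have cE: "err P S' U V T \<in> carrier_mat r c" if "T \<in> carrier_mat r c" for P S' U V and T :: "'a mat"
        unfolding err_def using that by (rule minus_carrier_mat)
      have nxd: "frobenius_norm x \<le> k * d * t ^ j" "frobenius_norm y \<le> k * d * t ^ j"
        using nx mult_left_mono[OF nE less_imp_le[OF k]] by linarith+
      have c': "X j - x \<in> carrier_mat r r" "Y j - y \<in> carrier_mat c c" "T0 j + u0 \<in> carrier_mat r c" "T1 j + u1 \<in> carrier_mat r c"
        using c xy by (auto intro: minus_carrier_mat)
      have nX': "frobenius_norm (X j - x) \<le> k * d * g (Suc j)" "frobenius_norm (Y j - y) \<le> k * d * g (Suc j)"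
        using frobenius_norm_triangle_minus[OF c(1) xy(1)] frobenius_norm_triangle_minus[OF c(2) xy(2)] nX nxd
        by (simp_all add: g_Suc distrib_left)
      have "pair_norm u0 u1 \<le> rho * (d * t ^ j)" using nu mult_left_mono[OF nE rho] by linarith
      then have nT': "pair_norm (T0 j + u0) (T1 j + u1) \<le> rho * d * g (Suc j)"
        using pair_norm_triangle[OF c(3) xy(3) c(4) xy(4)] nT by (simp add: g_Suc distrib_left)
      have E': "E0 (Suc j) = x * (S0 - P0 * V) + (S0 - U * P0) * y + x * (P0 * y)"
        "E1 (Suc j) = x * (S1 - P1 * V) + (S1 - U * P1) * y + x * (P1 * y)"
        using mult_residual_identity[OF UV xy(1,2) P(1) S(1) c(3) xy(3)]
          mult_residual_identity[OF UV xy(1,2) P(2) S(2) c(4) xy(4)] eq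
        unfolding E0_def E1_def err_def S' UV' U_def[symmetric] V_def[symmetric] by simp_all
      have XP: "X j * P0 \<in> carrier_mat r c" "X j * P1 \<in> carrier_mat r c" "P0 * Y j \<in> carrier_mat r c" "P1 * Y j \<in> carrier_mat r c"
        "P0 * y \<in> carrier_mat r c" "P1 * y \<in> carrier_mat r c"
        using c P xy by auto
      have SP: "S0 - P0 * V = - D0 - P0 * Y j" "S1 - P1 * V = - D1 - P1 * Y j"
        "S0 - U * P0 = - D0 - X j * P0" "S1 - U * P1 = - D1 - X j * P1"
      proof -
        have e: "P0 * V = P0 + P0 * Y j" "P1 * V = P1 + P1 * Y j" "U * P0 = P0 + X j * P0" "U * P1 = P1 + X j * P1"
          unfolding U_def V_def I_def J_def using P c
          by (simp_all add: mult_add_distrib_mat[OF _ one_carrier_mat] add_mult_distrib_mat[OF one_carrier_mat])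
        show "S0 - P0 * V = - D0 - P0 * Y j" "S1 - P1 * V = - D1 - P1 * Y j"
          "S0 - U * P0 = - D0 - X j * P0" "S1 - U * P1 = - D1 - X j * P1"
          unfolding e unfolding P0_def P1_def
          by (rule eq_matI; use S D c in \<open>auto simp del: index_mult_mat(1)\<close>)+
      qed
      \<comment> \<open>A common bound for \<open>S - P V\<close> and \<open>S - U P\<close>.\<close>
      let ?m = "d + s * (k * d * 2)"
      have gj: "k * d * g j \<le> k * d * 2" using g2(2)[of j] k d by (intro mult_left_mono) auto
      have nX2: "frobenius_norm (X j) \<le> k * d * 2" "frobenius_norm (Y j) \<le> k * d * 2" "0 \<le> k * d * 2"
        using nX gj mult_nonneg_nonneg[OF less_imp_le[OF k] d(1)] by linarith+
      have neg: "pair_norm (- D0) (- D1) = d" by (simp add: pair_norm_def d_def)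
      have mD: "- D0 \<in> carrier_mat r c" "- D1 \<in> carrier_mat r c" using D by auto
      have "pair_norm (P0 * Y j) (P1 * Y j) \<le> s * (k * d * 2)"
        by (rule order_trans[OF pair_norm_mult_right[OF c(2) P]]) (use nP nX2 s in \<open>intro mult_mono; simp\<close>)
      then have n1: "pair_norm (S0 - P0 * V) (S1 - P1 * V) \<le> ?m"
        unfolding SP using pair_norm_triangle_minus[OF mD(1) XP(3) mD(2) XP(4)] neg by linarith
      have "pair_norm (X j * P0) (X j * P1) \<le> (k * d * 2) * s"
        by (rule order_trans[OF pair_norm_mult_left[OF c(1) P]]) (use nP nX2 s in \<open>intro mult_mono; simp\<close>)
      then have n2: "pair_norm (S0 - U * P0) (S1 - U * P1) \<le> ?m"
        unfolding SP using pair_norm_triangle_minus[OF mD(1) XP(1) mD(2) XP(2)] neg by (simp add: mult.commute)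
      have cc: "S0 - P0 * V \<in> carrier_mat r c" "S1 - P1 * V \<in> carrier_mat r c" "S0 - U * P0 \<in> carrier_mat r c" "S1 - U * P1 \<in> carrier_mat r c"
        using P UV by (auto intro!: minus_carrier_mat)
      define z where "z = k * d * t ^ j"
      have z: "0 \<le> z" "z \<le> k * d" using k d t by (auto simp: z_def intro!: mult_left_le power_le_one)
      have m0: "0 \<le> ?m" using d s k by auto
      have a1: "pair_norm (x * (S0 - P0 * V)) (x * (S1 - P1 * V)) \<le> z * ?m"
        by (rule order_trans[OF pair_norm_mult_left[OF xy(1) cc(1,2)]])
          (use nxd(1) n1 z m0 in \<open>intro mult_mono; simp add: z_def\<close>)
      have a2: "pair_norm ((S0 - U * P0) * y) ((S1 - U * P1) * y) \<le> ?m * z"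
        by (rule order_trans[OF pair_norm_mult_right[OF xy(2) cc(3,4)]])
          (use nxd(2) n2 z m0 in \<open>intro mult_mono; simp add: z_def\<close>)
      have "pair_norm (P0 * y) (P1 * y) \<le> s * z"
        by (rule order_trans[OF pair_norm_mult_right[OF xy(2) P]]) (use nP nxd(2) s in \<open>intro mult_mono; simp add: z_def\<close>)
      also have "\<dots> \<le> s * (k * d)" using z s by (intro mult_left_mono) auto
      finally have a3: "pair_norm (x * (P0 * y)) (x * (P1 * y)) \<le> z * (s * (k * d))"
        by (intro order_trans[OF pair_norm_mult_left[OF xy(1) XP(5,6)]])
          (use nxd(1) z in \<open>intro mult_mono; simp add: z_def\<close>)
      have cx: "x * (S0 - P0 * V) \<in> carrier_mat r c" "x * (S1 - P1 * V) \<in> carrier_mat r c"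
        "(S0 - U * P0) * y \<in> carrier_mat r c" "(S1 - U * P1) * y \<in> carrier_mat r c"
        "x * (P0 * y) \<in> carrier_mat r c" "x * (P1 * y) \<in> carrier_mat r c"
        using xy cc XP by auto
      have "pair_norm (E0 (Suc j)) (E1 (Suc j)) \<le> z * ?m + ?m * z + z * (s * (k * d))"
        unfolding E'
        using pair_norm_triangle[OF add_carrier_mat[OF cx(3)] cx(5) add_carrier_mat[OF cx(4)] cx(6), of "x * (S0 - P0 * V)" "x * (S1 - P1 * V)"]
          pair_norm_triangle[OF cx(1) cx(3) cx(2) cx(4)] a1 a2 a3 by linarith
      also have "\<dots> = d * t ^ Suc j"
        by (simp add: z_def t_def L_def algebra_simps)
      finally have nE': "pair_norm (E0 (Suc j)) (E1 (Suc j)) \<le> d * t ^ Suc j" .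
      have "E0 (Suc j) \<in> carrier_mat r c" "E1 (Suc j) \<in> carrier_mat r c"
        unfolding E' using cx by auto
      then show ?case
        using c' nX' nT' nE' Q_add[OF c(3,4) xy(3,4) QT Qu] unfolding S' by blast
    qed
    then have c: "\<And>j. X j \<in> carrier_mat r r" "\<And>j. Y j \<in> carrier_mat c c" "\<And>j. T0 j \<in> carrier_mat r c"
      "\<And>j. T1 j \<in> carrier_mat r c" "\<And>j. E0 j \<in> carrier_mat r c" "\<And>j. E1 j \<in> carrier_mat r c"
      and QT: "\<And>j. Q (T0 j) (T1 j)"
      and nX: "\<And>j. frobenius_norm (X j) \<le> k * d * g j" "\<And>j. frobenius_norm (Y j) \<le> k * d * g j"
      and nT: "\<And>j. pair_norm (T0 j) (T1 j) \<le> rho * d * g j" and nE: "\<And>j. pair_norm (E0 j) (E1 j) \<le> d * t ^ j"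
      by blast+
    have fc: "fX (E0 j) (E1 j) \<in> carrier_mat r r" "fY (E0 j) (E1 j) \<in> carrier_mat c c"
      "fT0 (E0 j) (E1 j) \<in> carrier_mat r c" "fT1 (E0 j) (E1 j) \<in> carrier_mat r c" for j
      using sol[OF c(5)[of j] c(6)[of j]] by blast+
    have fn: "frobenius_norm (fX (E0 j) (E1 j)) \<le> k * pair_norm (E0 j) (E1 j)"
      "frobenius_norm (fY (E0 j) (E1 j)) \<le> k * pair_norm (E0 j) (E1 j)"
      "pair_norm (fT0 (E0 j) (E1 j)) (fT1 (E0 j) (E1 j)) \<le> rho * pair_norm (E0 j) (E1 j)" for j
      using sol[OF c(5)[of j] c(6)[of j]] by blast+
    have dX: "frobenius_norm (X (Suc j) - X j) \<le> (k * d) * t ^ j" for j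
    proof -
      have "X (Suc j) - X j = - fX (E0 j) (E1 j)"
        unfolding iter by (rule eq_matI; use c(1)[of j] fc[of j] in auto)
      moreover have "k * pair_norm (E0 j) (E1 j) \<le> k * d * t ^ j"
        using mult_left_mono[OF nE[of j] less_imp_le[OF k]] by (simp add: mult.assoc)
      ultimately show ?thesis using fn[of j] by (metis frobenius_norm_uminus order_trans)
    qed
    have dY: "frobenius_norm (Y (Suc j) - Y j) \<le> (k * d) * t ^ j" for j
    proof -
      have "Y (Suc j) - Y j = - fY (E0 j) (E1 j)"
        unfolding iter by (rule eq_matI; use c(2)[of j] fc[of j] in auto)
      moreover have "k * pair_norm (E0 j) (E1 j) \<le> k * d * t ^ j"
        using mult_left_mono[OF nE[of j] less_imp_le[OF k]] by (simp add: mult.assoc)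
      ultimately show ?thesis using fn[of j] by (metis frobenius_norm_uminus order_trans)
    qed
    have du: "pair_norm (fT0 (E0 j) (E1 j)) (fT1 (E0 j) (E1 j)) \<le> (rho * d) * t ^ j" for j
    proof -
      have "rho * pair_norm (E0 j) (E1 j) \<le> rho * d * t ^ j"
        using mult_left_mono[OF nE[of j] rho] by (simp add: mult.assoc)
      then show ?thesis using fn[of j] order_trans by blast
    qed
    have dT0: "frobenius_norm (T0 (Suc j) - T0 j) \<le> (rho * d) * t ^ j" for j
    proof -
      have "T0 (Suc j) - T0 j = fT0 (E0 j) (E1 j)"
        unfolding iter by (rule eq_matI; use c(3)[of j] fc[of j] in auto)
      then show ?thesis using du[of j] pair_norm_ge(1) order_trans by metis
    qed
    have dT1: "frobenius_norm (T1 (Suc j) - T1 j) \<le> (rho * d) * t ^ j" for j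
    proof -
      have "T1 (Suc j) - T1 j = fT1 (E0 j) (E1 j)"
        unfolding iter by (rule eq_matI; use c(4)[of j] fc[of j] in auto)
      then show ?thesis using du[of j] pair_norm_ge(2) order_trans by metis
    qed
    obtain LX where LX: "mat_tendsto r r X LX" using mat_geometric_steps_convergent[OF c(1) dX t(1,3)] .
    obtain LY where LY: "mat_tendsto c c Y LY" using mat_geometric_steps_convergent[OF c(2) dY t(1,3)] .
    obtain L0 where L0: "mat_tendsto r c T0 L0" using mat_geometric_steps_convergent[OF c(3) dT0 t(1,3)] .
    obtain L1 where L1: "mat_tendsto r c T1 L1" using mat_geometric_steps_convergent[OF c(4) dT1 t(1,3)] .
    have lc: "LX \<in> carrier_mat r r" "LY \<in> carrier_mat c c" "L0 \<in> carrier_mat r c" "L1 \<in> carrier_mat r c"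
      using LX LY L0 L1 by (simp_all add: mat_tendsto_def)
    have lim: "mat_tendsto r c (\<lambda>j. err P S (I + X j) (J + Y j) (T j)) (err P S (I + LX) (J + LY) L)"
      if "P \<in> carrier_mat r c" "S \<in> carrier_mat r c" "mat_tendsto r c T L" for P S T L
      unfolding err_def
      by (intro mat_tendsto_minus mat_tendsto_mult[where s = c] mat_tendsto_mult[where s = r] mat_tendsto_add
          mat_tendsto_const that LX LY IJ)
    have e0: "err P0 S0 (I + LX) (J + LY) L0 = 0\<^sub>m r c" "err P1 S1 (I + LX) (J + LY) L1 = 0\<^sub>m r c"
      by (rule pair_norm_eq_0_tendsto[OF lim[OF P(1) S(1) L0] lim[OF P(2) S(2) L1] nE[unfolded E0_def E1_def] t(1,3)])+
    have fin: "U = S + T" if "U - S - T = 0\<^sub>m r c" "U \<in> carrier_mat r c" "S \<in> carrier_mat r c" "T \<in> carrier_mat r c" for U S T :: "'a mat"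
    proof (rule eq_matI)
      fix i j assume "i < dim_row (S + T)" "j < dim_col (S + T)"
      then have ij: "i < r" "j < c" using that by auto
      have "(U - S - T) $$ (i, j) = 0" using that ij by simp
      then show "U $$ (i, j) = (S + T) $$ (i, j)" using ij that(2-4) by (simp add: diff_eq_eq add.commute)
    qed (use that in auto)
    have UPV: "(I + LX) * P * (J + LY) \<in> carrier_mat r c" if "P \<in> carrier_mat r c" for P
      using that lc IJ by auto
    have "frobenius_norm LX \<le> k * d * 2" "frobenius_norm LY \<le> k * d * 2"
      using nX g2(2) k d
      by (auto intro!: LIMSEQ_le_const2[OF mat_tendsto_frobenius_norm[OF LX]] LIMSEQ_le_const2[OF mat_tendsto_frobenius_norm[OF LY]]
          exI[of _ 0] order_trans[OF nX(1) mult_left_mono[OF g2(2)]] order_trans[OF nX(2) mult_left_mono[OF g2(2)]])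
    then have n: "frobenius_norm LX < 1" "frobenius_norm LY < 1" using kd k d by auto
    have "(\<lambda>j. pair_norm (T0 j) (T1 j)) \<longlonglongrightarrow> pair_norm L0 L1"
      unfolding pair_norm_def
      by (intro tendsto_real_sqrt tendsto_add tendsto_power mat_tendsto_frobenius_norm[OF L0] mat_tendsto_frobenius_norm[OF L1])
    moreover have "pair_norm (T0 j) (T1 j) \<le> rho * d * (1 + 2 * t)" for j
      using nT[of j] mult_left_mono[OF g2(1)[of j], of "rho * d"] rho d by simp
    ultimately have "pair_norm L0 L1 \<le> rho * d * (1 + 2 * t)"
      by (auto intro: LIMSEQ_le_const2)
    also have "\<dots> = rho * (d + 2 * L * d\<^sup>2)"
      by (simp add: t_def power2_eq_square algebra_simps)
    finally show ?thesis
      using lc n Q_closed[OF L0 L1 QT] fin[OF e0(1)[unfolded err_def] UPV[OF P(1)] S(1) lc(3)]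
        fin[OF e0(2)[unfolded err_def] UPV[OF P(2)] S(2) lc(4)]
      unfolding d_def P0_def P1_def I_def J_def by blast
  qed
  then show thesis using that[OF \<tau>, of "2 * L"] L by auto
qed

section \<open>Minimality is an open condition\<close>

lemma invertible_one_plus:
  fixes X :: "'a::real_normed_field mat"
  assumes X: "X \<in> carrier_mat k k" and small: "frobenius_norm X < 1"
  obtains W where "W \<in> carrier_mat k k" "(1\<^sub>m k + X) * W = 1\<^sub>m k" "W * (1\<^sub>m k + X) = 1\<^sub>m k"
proof -
  have c: "1\<^sub>m k + X \<in> carrier_mat k k" using X by simp
  have "det (1\<^sub>m k + X) \<noteq> 0"
  proof
    assume "det (1\<^sub>m k + X) = 0"
    then obtain v where v: "v \<in> carrier_vec k" "v \<noteq> 0\<^sub>v k" "(1\<^sub>m k + X) *\<^sub>v v = 0\<^sub>v k"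
      using det_0_iff_vec_prod_zero_field[OF c] by blast
    have "v + X *\<^sub>v v = 0\<^sub>v k"
      using v X add_mult_distrib_mat_vec[OF one_carrier_mat X v(1)] by simp
    then have e: "norm (v $ i) = norm ((X *\<^sub>v v) $ i)" if "i < k" for i
    proof -
      assume "v + X *\<^sub>v v = 0\<^sub>v k"
      then have "(v + X *\<^sub>v v) $ i = 0" using that by simp
      then show ?thesis using that X v(1)
        by (simp add: eq_neg_iff_add_eq_0[symmetric] del: index_mult_mat_vec)
    qed
    have "euclidean_vec_norm v = euclidean_vec_norm (X *\<^sub>v v)"
      unfolding euclidean_vec_norm_def using e v(1) X by (simp del: index_mult_mat_vec)
    also have "\<dots> \<le> frobenius_norm X * euclidean_vec_norm v"
      using v(1) X by (intro euclidean_vec_norm_mult_frobenius) auto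
    finally have "(1 - frobenius_norm X) * euclidean_vec_norm v \<le> 0" by (simp add: algebra_simps)
    then have "euclidean_vec_norm v = 0"
      using small euclidean_vec_norm_nonneg[of v] by (simp add: mult_le_0_iff)
    then show False using v by (simp add: euclidean_vec_norm_eq_0)
  qed
  from det_non_zero_imp_unit[OF c this, of "()"]
  show thesis using that unfolding Units_def ring_mat_def by auto
qed

lemma invertible_mat_one_plus:
  fixes X :: "'a::real_normed_field mat"
  assumes X: "X \<in> carrier_mat k k" and small: "frobenius_norm X < 1"
  shows "invertible_mat (1\<^sub>m k + X)"
proof -
  obtain W where "W \<in> carrier_mat k k" "(1\<^sub>m k + X) * W = 1\<^sub>m k" "W * (1\<^sub>m k + X) = 1\<^sub>m k"
    using invertible_one_plus[OF X small] .
  then show ?thesis using X unfolding invertible_mat_def inverts_mat_def square_mat.simps by auto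
qed

lemma mult_mat_zero_vec: "(M :: 'a::semiring_1 mat) \<in> carrier_mat r c \<Longrightarrow> M *\<^sub>v 0\<^sub>v c = 0\<^sub>v r"
  by (rule eq_vecI) auto

lemma one_plus_minus_one: "(X :: 'a::ring_1 mat) \<in> carrier_mat k k \<Longrightarrow> 1\<^sub>m k + (X - 1\<^sub>m k) = X"
  by (rule eq_matI) auto

text \<open>In the reduced row echelon form \<open>P A\<close> of an injective matrix every column is a pivot column, hence a unit
  vector. The rows of \<open>P\<close> that belong to the pivots form a left inverse.\<close>

lemma injective_imp_left_inverse:
  fixes A :: "'a::field mat"
  assumes A: "A \<in> carrier_mat r c"
    and inj: "\<And>v. v \<in> carrier_vec c \<Longrightarrow> A *\<^sub>v v = 0\<^sub>v r \<Longrightarrow> v = 0\<^sub>v c"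
  obtains L where "L \<in> carrier_mat c r" "L * A = 1\<^sub>m c"
proof -
  define R where "R = gauss_jordan_single A"
  note gj = gauss_jordan_single[OF A R_def[symmetric]]
  obtain P where P: "R = P * A" "P \<in> carrier_mat r r" using gj(4) by blast
  have piv: "snd ` set (pivot_positions R) = {0..<c}"
  proof (rule ccontr)
    assume "snd ` set (pivot_positions R) \<noteq> {0..<c}"
    from find_base_vector[OF gj(3,2) this] gj(1)[of "find_base_vector R"] inj[of "find_base_vector R"]
    show False by auto
  qed
  obtain f where f: "pivot_fun R f c"
    using gj(2,3) unfolding row_echelon_form_def by auto
  note pp = pivot_positions[OF gj(2) f]
  have "\<exists>i<r. f i = j" if "j < c" for j
  proof -
    have "j \<in> snd ` set (pivot_positions R)" using that piv by auto
    then show ?thesis using pp(1) by auto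
  qed
  then obtain g where g: "\<And>j. j < c \<Longrightarrow> g j < r \<and> f (g j) = j" by metis
  define L where "L = mat c r (\<lambda>(j, k). P $$ (g j, k))"
  have L: "L \<in> carrier_mat c r" by (simp add: L_def)
  have "L * A = 1\<^sub>m c"
  proof (rule eq_matI)
    fix j j' assume "j < dim_row (1\<^sub>m c :: 'a mat)" "j' < dim_col (1\<^sub>m c :: 'a mat)"
    then have j: "j < c" "j' < c" by auto
    have "row L j = row P (g j)" using j g[of j] P(2) by (auto simp: L_def)
    then have "(L * A) $$ (j, j') = R $$ (g j, j')"
      using j g[of j] L A P by simp
    also have "\<dots> = R $$ (g j, f (g j'))" using g[OF j(2)] by simp
    also have "\<dots> = (if j = j' then 1 else 0)"
      using pivot_funD(4,5)[OF carrier_matD(1)[OF gj(2)] f, of "g j'"] g[OF j(1)] g[OF j(2)] j by (metis)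
    finally show "(L * A) $$ (j, j') = 1\<^sub>m c $$ (j, j')" using j by simp
  qed (use L A in auto)
  with L show thesis by (rule that)
qed

lemma full_column_rank_iff_injective:
  fixes A :: "'a::field mat"
  assumes A: "A \<in> carrier_mat r c"
  shows "vec_space.rank r A = c \<longleftrightarrow> (\<forall>v \<in> carrier_vec c. A *\<^sub>v v = 0\<^sub>v r \<longrightarrow> v = 0\<^sub>v c)"
proof -
  interpret vec_space "TYPE('a)" r .
  show ?thesis
  proof
    assume rank: "rank A = c"
    obtain S where S: "maximal S (\<lambda>T. T \<subseteq> set (cols A) \<and> lin_indpt T)"
      using maximal_exists[of "(\<lambda>T. T \<subseteq> set (cols A) \<and> lin_indpt T)" "card (set (cols A))" "{}"]
      by (meson List.finite_set card_mono empty_iff empty_subsetI finite_lin_indpt2 rev_finite_subset)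
    then have "c \<le> card (set (cols A))"
      using rank_card_indpt[OF A S] rank by (simp add: card_mono maximal_def)
    then have dist: "distinct (cols A)"
      using A card_distinct[of "cols A"] card_length[of "cols A"] by auto
    then have "lin_indpt (set (cols A))" using full_rank_lin_indpt[OF A rank] by blast
    then show "\<forall>v \<in> carrier_vec c. A *\<^sub>v v = 0\<^sub>v r \<longrightarrow> v = 0\<^sub>v c"
      using lin_depI[OF A _ _ _ dist] by blast
  next
    assume inj: "\<forall>v \<in> carrier_vec c. A *\<^sub>v v = 0\<^sub>v r \<longrightarrow> v = 0\<^sub>v c"
    obtain L where L: "L \<in> carrier_mat c r" "L * A = 1\<^sub>m c"
      using injective_imp_left_inverse[OF A] inj by blast
    have dist: "distinct (cols A)"
    proof (rule ccontr)
      assume "\<not> distinct (cols A)"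
      then obtain i j where ij: "i < c" "j < c" "i \<noteq> j" "col A i = col A j"
        using A by (auto simp: distinct_conv_nth)
      have "col (1\<^sub>m c :: 'a mat) i = L *\<^sub>v col A i" "col (1\<^sub>m c :: 'a mat) j = L *\<^sub>v col A j"
        using col_mult2[OF L(1) A ij(1)] col_mult2[OF L(1) A ij(2)] L(2) by simp_all
      then have "unit_vec c i = (unit_vec c j :: 'a vec)" using ij by simp
      then have "unit_vec c i $ i = (unit_vec c j :: 'a vec) $ i" by simp
      then show False using ij by simp
    qed
    have "lin_indpt (set (cols A))"
      using lin_depE[OF A _ dist] inj by blast
    then show "rank A = c" using lin_indpt_full_rank[OF A dist] by blast
  qed
qed

lemma full_row_rank_iff_right_inverse:
  fixes A :: "'a::field mat"
  assumes A: "A \<in> carrier_mat r c"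
  shows "vec_space.rank r A = r \<longleftrightarrow> (\<exists>Z \<in> carrier_mat c r. A * Z = 1\<^sub>m r)"
proof -
  interpret vec_space "TYPE('a)" r .
  have cols: "set (cols A) \<subseteq> carrier_vec r" using A cols_dim by blast
  show ?thesis
  proof
    assume rank: "rank A = r"
    obtain S where S: "maximal S (\<lambda>T. T \<subseteq> set (cols A) \<and> lin_indpt T)"
      using maximal_exists[of "(\<lambda>T. T \<subseteq> set (cols A) \<and> lin_indpt T)" "card (set (cols A))" "{}"]
      by (meson List.finite_set card_mono empty_iff empty_subsetI finite_lin_indpt2 rev_finite_subset)
    then have S': "S \<subseteq> set (cols A)" "lin_indpt S" by (auto simp: maximal_def)
    have "card S = dim" using rank_card_indpt[OF A S] rank dim_is_n by simp
    then have "basis S"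
      using S' cols by (intro dim_li_is_basis) (auto intro: finite_subset)
    then have "span S = carrier_vec r" by (simp add: basis_def)
    then have "carrier_vec r \<subseteq> col_space A"
      unfolding col_space_def using span_is_monotone[OF S'(1)] by simp
    moreover have "unit_vec r i \<in> carrier_vec r" for i by simp
    ultimately have "\<forall>i<r. \<exists>x\<in>carrier_vec c. A *\<^sub>v x = unit_vec r i"
      using col_space_eq[OF A] A by blast
    then obtain x where x: "\<And>i. i < r \<Longrightarrow> x i \<in> carrier_vec c \<and> A *\<^sub>v x i = unit_vec r i" by metis
    define Z where "Z = mat c r (\<lambda>(k, i). x i $ k)"
    have Z: "Z \<in> carrier_mat c r" by (simp add: Z_def)
    have "A * Z = 1\<^sub>m r"
    proof (rule mat_col_eqI)
      fix i assume "i < dim_col (1\<^sub>m r :: 'a mat)"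
      then have i: "i < r" by simp
      have "col Z i = x i" using i x[OF i] by (auto simp: Z_def)
      then show "col (A * Z) i = col (1\<^sub>m r) i" using col_mult2[OF A Z i] x[OF i] i by simp
    qed (use A Z in auto)
    then show "\<exists>Z \<in> carrier_mat c r. A * Z = 1\<^sub>m r" using Z by blast
  next
    assume "\<exists>Z \<in> carrier_mat c r. A * Z = 1\<^sub>m r"
    then obtain Z where Z: "Z \<in> carrier_mat c r" "A * Z = 1\<^sub>m r" by blast
    have "y \<in> col_space A" if y: "y \<in> carrier_vec r" for y
    proof -
      have "A *\<^sub>v (Z *\<^sub>v y) = y"
        using assoc_mult_mat_vec[OF A Z(1) y] Z(2) y by simp
      then show ?thesis using col_space_eq[OF A] A Z y by (auto intro!: bexI[of _ "Z *\<^sub>v y"])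
    qed
    then have "span (set (cols A)) = carrier V"
      using span_closed[OF cols] unfolding col_space_def by auto
    moreover have "vs (carrier V) = V" by (simp add: module_vec_def)
    ultimately have "rank A = dim" unfolding rank_def by (simp only:)
    then show "rank A = r" using dim_is_n by simp
  qed
qed

text \<open>A left inverse \<open>L\<close> of the limit is almost one of its approximations: \<open>L X\<^sub>k\<close> differs from the identity by
  less than 1 eventually, is then invertible, and forces \<open>X\<^sub>k\<close> to be injective.\<close>

lemma full_column_rank_limit:
  fixes X :: "nat \<Rightarrow> 'a::real_normed_field mat"
  assumes lim: "mat_tendsto r c X A" and rank: "vec_space.rank r A = c"
  shows "eventually (\<lambda>k. vec_space.rank r (X k) = c) sequentially"
proof -
  have A: "A \<in> carrier_mat r c" and X: "\<And>k. X k \<in> carrier_mat r c" using lim by (auto simp: mat_tendsto_def)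
  obtain L where L: "L \<in> carrier_mat c r" "L * A = 1\<^sub>m c"
    using injective_imp_left_inverse[OF A] rank full_column_rank_iff_injective[OF A] by blast
  have "mat_tendsto c c (\<lambda>k. L * X k - 1\<^sub>m c) (L * A - 1\<^sub>m c)"
    by (intro mat_tendsto_minus mat_tendsto_mult[where s = r] mat_tendsto_const L lim) simp
  moreover have "L * A - 1\<^sub>m c = 0\<^sub>m c c" unfolding L(2) by (rule eq_matI) auto
  ultimately have "mat_tendsto c c (\<lambda>k. L * X k - 1\<^sub>m c) (0\<^sub>m c c)" by simp
  from mat_tendsto_frobenius_norm[OF this]
  have "(\<lambda>k. frobenius_norm (L * X k - 1\<^sub>m c)) \<longlonglongrightarrow> 0" by simp
  then have "eventually (\<lambda>k. frobenius_norm (L * X k - 1\<^sub>m c) < 1) sequentially"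
    by (rule order_tendstoD) simp
  then show ?thesis
  proof (rule eventually_mono)
    fix k assume small: "frobenius_norm (L * X k - 1\<^sub>m c) < 1"
    have E: "L * X k - 1\<^sub>m c \<in> carrier_mat c c" by (rule minus_carrier_mat) simp
    obtain W where W: "W \<in> carrier_mat c c" "W * (1\<^sub>m c + (L * X k - 1\<^sub>m c)) = 1\<^sub>m c"
      using invertible_one_plus[OF E small] by blast
    have LX: "L * X k \<in> carrier_mat c c" using L X by auto
    have "1\<^sub>m c + (L * X k - 1\<^sub>m c) = L * X k"
      by (rule one_plus_minus_one[OF LX])
    then have W: "W \<in> carrier_mat c c" "W * (L * X k) = 1\<^sub>m c" using W by simp_all
    have "v = 0\<^sub>v c" if v: "v \<in> carrier_vec c" "X k *\<^sub>v v = 0\<^sub>v r" for v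
    proof -
      have "v = W * (L * X k) *\<^sub>v v" using W v by simp
      also have "\<dots> = W *\<^sub>v (L *\<^sub>v (X k *\<^sub>v v))"
        using assoc_mult_mat_vec[OF W(1) LX v(1)] assoc_mult_mat_vec[OF L(1) X v(1)] by simp
      also have "\<dots> = W *\<^sub>v 0\<^sub>v c" using v(2) mult_mat_zero_vec[OF L(1)] by simp
      also have "\<dots> = 0\<^sub>v c" by (rule mult_mat_zero_vec[OF W(1)])
      finally show ?thesis .
    qed
    then show "vec_space.rank r (X k) = c" using full_column_rank_iff_injective[OF X] by blast
  qed
qed

lemma full_row_rank_limit:
  fixes X :: "nat \<Rightarrow> 'a::real_normed_field mat"
  assumes lim: "mat_tendsto r c X A" and rank: "vec_space.rank r A = r"
  shows "eventually (\<lambda>k. vec_space.rank r (X k) = r) sequentially"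
proof -
  have A: "A \<in> carrier_mat r c" and X: "\<And>k. X k \<in> carrier_mat r c" using lim by (auto simp: mat_tendsto_def)
  obtain Z where Z: "Z \<in> carrier_mat c r" "A * Z = 1\<^sub>m r"
    using rank full_row_rank_iff_right_inverse[OF A] by blast
  have "mat_tendsto r r (\<lambda>k. X k * Z - 1\<^sub>m r) (A * Z - 1\<^sub>m r)"
    by (intro mat_tendsto_minus mat_tendsto_mult[where s = c] mat_tendsto_const Z lim) simp
  moreover have "A * Z - 1\<^sub>m r = 0\<^sub>m r r" unfolding Z(2) by (rule eq_matI) auto
  ultimately have "mat_tendsto r r (\<lambda>k. X k * Z - 1\<^sub>m r) (0\<^sub>m r r)" by simp
  from mat_tendsto_frobenius_norm[OF this]
  have "(\<lambda>k. frobenius_norm (X k * Z - 1\<^sub>m r)) \<longlonglongrightarrow> 0" by simp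
  then have "eventually (\<lambda>k. frobenius_norm (X k * Z - 1\<^sub>m r) < 1) sequentially"
    by (rule order_tendstoD) simp
  then show ?thesis
  proof (rule eventually_mono)
    fix k assume small: "frobenius_norm (X k * Z - 1\<^sub>m r) < 1"
    have E: "X k * Z - 1\<^sub>m r \<in> carrier_mat r r" by (rule minus_carrier_mat) simp
    obtain W where W: "W \<in> carrier_mat r r" "(1\<^sub>m r + (X k * Z - 1\<^sub>m r)) * W = 1\<^sub>m r"
      using invertible_one_plus[OF E small] by blast
    have XZ: "X k * Z \<in> carrier_mat r r" using mult_carrier_mat[OF X Z(1)] .
    have "1\<^sub>m r + (X k * Z - 1\<^sub>m r) = X k * Z"
      by (rule one_plus_minus_one[OF XZ])
    then have "X k * (Z * W) = 1\<^sub>m r" using W assoc_mult_mat[OF X Z(1) W(1)] by simp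
    then show "vec_space.rank r (X k) = r"
      using full_row_rank_iff_right_inverse[OF X] mult_carrier_mat[OF Z(1) W(1)] by blast
  qed
qed

lemma mat_tendsto_power:
  assumes "mat_tendsto r r X A"
  shows "mat_tendsto r r (\<lambda>k. X k ^\<^sub>m t) (A ^\<^sub>m t)"
proof (induction t)
  case 0
  have "dim_row (X k) = r" "dim_row A = r" for k
    using assms by (auto simp: mat_tendsto_def)
  then show ?case by (simp add: mat_tendsto_const)
next
  case (Suc t)
  show ?case unfolding pow_mat.simps by (rule mat_tendsto_mult[OF Suc assms])
qed

lemma controllability_mat_tendsto:
  assumes A: "mat_tendsto l l X A" and B: "mat_tendsto l n Y B"
  shows "mat_tendsto l (l * n) (\<lambda>k. controllability_mat (X k) (Y k)) (controllability_mat A B)"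
proof -
  have d: "dim_row (X k) = l" "dim_row A = l" "dim_col (Y k) = n" "dim_col B = n" for k
    using A B by (auto simp: mat_tendsto_def)
  have "(\<lambda>k. (X k ^\<^sub>m (j div n) * Y k) $$ (i, j mod n)) \<longlonglongrightarrow> (A ^\<^sub>m (j div n) * B) $$ (i, j mod n)"
    if "i < l" "j < l * n" for i j
  proof -
    have "j mod n < n" using that by (cases n) auto
    then show ?thesis
      using that mat_tendsto_mult[OF mat_tendsto_power[OF A, of "j div n"] B] by (simp add: mat_tendsto_def)
  qed
  then show ?thesis
    unfolding mat_tendsto_def controllability_mat_def d by simp
qed

lemma observability_mat_tendsto:
  assumes A: "mat_tendsto l l X A" and C: "mat_tendsto m l Y C"
  shows "mat_tendsto (l * m) l (\<lambda>k. observability_mat (X k) (Y k)) (observability_mat A C)"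
proof -
  have d: "dim_row (X k) = l" "dim_row A = l" "dim_row (Y k) = m" "dim_row C = m" for k
    using A C by (auto simp: mat_tendsto_def)
  have "(\<lambda>k. (Y k * X k ^\<^sub>m (i div m)) $$ (i mod m, j)) \<longlonglongrightarrow> (C * A ^\<^sub>m (i div m)) $$ (i mod m, j)"
    if "i < l * m" "j < l" for i j
  proof -
    have "i mod m < m" using that by (cases m) auto
    then show ?thesis
      using that mat_tendsto_mult[OF C mat_tendsto_power[OF A, of "i div m"]] by (simp add: mat_tendsto_def)
  qed
  then show ?thesis
    unfolding mat_tendsto_def observability_mat_def d by simp
qed

text \<open>Otherwise there are nonminimal triples arbitrarily close to the given one. Along such a sequence the
  controllability and the observability matrices converge, because their entries are polynomials in the
  entries of the triple, and so their ranks are eventually full.\<close>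

lemma minimal_triple_open:
  fixes A B C :: "'a::real_normed_field mat"
  assumes A: "A \<in> carrier_mat l l" and B: "B \<in> carrier_mat l n" and C: "C \<in> carrier_mat m l"
    and min: "minimal_triple A B C"
  obtains \<epsilon> where "0 < \<epsilon>" "\<And>A' B' C'. A' \<in> carrier_mat l l \<Longrightarrow> B' \<in> carrier_mat l n \<Longrightarrow> C' \<in> carrier_mat m l \<Longrightarrow>
      frobenius_norm (A' - A) < \<epsilon> \<Longrightarrow> frobenius_norm (B' - B) < \<epsilon> \<Longrightarrow> frobenius_norm (C' - C) < \<epsilon> \<Longrightarrow>
      minimal_triple A' B' C'"
proof (rule ccontr)
  assume "\<not> thesis"
  then have "\<forall>k. \<exists>A' B' C'. A' \<in> carrier_mat l l \<and> B' \<in> carrier_mat l n \<and> C' \<in> carrier_mat m l \<and>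
      frobenius_norm (A' - A) < inverse (real (Suc k)) \<and> frobenius_norm (B' - B) < inverse (real (Suc k)) \<and>
      frobenius_norm (C' - C) < inverse (real (Suc k)) \<and> \<not> minimal_triple A' B' C'"
    using that by (metis inverse_positive_iff_positive of_nat_0_less_iff zero_less_Suc)
  then obtain X Y Z where XYZ: "\<And>k. X k \<in> carrier_mat l l \<and> Y k \<in> carrier_mat l n \<and> Z k \<in> carrier_mat m l \<and>
      frobenius_norm (X k - A) < inverse (real (Suc k)) \<and> frobenius_norm (Y k - B) < inverse (real (Suc k)) \<and>
      frobenius_norm (Z k - C) < inverse (real (Suc k)) \<and> \<not> minimal_triple (X k) (Y k) (Z k)"
    by metis
  have null: "u \<longlonglongrightarrow> 0" if "\<And>k. 0 \<le> u k \<and> u k < inverse (real (Suc k))" for u :: "nat \<Rightarrow> real"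
    by (rule tendsto_sandwich[OF _ _ tendsto_const LIMSEQ_inverse_real_of_nat])
      (use that in \<open>auto intro!: always_eventually less_imp_le\<close>)
  have lim: "mat_tendsto l l X A" "mat_tendsto l n Y B" "mat_tendsto m l Z C"
    using XYZ A B C by (auto intro!: mat_tendsto_of_norm null)
  have "vec_space.rank l (controllability_mat A B) = l" "vec_space.rank (l * m) (observability_mat A C) = l"
    using min A C by (auto simp: minimal_triple_def controllable_def observable_def)
  from full_row_rank_limit[OF controllability_mat_tendsto[OF lim(1,2)] this(1)]
    full_column_rank_limit[OF observability_mat_tendsto[OF lim(1,3)] this(2)]
  have "eventually (\<lambda>k. minimal_triple (X k) (Y k) (Z k)) sequentially"
  proof eventually_elim
    case (elim k)
    have "dim_row (X k) = l" "dim_row (Z k) = m" using XYZ[of k] by auto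
    then show ?case using elim by (simp add: minimal_triple_def controllable_def observable_def)
  qed
  then show False using XYZ by auto
qed

section \<open>Structured perturbations\<close>

context kronecker_coefficients
begin

lemma structured_blocks:
  assumes "structured T0 T1"
  shows "blk rs cs 0 2 T0 = 0\<^sub>m p (h * m)" "blk rs cs 1 2 T0 = 0\<^sub>m l (h * m)" "blk rs cs 2 0 T0 = 0\<^sub>m (e * n) q"
    "blk rs cs 2 1 T0 = 0\<^sub>m (e * n) l" "blk rs cs 2 2 T0 = 0\<^sub>m (e * n) (h * m)"
    "blk rs cs 0 1 T1 = 0\<^sub>m p l" "blk rs cs 0 2 T1 = 0\<^sub>m p (h * m)" "blk rs cs 1 0 T1 = 0\<^sub>m l q"
    "blk rs cs 1 1 T1 = 0\<^sub>m l l" "blk rs cs 1 2 T1 = 0\<^sub>m l (h * m)" "blk rs cs 2 0 T1 = 0\<^sub>m (e * n) q"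
    "blk rs cs 2 1 T1 = 0\<^sub>m (e * n) l" "blk rs cs 2 2 T1 = 0\<^sub>m (e * n) (h * m)"
    "blk rs cs 0 1 T0 = (K_last h m)\<^sup>T * (K_last h m * blk rs cs 0 1 T0)"
    "blk rs cs 1 0 T0 = blk rs cs 1 0 T0 * (K_last e n)\<^sup>T * K_last e n"
proof -
  note o = off_simps[OF sizes(1), unfolded sizes] off_simps[OF sizes(2), unfolded sizes]
  have z0: "T0 $$ (i, j) = 0" if "i < nr" "j < nc" "\<not> free0 i j" for i j
    using assms that by (simp add: structured_def)
  have z1: "T1 $$ (i, j) = 0" if "i < nr" "j < nc" "\<not> free1 i j" for i j
    using assms that by (simp add: structured_def)
  have pq: "h * m \<le> p" "e * n \<le> q" "p - h * m = m" "q - e * n = n" by (simp_all add: p_def q_def)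
  show "blk rs cs 0 2 T0 = 0\<^sub>m p (h * m)" "blk rs cs 1 2 T0 = 0\<^sub>m l (h * m)" "blk rs cs 2 0 T0 = 0\<^sub>m (e * n) q"
    "blk rs cs 2 1 T0 = 0\<^sub>m (e * n) l" "blk rs cs 2 2 T0 = 0\<^sub>m (e * n) (h * m)"
    by (rule eq_matI; use z0 o in \<open>auto simp: blk_def free0_def\<close>)+
  show "blk rs cs 0 1 T1 = 0\<^sub>m p l" "blk rs cs 0 2 T1 = 0\<^sub>m p (h * m)" "blk rs cs 1 0 T1 = 0\<^sub>m l q"
    "blk rs cs 1 1 T1 = 0\<^sub>m l l" "blk rs cs 1 2 T1 = 0\<^sub>m l (h * m)" "blk rs cs 2 0 T1 = 0\<^sub>m (e * n) q"
    "blk rs cs 2 1 T1 = 0\<^sub>m (e * n) l" "blk rs cs 2 2 T1 = 0\<^sub>m (e * n) (h * m)"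
    by (rule eq_matI; use z1 o in \<open>auto simp: blk_def free1_def\<close>)+
  show "blk rs cs 0 1 T0 = (K_last h m)\<^sup>T * (K_last h m * blk rs cs 0 1 T0)" (is "?G = ?H")
  proof (rule eq_matI)
    fix i j assume "i < dim_row ?H" "j < dim_col ?H"
    then have ij: "i < p" "j < l" by (simp_all add: p_def)
    have Gz: "?G $$ (i, j) = 0" if "i < h * m"
    proof -
      have "?G $$ (i, j) = T0 $$ (i, q + j)" using ij o by (simp add: blk_def)
      also have "\<dots> = 0" using ij that pq by (intro z0) (auto simp: free0_def)
      finally show ?thesis .
    qed
    have "?H $$ (i, j) = (if h * m \<le> i \<and> i - h * m < m then ?G $$ (i, j) else 0)"
      using ij unfolding K_last_def p_def[symmetric] by (auto simp: shift_index simp del: index_mult_mat(1))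
    then show "?G $$ (i, j) = ?H $$ (i, j)" using Gz ij pq by auto
  qed (simp_all add: p_def)
  show "blk rs cs 1 0 T0 = blk rs cs 1 0 T0 * (K_last e n)\<^sup>T * K_last e n" (is "?G = ?H")
  proof (rule eq_matI)
    fix i j assume "i < dim_row ?H" "j < dim_col ?H"
    then have ij: "i < l" "j < q" by (simp_all add: q_def)
    have Gz: "?G $$ (i, j) = 0" if "j < e * n"
    proof -
      have "?G $$ (i, j) = T0 $$ (p + i, j)" using ij o by (simp add: blk_def)
      also have "\<dots> = 0" using ij that pq by (intro z0) (auto simp: free0_def)
      finally show ?thesis .
    qed
    have "?H $$ (i, j) = (if e * n \<le> j \<and> j - e * n < n then ?G $$ (i, j) else 0)"
      using ij unfolding K_last_def q_def[symmetric] by (auto simp: shift_index simp del: index_mult_mat(1))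
    then show "?G $$ (i, j) = ?H $$ (i, j)" using Gz ij pq by auto
  qed (simp_all add: q_def)
qed

text \<open>The contributions of a structured pair to \<open>A\<close>, \<open>B\<close> and \<open>C\<close>. Multiplication by \<open>K_last\<close> or its
  transpose cuts out the last block column or row.\<close>

abbreviation "state_part T \<equiv> blk rs cs 1 1 T"
abbreviation "input_part T \<equiv> blk rs cs 1 0 T * (K_last e n)\<^sup>T"
abbreviation "output_part T \<equiv> K_last h m * blk rs cs 0 1 T"

lemma parts_carrier:
  fixes T :: "'a mat"
  shows "state_part T \<in> carrier_mat l l" "input_part T \<in> carrier_mat l n" "output_part T \<in> carrier_mat m l"
proof -
  show "state_part T \<in> carrier_mat l l" using blk_carrier(1)[of rs cs 1 1 T] by (simp only: sizes)
  have "blk rs cs 1 0 T \<in> carrier_mat l q" "blk rs cs 0 1 T \<in> carrier_mat p l"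
    using blk_carrier(1)[of rs cs 1 0 T] blk_carrier(1)[of rs cs 0 1 T] by (simp_all only: sizes)
  then show "input_part T \<in> carrier_mat l n" "output_part T \<in> carrier_mat m l"
    using K_sizes by (auto intro!: mult_carrier_mat[of _ l q] mult_carrier_mat[of _ m p])
qed

lemma parts_norm:
  assumes "structured T0 T1"
  shows "(frobenius_norm (state_part T0))\<^sup>2 + (frobenius_norm (input_part T0))\<^sup>2 + (frobenius_norm (output_part T0))\<^sup>2
    + ((frobenius_norm (blk rs cs 0 0 T0))\<^sup>2 + (frobenius_norm (blk rs cs 0 0 T1))\<^sup>2) \<le> (pair_norm T0 T1)\<^sup>2"
proof -
  have c: "blk rs cs 1 0 T0 \<in> carrier_mat l q" "blk rs cs 0 1 T0 \<in> carrier_mat p l"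
    using blk_carrier(1)[of rs cs 1 0 T0] blk_carrier(1)[of rs cs 0 1 T0] by (simp_all only: sizes)
  have "frobenius_norm (input_part T0) \<le> frobenius_norm (blk rs cs 1 0 T0)"
    "frobenius_norm (output_part T0) \<le> frobenius_norm (blk rs cs 0 1 T0)"
    unfolding K_last_def p_def[symmetric] q_def[symmetric]
    by (rule frobenius_norm_shift_transpose_right[OF c(1)], rule frobenius_norm_shift_left[OF c(2)])
  then have "(frobenius_norm (input_part T0))\<^sup>2 \<le> (pair_norm (blk rs cs 1 0 T0) (blk rs cs 1 0 T1))\<^sup>2"
    "(frobenius_norm (output_part T0))\<^sup>2 \<le> (pair_norm (blk rs cs 0 1 T0) (blk rs cs 0 1 T1))\<^sup>2"
    "(frobenius_norm (state_part T0))\<^sup>2 \<le> (pair_norm (blk rs cs 1 1 T0) (blk rs cs 1 1 T1))\<^sup>2"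
    by (auto intro!: power_mono intro: order_trans[OF _ pair_norm_ge(1)] pair_norm_ge(1))
  moreover have "(frobenius_norm (blk rs cs 0 0 T0))\<^sup>2 + (frobenius_norm (blk rs cs 0 0 T1))\<^sup>2
    = (pair_norm (blk rs cs 0 0 T0) (blk rs cs 0 0 T1))\<^sup>2" by (simp add: pair_norm_def)
  moreover have "(pair_norm T0 T1)\<^sup>2 \<ge> (pair_norm (blk rs cs 1 1 T0) (blk rs cs 1 1 T1))\<^sup>2
    + (pair_norm (blk rs cs 1 0 T0) (blk rs cs 1 0 T1))\<^sup>2 + (pair_norm (blk rs cs 0 1 T0) (blk rs cs 0 1 T1))\<^sup>2
    + (pair_norm (blk rs cs 0 0 T0) (blk rs cs 0 0 T1))\<^sup>2"
    using pair_norm_sq_blocks[of T0 T1] assms by (simp add: structured_def sum_less_3)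
  ultimately show ?thesis by linarith
qed

lemma kronecker_coefficients_add:
  assumes T: "structured T0 T1"
  shows "kronecker_coefficients m n l e h (A + state_part T0) (B + input_part T0) (C + output_part T0) (S0 + T0) (S1 + T1)"
proof -
  note tb = structured_blocks[OF T]
  have Tc: "T0 \<in> carrier_mat nr nc" "T1 \<in> carrier_mat nr nc" using T by (simp_all add: structured_def)
  have add: "blk rs cs a b (G + H) = blk rs cs a b G + blk rs cs a b H"
    if "a < 3" "b < 3" "G \<in> carrier_mat nr nc" "H \<in> carrier_mat nr nc" for a b and G H :: "'a mat"
    using that by (intro blk_add) simp_all
  have B0: "blk rs cs 0 1 (S0 + T0) = (K_last h m)\<^sup>T * (C + output_part T0)"
  proof -
    have "blk rs cs 0 1 (S0 + T0) = (K_last h m)\<^sup>T * C + (K_last h m)\<^sup>T * output_part T0"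
      using add[of 0 1 S0 T0] S_carrier Tc S_blocks(1) tb(14) by simp
    also have "\<dots> = (K_last h m)\<^sup>T * (C + output_part T0)"
      by (rule mult_add_distrib_mat[symmetric, of _ p m _ l]) (use K_sizes C parts_carrier in auto)
    finally show ?thesis .
  qed
  have B1: "blk rs cs 1 0 (S0 + T0) = (B + input_part T0) * K_last e n"
  proof -
    have "blk rs cs 1 0 (S0 + T0) = B * K_last e n + input_part T0 * K_last e n"
      using add[of 1 0 S0 T0] S_carrier Tc S_blocks(3) tb(15) by simp
    also have "\<dots> = (B + input_part T0) * K_last e n"
      by (rule add_mult_distrib_mat[symmetric, of _ l n _ _ q]) (use K_sizes B parts_carrier in auto)
    finally show ?thesis .
  qed
  have Kc: "(K_low h m :: 'a mat)\<^sup>T \<in> carrier_mat p (h * m)" "- (K_high h m :: 'a mat)\<^sup>T \<in> carrier_mat p (h * m)"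
    "(K_low e n :: 'a mat) \<in> carrier_mat (e * n) q" "- (K_high e n :: 'a mat) \<in> carrier_mat (e * n) q"
    using K_sizes by auto
  show ?thesis
  proof (unfold_locales, goal_cases)
    case 1 show ?case using A parts_carrier by auto
  next
    case 2 show ?case using B parts_carrier by auto
  next
    case 3 show ?case using C parts_carrier by auto
  next
    case 4 show ?case using S_carrier Tc by (simp only: p_def[symmetric] q_def[symmetric]) auto
  next
    case 5 show ?case using S_carrier Tc by (simp only: p_def[symmetric] q_def[symmetric]) auto
  next
    case 6 show ?case by (rule B0)
  next
    case 8 show ?case by (rule B1)
  qed (use S_carrier Tc S_blocks tb Kc in \<open>simp_all add: add p_def[symmetric] q_def[symmetric] del: mult_Suc\<close>, simp_all add: p_def q_def)
qed

lemma structured_zero: "structured (0\<^sub>m nr nc) (0\<^sub>m nr nc)"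
  by (simp add: structured_def)

lemma structured_add:
  assumes "structured T0 T1" "structured U0 U1"
  shows "structured (T0 + U0) (T1 + U1)"
  using assms unfolding structured_def by auto

lemma structured_closed:
  assumes "mat_tendsto nr nc T0 L0" "mat_tendsto nr nc T1 L1" "\<And>j. structured (T0 j) (T1 j)"
  shows "structured L0 L1"
  unfolding structured_def
proof (intro conjI allI impI)
  fix i j assume ij: "i < nr" "j < nc"
  { assume "\<not> free0 i j"
    then have "(\<lambda>k. T0 k $$ (i, j)) = (\<lambda>_. 0)" using assms(3) ij by (simp add: structured_def)
    moreover have "(\<lambda>k. T0 k $$ (i, j)) \<longlonglongrightarrow> L0 $$ (i, j)" using assms(1) ij by (simp add: mat_tendsto_def)
    ultimately show "L0 $$ (i, j) = 0" using LIMSEQ_const_iff[of 0 "L0 $$ (i, j)"] by simp }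
  { assume "\<not> free1 i j"
    then have "(\<lambda>k. T1 k $$ (i, j)) = (\<lambda>_. 0)" using assms(3) ij by (simp add: structured_def)
    moreover have "(\<lambda>k. T1 k $$ (i, j)) \<longlonglongrightarrow> L1 $$ (i, j)" using assms(2) ij by (simp add: mat_tendsto_def)
    ultimately show "L1 $$ (i, j) = 0" using LIMSEQ_const_iff[of 0 "L1 $$ (i, j)"] by simp }
qed (use assms in \<open>simp_all add: mat_tendsto_def\<close>)

text \<open>A bound for the growth of the remainder over the three stages, the last one on the left.\<close>

definition restoration_factor :: real where
  "restoration_factor =
     (let a2 = sqrt 2 * real (max e h); a3 = sqrt 2 * (real (max e h) * max 1 (spectral_norm A ^ max e h))
      in (1 + sqrt (4 * a3\<^sup>2 + 4 * a3 + 2) * spectral_size) * (1 + sqrt (4 * a2\<^sup>2 + 4 * a2 + 2) * spectral_size)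
         * (1 + 6 * s_const e h A B C * spectral_size))"

end

lemma s_const_nonneg: "0 \<le> s_const e h A B C"
  by (auto simp: s_const_def Let_def ab_const_def gamma_const_def intro!: add_nonneg_nonneg simp: le_max_iff_disj)

text \<open>The simplified Newton iteration applied to the first-order solver of the three stages.\<close>

lemma structured_perturbation:
  fixes S0 S1 :: "'a::{real_normed_field, euclidean_space} mat"
  assumes "kronecker_coefficients m n l e h A B C S0 S1"
  defines "r \<equiv> (h + 1) * m + l + e * n" and "c \<equiv> (e + 1) * n + l + h * m"
    and "rho \<equiv> kronecker_coefficients.restoration_factor e h A B C S0 S1"
  obtains \<tau> K where "0 < \<tau>" "0 < K"
    "\<And>D0 D1. D0 \<in> carrier_mat r c \<Longrightarrow> D1 \<in> carrier_mat r c \<Longrightarrow> pair_norm D0 D1 < \<tau> \<Longrightarrow>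
      \<exists>X Y T0 T1. X \<in> carrier_mat r r \<and> Y \<in> carrier_mat c c \<and> T0 \<in> carrier_mat r c \<and> T1 \<in> carrier_mat r c \<and>
        frobenius_norm X < 1 \<and> frobenius_norm Y < 1 \<and> kronecker_coefficients.structured m n l e h T0 T1 \<and>
        (1\<^sub>m r + X) * (S0 + D0) * (1\<^sub>m c + Y) = S0 + T0 \<and>
        (1\<^sub>m r + X) * (S1 + D1) * (1\<^sub>m c + Y) = S1 + T1 \<and>
        pair_norm T0 T1 \<le> rho * (pair_norm D0 D1 + K * (pair_norm D0 D1)\<^sup>2)"
proof -
  interpret kronecker_coefficients m n l e h A B C S0 S1 by fact
  have rc: "r = nr" "c = nc" by (simp_all add: r_def c_def p_def q_def)
  define a2 a3 where "a2 = sqrt 2 * real (max e h)" and "a3 = sqrt 2 * (real (max e h) * max 1 (spectral_norm A ^ max e h))"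
  define c1 c2 c3 where "c1 = 6 * s_const e h A B C" and "c2 = sqrt (4 * a2\<^sup>2 + 4 * a2 + 2)" and "c3 = sqrt (4 * a3\<^sup>2 + 4 * a3 + 2)"
  define b1 b2 b3 where "b1 = 1 + c1 * spectral_size" and "b2 = 1 + c2 * spectral_size" and "b3 = 1 + c3 * spectral_size"
  have rho: "rho = b3 * b2 * b1"
    by (simp add: rho_def restoration_factor_def Let_def b1_def b2_def b3_def c1_def c2_def c3_def a2_def a3_def)
  have c0: "0 \<le> c1" "0 \<le> c2" "0 \<le> c3" "0 \<le> spectral_size"
    by (simp_all add: c1_def c2_def c3_def a2_def a3_def spectral_size_def s_const_nonneg le_max_iff_disj)
  then have b0: "0 \<le> b1" "0 \<le> b2" "0 \<le> b3" by (simp_all add: b1_def b2_def b3_def)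
  \<comment> \<open>The last summand only serves to make \<open>k\<close> positive.\<close>
  define k where "k = c1 + c2 * b1 + c3 * b2 * b1 + 1"
  have k: "0 < k" unfolding k_def using c0 b0 by (intro add_nonneg_pos) auto
  have solver: "\<exists>X Y T0 T1. X \<in> carrier_mat nr nr \<and> Y \<in> carrier_mat nc nc \<and> T0 \<in> carrier_mat nr nc \<and> T1 \<in> carrier_mat nr nc \<and>
        structured T0 T1 \<and> G0 = X * S0 + S0 * Y + T0 \<and> G1 = X * S1 + S1 * Y + T1 \<and>
        frobenius_norm X \<le> k * pair_norm G0 G1 \<and> frobenius_norm Y \<le> k * pair_norm G0 G1 \<and>
        pair_norm T0 T1 \<le> rho * pair_norm G0 G1"
    if G: "G0 \<in> carrier_mat nr nc" "G1 \<in> carrier_mat nr nc" for G0 G1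
  proof -
    obtain X Y where X: "X \<in> carrier_mat nr nr" and Y: "Y \<in> carrier_mat nc nc"
      and st: "structured (residual S0 X Y G0) (residual S1 X Y G1)"
      and n: "frobenius_norm X + frobenius_norm Y \<le> (c1 + c2 * b1 + c3 * b2 * b1) * pair_norm G0 G1"
      and nR: "pair_norm (residual S0 X Y G0) (residual S1 X Y G1) \<le> b3 * b2 * b1 * pair_norm G0 G1"
      using first_order_solver[OF G] unfolding b1_def b2_def b3_def c1_def c2_def c3_def a2_def a3_def by metis
    have "(c1 + c2 * b1 + c3 * b2 * b1) * pair_norm G0 G1 \<le> k * pair_norm G0 G1"
      by (intro mult_right_mono) (simp_all add: k_def)
    then have nk: "frobenius_norm X \<le> k * pair_norm G0 G1" "frobenius_norm Y \<le> k * pair_norm G0 G1"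
      using n frobenius_norm_nonneg[of X] frobenius_norm_nonneg[of Y] by linarith+
    have split: "G = X * S + S * Y + residual S X Y G" if "S \<in> carrier_mat nr nc" "G \<in> carrier_mat nr nc" for S G
      using residual_carrier[OF that(1) X Y] that
      by (intro eq_matI) (auto simp del: index_mult_mat(1))
    show ?thesis
      using X Y st nk nR residual_carrier(4)[OF S_carrier(1) X Y] residual_carrier(4)[OF S_carrier(2) X Y]
        split[OF S_carrier(1) G(1)] split[OF S_carrier(2) G(2)] unfolding rho by blast
  qed
  show thesis
  proof (rule newton_iteration[where Q = structured and k = k and rho = rho, OF S_carrier], goal_cases)
    case 1 show ?case by (rule k)
  next
    case 2 show ?case using rho b0 by simp
  next
    case (3 G0 G1) then show ?case by (rule solver)
  next
    case 4 show ?case by (rule structured_zero)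
  next
    case 5 then show ?case by (intro structured_add)
  next
    case (6 T0 T1 L0 L1) then show ?case by (intro structured_closed[of T0 L0 T1 L1])
  next
    case (7 \<tau> K)
    show ?case
      by (rule that[OF 7(1,2)]) (simp only: rc 7(3))
  qed
qed

section \<open>Coefficients of block Kronecker pencils\<close>

lemma coeff_mat_carrier [simp]: "coeff_mat P k \<in> carrier_mat (dim_row P) (dim_col P)"
  "dim_row (coeff_mat P k) = dim_row P" "dim_col (coeff_mat P k) = dim_col P"
  by (simp_all add: coeff_mat_def)

lemma coeff_mat_index: "i < dim_row P \<Longrightarrow> j < dim_col P \<Longrightarrow> coeff_mat P k $$ (i, j) = coeff (P $$ (i, j)) k"
  by (simp add: coeff_mat_def)

lemma pencil_carrier: "pencil r c P \<Longrightarrow> P \<in> carrier_mat r c"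
  by (simp add: pencil_def)

lemma pencil_eqI:
  assumes P: "pencil r c P" and Q: "pencil r c Q"
    and "coeff_mat P 0 = coeff_mat Q 0" "coeff_mat P 1 = coeff_mat Q 1"
  shows "P = Q"
proof (rule eq_matI)
  have c: "P \<in> carrier_mat r c" "Q \<in> carrier_mat r c" using P Q by (simp_all add: pencil_def)
  fix i j assume "i < dim_row Q" "j < dim_col Q"
  then have ij: "i < r" "j < c" using c by auto
  show "P $$ (i, j) = Q $$ (i, j)"
  proof (rule poly_eqI)
    fix k :: nat
    consider "k = 0" | "k = 1" | "k > 1" by linarith
    then show "coeff (P $$ (i, j)) k = coeff (Q $$ (i, j)) k"
    proof cases
      case 1
      then show ?thesis using assms(3) ij c by (metis carrier_matD coeff_mat_index)
    next
      case 2
      then show ?thesis using assms(4) ij c by (metis carrier_matD coeff_mat_index)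
    next
      case 3
      have "degree (P $$ (i, j)) \<le> 1" "degree (Q $$ (i, j)) \<le> 1" using P Q ij by (simp_all add: pencil_def)
      then show ?thesis using 3 by (simp add: coeff_eq_0)
    qed
  qed
qed (use P Q in \<open>auto simp: pencil_def\<close>)

lemma blk_coeff_mat:
  assumes "length rs = 3" "length cs = 3" "a < 3" "b < 3" "P \<in> carrier_mat (sum_list rs) (sum_list cs)"
  shows "blk rs cs a b (coeff_mat P k) = coeff_mat (blk rs cs a b P) k"
  by (rule eq_matI) (use assms in \<open>auto simp: blk_def coeff_mat_def off_less\<close>)

lemma blk_pencil:
  assumes "length rs = 3" "length cs = 3" "a < 3" "b < 3" "pencil (sum_list rs) (sum_list cs) P"
  shows "pencil (rs ! a) (cs ! b) (blk rs cs a b P)"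
  using assms by (auto simp: pencil_def blk_def off_less)

lemma append_cols_index:
  assumes "X \<in> carrier_mat r c" "Y \<in> carrier_mat r c'" "i < r" "j < c + c'"
  shows "(X @\<^sub>c Y) $$ (i, j) = (if j < c then X $$ (i, j) else Y $$ (i, j - c))"
  using assms unfolding append_cols_def by auto

lemma append_cols_carrier:
  assumes "X \<in> carrier_mat r c" "Y \<in> carrier_mat r c'"
  shows "X @\<^sub>c Y \<in> carrier_mat r (c + c')"
  using assms unfolding append_cols_def by auto

lemma append_rows_index:
  assumes "X \<in> carrier_mat r c" "Y \<in> carrier_mat r' c" "i < r + r'" "j < c"
  shows "(X @\<^sub>r Y) $$ (i, j) = (if i < r then X $$ (i, j) else Y $$ (i - r, j))"
  using assms unfolding append_rows_def by auto

lemma append_eq_assemble: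
  assumes x: "x00 \<in> carrier_mat r0 c0" "x01 \<in> carrier_mat r0 c1" "x02 \<in> carrier_mat r0 c2"
    "x10 \<in> carrier_mat r1 c0" "x11 \<in> carrier_mat r1 c1" "x12 \<in> carrier_mat r1 c2"
    "x20 \<in> carrier_mat r2 c0" "x21 \<in> carrier_mat r2 c1" "x22 \<in> carrier_mat r2 c2"
  shows "(x00 @\<^sub>c x01 @\<^sub>c x02) @\<^sub>r (x10 @\<^sub>c x11 @\<^sub>c x12) @\<^sub>r (x20 @\<^sub>c x21 @\<^sub>c x22)
    = assemble [r0, r1, r2] [c0, c1, c2] (grid x00 x01 x02 x10 x11 x12 x20 x21 x22)" (is "?L = ?R")
proof (rule eq_matI)
  note c2 = append_cols_carrier[OF x(2,3)] append_cols_carrier[OF x(5,6)] append_cols_carrier[OF x(8,9)]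
  note c3 = append_cols_carrier[OF x(1) c2(1)] append_cols_carrier[OF x(4) c2(2)] append_cols_carrier[OF x(7) c2(3)]
  note r2 = carrier_append_rows[OF c3(2,3)]
  note r3 = carrier_append_rows[OF c3(1) r2]
  show d: "dim_row ?L = dim_row ?R" "dim_col ?L = dim_col ?R"
    using r3 by (auto simp: assemble_def)
  fix i j assume "i < dim_row ?R" "j < dim_col ?R"
  then have ij: "i < r0 + (r1 + r2)" "j < c0 + (c1 + c2)" using d r3 by auto
  have "i < r0 \<or> (\<exists>i'<r1. i = r0 + i') \<or> (\<exists>i'<r2. i = r0 + r1 + i')"
    "j < c0 \<or> (\<exists>j'<c1. j = c0 + j') \<or> (\<exists>j'<c2. j = c0 + c1 + j')"
    using ij by presburger+
  then show "?L $$ (i, j) = ?R $$ (i, j)"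
    by (elim disjE exE conjE)
      (simp_all add: append_rows_index[OF c3(1) r2] append_rows_index[OF c3(2,3)]
        append_cols_index[OF x(1) c2(1)] append_cols_index[OF x(4) c2(2)] append_cols_index[OF x(7) c2(3)]
        append_cols_index[OF x(2,3)] append_cols_index[OF x(5,6)] append_cols_index[OF x(8,9)]
        assemble_def block_of_def off_def)
qed

lemma const_poly_mat_carrier [simp]: "const_poly_mat X \<in> carrier_mat r c \<longleftrightarrow> X \<in> carrier_mat r c"
  "dim_row (const_poly_mat X) = dim_row X" "dim_col (const_poly_mat X) = dim_col X"
  by (auto simp: const_poly_mat_def)

lemma pencil_const: "X \<in> carrier_mat r c \<Longrightarrow> pencil r c (const_poly_mat X)"
  by (auto simp: pencil_def const_poly_mat_def)

lemma coeff_mat_const: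
  "coeff_mat (const_poly_mat X) 0 = X" "k > 0 \<Longrightarrow> coeff_mat (const_poly_mat X) k = 0\<^sub>m (dim_row X) (dim_col X)"
  by (rule eq_matI; auto simp: coeff_mat_def const_poly_mat_def coeff_pCons split: nat.split)+

lemma K_hat_eq: "K_hat k r = K_last k r"
proof (rule eq_matI)
  fix i j assume "i < dim_row (K_last k r :: 'a mat)" "j < dim_col (K_last k r :: 'a mat)"
  then have ij: "i < r" "j < (k + 1) * r" by auto
  then have "0 < r" "j div r < k + 1" by (auto simp: less_mult_imp_div_less)
  moreover have "j div r = k \<and> i = j mod r \<longleftrightarrow> j = i + k * r"
  proof
    assume "j div r = k \<and> i = j mod r"
    then show "j = i + k * r" using div_mult_mod_eq[of j r] by (metis add.commute)
  next
    assume "j = i + k * r"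
    then show "j div r = k \<and> i = j mod r" using ij by simp
  qed
  ultimately show "(K_hat k r :: 'a mat) $$ (i, j) = K_last k r $$ (i, j)"
    using ij by (auto simp: K_hat_def kronecker_def last_unit_def K_last_def shift_mat_def)
qed (simp_all add: K_hat_def kronecker_def last_unit_def)

lemma K_pencil_carrier: "K_pencil k r \<in> carrier_mat (k * r) ((k + 1) * r)"
  by (simp add: K_pencil_def kronecker_def L_pencil_def E_mat_def F_mat_def carrier_matI)

lemma K_pencil_index:
  assumes "i < k * r" "j < (k + 1) * r"
  shows "(K_pencil k r :: 'a::field poly mat) $$ (i, j) = [:K_low k r $$ (i, j), - K_high k r $$ (i, j):]"
proof -
  have r: "0 < r" using assms(1) by (cases r) auto
  have d: "i div r < k" "j div r < k + 1" using assms by (auto simp: less_mult_imp_div_less)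
  have 1: "j div r = i div r \<and> i mod r = j mod r \<longleftrightarrow> j = i"
    by (metis div_mult_mod_eq)
  have 2: "j div r = i div r + 1 \<and> i mod r = j mod r \<longleftrightarrow> j = i + r"
  proof
    assume a: "j div r = i div r + 1 \<and> i mod r = j mod r"
    have "j = (j div r) * r + j mod r" by simp
    also have "\<dots> = (i div r) * r + i mod r + r" using a by simp
    finally show "j = i + r" by simp
  qed (use r in simp)
  have L: "(L_pencil k :: 'a poly mat) $$ (i div r, j div r)
    = [:if j div r = i div r then 1 else 0, if j div r = i div r + 1 then -1 else 0:]"
    using d by (auto simp: L_pencil_def const_poly_mat_def E_mat_def F_mat_def)
  have dims: "dim_row (L_pencil k :: 'a poly mat) = k" "dim_col (L_pencil k :: 'a poly mat) = k + 1"
    by (simp_all add: L_pencil_def const_poly_mat_def E_mat_def F_mat_def)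
  have "(K_pencil k r :: 'a poly mat) $$ (i, j) = (L_pencil k :: 'a poly mat) $$ (i div r, j div r) * (if i mod r = j mod r then 1 else 0)"
    using assms r by (simp add: K_pencil_def kronecker_def dims)
  also have "\<dots> = [:K_low k r $$ (i, j), - K_high k r $$ (i, j):]"
    unfolding L using assms 1 2 by (auto simp: K_low_def K_high_def shift_mat_def)
  finally show ?thesis .
qed

lemma K_pencil_pencil: "pencil (k * r) ((k + 1) * r) (K_pencil k r :: 'a::field poly mat)"
  using K_pencil_carrier[of k r] K_pencil_index[of _ k r, where ?'a = 'a] by (auto simp: pencil_def)

lemma coeff_mat_K_pencil:
  "coeff_mat (K_pencil k r :: 'a::field poly mat) 0 = K_low k r"
  "coeff_mat (K_pencil k r :: 'a::field poly mat) 1 = - K_high k r"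
  using K_pencil_carrier[of k r, where ?'a = 'a]
  by (auto intro!: eq_matI simp: coeff_mat_def K_pencil_index)

lemma pencil_transpose: "pencil r c P \<Longrightarrow> pencil c r (P\<^sup>T)"
  by (auto simp: pencil_def)

lemma coeff_mat_transpose: "coeff_mat (P\<^sup>T) k = (coeff_mat P k)\<^sup>T"
  by (rule eq_matI) (auto simp: coeff_mat_def)

lemma minus_one_poly: "- 1 = [:- 1 :: 'a::comm_ring_1:]"
  by (simp add: one_pCons)

lemma state_pencil:
  assumes A: "(A :: 'a::field mat) \<in> carrier_mat l l"
  shows "pencil l l (const_poly_mat A - [:0, 1:] \<cdot>\<^sub>m 1\<^sub>m l)"
    "coeff_mat (const_poly_mat A - [:0, 1:] \<cdot>\<^sub>m 1\<^sub>m l) 0 = A"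
    "coeff_mat (const_poly_mat A - [:0, 1:] \<cdot>\<^sub>m 1\<^sub>m l) 1 = - 1\<^sub>m l"
proof -
  have e: "(const_poly_mat A - [:0, 1:] \<cdot>\<^sub>m 1\<^sub>m l) $$ (i, j) = [:A $$ (i, j), if i = j then -1 else 0:]"
    if "i < l" "j < l" for i j
    using that A by (auto simp: const_poly_mat_def minus_one_poly)
  have c: "const_poly_mat A - [:0, 1:] \<cdot>\<^sub>m 1\<^sub>m l \<in> carrier_mat l l"
    by (intro minus_carrier_mat) simp
  show "pencil l l (const_poly_mat A - [:0, 1:] \<cdot>\<^sub>m 1\<^sub>m l)"
    using c e by (auto simp: pencil_def)
  show "coeff_mat (const_poly_mat A - [:0, 1:] \<cdot>\<^sub>m 1\<^sub>m l) 0 = A"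
    "coeff_mat (const_poly_mat A - [:0, 1:] \<cdot>\<^sub>m 1\<^sub>m l) 1 = - 1\<^sub>m l"
    by (rule eq_matI; use A c e in \<open>auto simp: coeff_mat_index\<close>)+
qed

lemma zero_pencil: "pencil r c (0\<^sub>m r c)" "coeff_mat (0\<^sub>m r c) k = 0\<^sub>m r c"
  by (auto simp: pencil_def coeff_mat_def)

lemma mult_mat_index_sum:
  assumes "X \<in> carrier_mat r s" "Y \<in> carrier_mat s c" "i < r" "j < c"
  shows "(X * Y) $$ (i, j) = (\<Sum>t<s. X $$ (i, t) * Y $$ (t, j))"
  using assms by (simp add: scalar_prod_def atLeast0LessThan)

lemma pencil_frobenius_norm_eq: "pencil_frobenius_norm P = pair_norm (coeff_mat P 0) (coeff_mat P 1)"
  by (simp add: pencil_frobenius_norm_def pair_norm_def)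

lemma coeff_mat_add:
  assumes "P \<in> carrier_mat r c" "Q \<in> carrier_mat r c"
  shows "coeff_mat (P + Q) k = coeff_mat P k + coeff_mat Q k"
  by (rule eq_matI) (use assms in \<open>auto simp: coeff_mat_def\<close>)

lemma coeff_mat_const_mult:
  fixes P :: "'a::field poly mat"
  assumes U: "U \<in> carrier_mat r r'" and P: "P \<in> carrier_mat r' c"
  shows "coeff_mat (const_poly_mat U * P) k = U * coeff_mat P k"
proof (rule eq_matI)
  have Uc: "const_poly_mat U \<in> carrier_mat r r'" using U by simp
  have kc: "coeff_mat P k \<in> carrier_mat r' c" using P coeff_mat_carrier(1)[of P k] by simp
  fix i j assume "i < dim_row (U * coeff_mat P k)" "j < dim_col (U * coeff_mat P k)"
  then have ij: "i < r" "j < c" using U P by auto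
  have "coeff ((const_poly_mat U * P) $$ (i, j)) k = (\<Sum>t<r'. U $$ (i, t) * coeff (P $$ (t, j)) k)"
    unfolding mult_mat_index_sum[OF Uc P ij] coeff_sum using U ij
    by (intro sum.cong refl) (simp add: const_poly_mat_def)
  also have "\<dots> = (U * coeff_mat P k) $$ (i, j)"
    unfolding mult_mat_index_sum[OF U kc ij] using P ij by (intro sum.cong refl) (simp add: coeff_mat_index)
  finally show "coeff_mat (const_poly_mat U * P) k $$ (i, j) = (U * coeff_mat P k) $$ (i, j)"
    using ij U P by (simp add: coeff_mat_index del: index_mult_mat(1))
qed (use U P in auto)

lemma coeff_mat_mult_const:
  fixes P :: "'a::field poly mat"
  assumes P: "P \<in> carrier_mat r c" and V: "V \<in> carrier_mat c c'"
  shows "coeff_mat (P * const_poly_mat V) k = coeff_mat P k * V"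
proof (rule eq_matI)
  have Vc: "const_poly_mat V \<in> carrier_mat c c'" using V by simp
  have kc: "coeff_mat P k \<in> carrier_mat r c" using P coeff_mat_carrier(1)[of P k] by simp
  fix i j assume "i < dim_row (coeff_mat P k * V)" "j < dim_col (coeff_mat P k * V)"
  then have ij: "i < r" "j < c'" using V P by auto
  have "coeff ((P * const_poly_mat V) $$ (i, j)) k = (\<Sum>t<c. coeff (P $$ (i, t)) k * V $$ (t, j))"
    unfolding mult_mat_index_sum[OF P Vc ij] coeff_sum using V ij
    by (intro sum.cong refl) (simp add: const_poly_mat_def)
  also have "\<dots> = (coeff_mat P k * V) $$ (i, j)"
    unfolding mult_mat_index_sum[OF kc V ij] using P ij by (intro sum.cong refl) (simp add: coeff_mat_index)
  finally show "coeff_mat (P * const_poly_mat V) k $$ (i, j) = (coeff_mat P k * V) $$ (i, j)"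
    using ij V P by (simp add: coeff_mat_index del: index_mult_mat(1))
qed (use V P in auto)

lemma pencil_add:
  assumes "pencil r c P" "pencil r c Q" shows "pencil r c (P + Q)"
  using assms by (auto simp: pencil_def intro!: degree_add_le)

lemma pencil_const_sandwich:
  fixes P :: "'a::field poly mat"
  assumes U: "U \<in> carrier_mat r r" and P: "pencil r c P" and V: "V \<in> carrier_mat c c"
  shows "pencil r c (const_poly_mat U * P * const_poly_mat V)"
    "coeff_mat (const_poly_mat U * P * const_poly_mat V) k = U * coeff_mat P k * V"
proof -
  note Pc = pencil_carrier[OF P]
  have UP: "const_poly_mat U * P \<in> carrier_mat r c" using U Pc by auto
  have UPV: "const_poly_mat U * P * const_poly_mat V \<in> carrier_mat r c" using UP V by auto
  show co: "coeff_mat (const_poly_mat U * P * const_poly_mat V) k = U * coeff_mat P k * V" for k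
    by (simp only: coeff_mat_mult_const[OF UP V] coeff_mat_const_mult[OF U Pc])
  have zero: "coeff_mat (const_poly_mat U * P * const_poly_mat V) k = 0\<^sub>m r c" if "k > 1" for k
  proof -
    have "coeff_mat P k = 0\<^sub>m r c"
    proof (rule eq_matI)
      fix i j assume "i < dim_row (0\<^sub>m r c :: 'a mat)" "j < dim_col (0\<^sub>m r c :: 'a mat)"
      then have ij: "i < r" "j < c" by auto
      then have "degree (P $$ (i, j)) < k" using P that by (fastforce simp: pencil_def)
      then show "coeff_mat P k $$ (i, j) = 0\<^sub>m r c $$ (i, j)" using ij Pc by (simp add: coeff_mat_def coeff_eq_0)
    qed (use Pc in auto)
    then show ?thesis unfolding co using U V by simp
  qed
  show "pencil r c (const_poly_mat U * P * const_poly_mat V)"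
    unfolding pencil_def
  proof (intro conjI allI impI UPV)
    fix i j assume ij: "i < r" "j < c"
    show "degree ((const_poly_mat U * P * const_poly_mat V) $$ (i, j)) \<le> 1"
    proof (rule degree_le, intro allI impI)
      fix k :: nat assume "1 < k"
      from zero[OF this] have "coeff_mat (const_poly_mat U * P * const_poly_mat V) k $$ (i, j) = 0" using ij by simp
      moreover have "coeff_mat (const_poly_mat U * P * const_poly_mat V) k $$ (i, j)
        = coeff ((const_poly_mat U * P * const_poly_mat V) $$ (i, j)) k"
        by (rule coeff_mat_index) (use ij in \<open>simp_all only: carrier_matD[OF UPV]\<close>)
      ultimately show "coeff ((const_poly_mat U * P * const_poly_mat V) $$ (i, j)) k = 0" by (simp only:)
    qed
  qed
qed

locale kronecker_data =
  fixes m n l e h :: nat and A B C :: "'a::real_normed_field mat" and M :: "'a poly mat"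
  assumes A: "A \<in> carrier_mat l l" and B: "B \<in> carrier_mat l n" and C: "C \<in> carrier_mat m l"
    and M: "pencil ((h + 1) * m) ((e + 1) * n) M"
begin

definition p where "p = (h + 1) * m"
definition q where "q = (e + 1) * n"

abbreviation "rs \<equiv> row_sizes m n l e h"
abbreviation "cs \<equiv> col_sizes m n l e h"
abbreviation "P \<equiv> block_kronecker_pencil m n l e h A B C M"

definition part :: "nat \<Rightarrow> nat \<Rightarrow> 'a poly mat" where
  "part = grid M (const_poly_mat ((K_last h m)\<^sup>T * C)) ((K_pencil h m)\<^sup>T)
     (const_poly_mat (B * K_last e n)) (const_poly_mat A - [:0, 1:] \<cdot>\<^sub>m 1\<^sub>m l) (0\<^sub>m l (h * m))
     (K_pencil e n) (0\<^sub>m (e * n) l) (0\<^sub>m (e * n) (h * m))"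

lemma sizes [simp]: "length rs = 3" "length cs = 3" "sum_list rs = p + l + e * n" "sum_list cs = q + l + h * m"
  "rs ! 0 = p" "rs ! 1 = l" "rs ! Suc 0 = l" "rs ! 2 = e * n"
  "cs ! 0 = q" "cs ! 1 = l" "cs ! Suc 0 = l" "cs ! 2 = h * m"
  by (simp_all add: row_sizes_def col_sizes_def p_def q_def)

lemma Kc: "(K_last h m :: 'a mat) \<in> carrier_mat m p" "(K_last e n :: 'a mat) \<in> carrier_mat n q"
  "(K_pencil h m :: 'a poly mat) \<in> carrier_mat (h * m) p" "(K_pencil e n :: 'a poly mat) \<in> carrier_mat (e * n) q"
  unfolding p_def q_def by (simp_all only: K_carrier K_pencil_carrier)

lemma part_pencil: "a < 3 \<Longrightarrow> b < 3 \<Longrightarrow> pencil (rs ! a) (cs ! b) (part a b)"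
proof -
  have "(K_last h m)\<^sup>T * C \<in> carrier_mat p l" "B * K_last e n \<in> carrier_mat l q" using Kc B C by auto
  note ps = pencil_const[OF this(1)] pencil_const[OF this(2)] M[folded p_def q_def] state_pencil(1)[OF A]
    K_pencil_pencil[of e n, folded q_def, where ?'a = 'a]
    pencil_transpose[OF K_pencil_pencil[of h m, folded p_def, where ?'a = 'a]]
  assume "a < 3" "b < 3"
  then show "pencil (rs ! a) (cs ! b) (part a b)"
    unfolding less_3_cases part_def by (elim disjE) (simp_all add: ps zero_pencil)
qed

lemma P_eq: "P = assemble rs cs part"
proof -
  have "part a b \<in> carrier_mat (rs ! a) (cs ! b)" if "a < 3" "b < 3" for a b
    using part_pencil[OF that] by (rule pencil_carrier)
  from this[of 0 0] this[of 0 1] this[of 0 2] this[of 1 0] this[of 1 1] this[of 1 2] this[of 2 0] this[of 2 1] this[of 2 2]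
  show ?thesis
    unfolding block_kronecker_pencil_def K_hat_eq part_def row_sizes_def col_sizes_def
    by (intro append_eq_assemble) (simp_all add: p_def q_def)
qed

lemma blk_P: "a < 3 \<Longrightarrow> b < 3 \<Longrightarrow> blk rs cs a b P = part a b"
  unfolding P_eq by (rule blk_assemble) (auto intro: pencil_carrier part_pencil)

lemma P_carrier: "P \<in> carrier_mat (p + l + e * n) (q + l + h * m)"
  unfolding P_eq using assemble_carrier[of rs cs part] by (simp only: sizes)

lemma P_pencil: "pencil (p + l + e * n) (q + l + h * m) P"
  unfolding pencil_def
proof (intro conjI allI impI P_carrier)
  fix i j assume "i < p + l + e * n" "j < q + l + h * m"
  then obtain a i' b j' where ab: "a < 3" "i' < rs ! a" "i = off rs a + i'" "b < 3" "j' < cs ! b" "j = off cs b + j'"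
    using block_decomp[of rs i] block_decomp[of cs j] by (metis sizes(1,2,3,4))
  then have "P $$ (i, j) = blk rs cs a b P $$ (i', j')" by (simp only: blk_def index_mat(1) split_conv)
  then have "P $$ (i, j) = part a b $$ (i', j')" using blk_P[OF ab(1,4)] by simp
  then show "degree (P $$ (i, j)) \<le> 1" using part_pencil[OF ab(1,4)] ab by (simp add: pencil_def)
qed

lemma coefficients: "kronecker_coefficients m n l e h A B C (coeff_mat P 0) (coeff_mat P 1)"
proof -
  have b: "blk rs cs a b (coeff_mat P k) = coeff_mat (part a b) k" if "a < 3" "b < 3" for a b k
    using that P_carrier by (subst blk_coeff_mat) (simp_all add: blk_P)
  have Kc': "(K_last h m)\<^sup>T * C \<in> carrier_mat p l" "B * K_last e n \<in> carrier_mat l q" using Kc B C by auto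
  show ?thesis
  proof (unfold_locales, goal_cases)
    case 4 show ?case using P_carrier coeff_mat_carrier(1)[of P 0] by (simp add: p_def q_def)
  next
    case 5 show ?case using P_carrier coeff_mat_carrier(1)[of P 1] by (simp add: p_def q_def)
  qed (use A B C Kc' in \<open>simp_all add: b part_def coeff_mat_const coeff_mat_transpose coeff_mat_K_pencil[unfolded One_nat_def]
      coeff_mat_K_pencil state_pencil[OF A, unfolded One_nat_def] state_pencil[OF A] zero_pencil transpose_uminus\<close>)
qed

end

text \<open>The corner block of a block Kronecker pencil is arbitrary, so that the prescribed blocks of the two
  coefficients are all that has to be checked.\<close>

lemma pencil_eq_block_kronecker_pencil:
  fixes Q :: "'a::real_normed_field poly mat"
  assumes Q: "pencil ((h + 1) * m + l + e * n) ((e + 1) * n + l + h * m) Q"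
    and co: "kronecker_coefficients m n l e h A B C (coeff_mat Q 0) (coeff_mat Q 1)"
  defines "M \<equiv> blk (row_sizes m n l e h) (col_sizes m n l e h) 0 0 Q"
  shows "pencil ((h + 1) * m) ((e + 1) * n) M" "Q = block_kronecker_pencil m n l e h A B C M"
proof -
  interpret kc: kronecker_coefficients m n l e h A B C "coeff_mat Q 0" "coeff_mat Q 1" by (rule co)
  have Qp: "pencil (sum_list kc.rs) (sum_list kc.cs) Q" using Q by (simp add: kc.p_def kc.q_def)
  have Qc: "Q \<in> carrier_mat (sum_list kc.rs) (sum_list kc.cs)" by (rule pencil_carrier[OF Qp])
  show M: "pencil ((h + 1) * m) ((e + 1) * n) M"
    unfolding M_def using blk_pencil[OF kc.sizes(1,2) _ _ Qp, of 0 0] by (simp add: kc.p_def kc.q_def)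
  interpret kd: kronecker_data m n l e h A B C M
    by unfold_locales (rule kc.A kc.B kc.C M)+
  interpret kp: kronecker_coefficients m n l e h A B C "coeff_mat kd.P 0" "coeff_mat kd.P 1"
    by (rule kd.coefficients)
  have Pp: "pencil (sum_list kc.rs) (sum_list kc.cs) kd.P"
    using kd.P_pencil by (simp add: kc.p_def kc.q_def kd.p_def kd.q_def)
  have Pc: "kd.P \<in> carrier_mat (sum_list kc.rs) (sum_list kc.cs)" by (rule pencil_carrier[OF Pp])
  have carr: "coeff_mat R k \<in> carrier_mat (sum_list kc.rs) (sum_list kc.cs)"
    if "R \<in> carrier_mat (sum_list kc.rs) (sum_list kc.cs)" for R :: "'a poly mat" and k
    using that coeff_mat_carrier(1)[of R k] by simp
  have "kd.part 0 0 = M" by (simp add: kd.part_def)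
  then have corner: "blk kc.rs kc.cs 0 0 (coeff_mat Q k) = blk kc.rs kc.cs 0 0 (coeff_mat kd.P k)" for k
    using blk_coeff_mat[OF kc.sizes(1,2) _ _ Qc, of 0 0 k] blk_coeff_mat[OF kc.sizes(1,2) _ _ Pc, of 0 0 k]
      kd.blk_P[of 0 0] \<open>kd.part 0 0 = M\<close> M_def by simp
  have "coeff_mat Q 0 = coeff_mat kd.P 0"
  proof (rule blk_eqI[OF kc.sizes(1,2) carr[OF Qc] carr[OF Pc]])
    fix a b :: nat assume "a < 3" "b < 3"
    then show "blk kc.rs kc.cs a b (coeff_mat Q 0) = blk kc.rs kc.cs a b (coeff_mat kd.P 0)"
      unfolding less_3_cases by (elim disjE) (simp_all only: corner kc.S0_blocks kp.S0_blocks)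
  qed
  moreover have "coeff_mat Q 1 = coeff_mat kd.P 1"
  proof (rule blk_eqI[OF kc.sizes(1,2) carr[OF Qc] carr[OF Pc]])
    fix a b :: nat assume "a < 3" "b < 3"
    then show "blk kc.rs kc.cs a b (coeff_mat Q 1) = blk kc.rs kc.cs a b (coeff_mat kd.P 1)"
      unfolding less_3_cases by (elim disjE) (simp_all only: corner kc.S1_blocks kp.S1_blocks)
  qed
  ultimately show "Q = block_kronecker_pencil m n l e h A B C M"
    by (rule pencil_eqI[OF Qp Pp])
qed

section \<open>The polynomial part\<close>

text \<open>The coefficients of \<open>(\<Lambda>\<^sub>h \<otimes> I)\<^sup>T (N\<^sub>0 + \<lambda> N\<^sub>1) (\<Lambda>\<^sub>e \<otimes> I)\<close>. The block of \<open>N\<^sub>0\<close> at \<open>(i, j)\<close> is multiplied by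
  \<open>\<lambda>\<^sup>h\<^sup>-\<^sup>i\<close> and \<open>\<lambda>\<^sup>e\<^sup>-\<^sup>j\<close>, that of \<open>N\<^sub>1\<close> by one more power of \<open>\<lambda>\<close>. The bounds \<open>i \<le> h\<close> and \<open>j \<le> e\<close>
  keep the subtractions of natural numbers exact.\<close>

definition antidiagonal_sums ::
  "nat \<Rightarrow> nat \<Rightarrow> nat \<Rightarrow> nat \<Rightarrow> 'a::comm_monoid_add mat \<Rightarrow> 'a mat \<Rightarrow> nat \<Rightarrow> 'a mat" where
  "antidiagonal_sums m n e h N0 N1 k = mat m n (\<lambda>(a, b). \<Sum>i<h + 1. \<Sum>j<e + 1.
     (if (h - i) + (e - j) = k then N0 $$ (i * m + a, j * n + b) else 0)
     + (if (h - i) + (e - j) + 1 = k then N1 $$ (i * m + a, j * n + b) else 0))"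

lemma sum_lessThan_mult:
  fixes g :: "nat \<Rightarrow> 'a::comm_monoid_add"
  shows "(\<Sum>x<k * r. g x) = (\<Sum>i<k. \<Sum>a<r. g (i * r + a))"
proof (induction k)
  case (Suc k)
  have "(\<Sum>x<Suc k * r. g x) = (\<Sum>x<k * r + r. g x)" by (simp add: add.commute)
  then show ?case using Suc by (simp add: sum_lessThan_add)
qed simp

lemma Lambda_kronecker_index:
  assumes "i < h + 1" "a < m" "b < m"
  shows "(Lambda_mat h \<otimes>\<^sub>k 1\<^sub>m m :: 'a::field poly mat) $$ (i * m + a, b) = (if a = b then monom 1 (h - i) else 0)"
proof -
  have "i * m + a < (h + 1) * m"
    using assms by (metis add.commute less_mult_imp_div_less mult_less_cancel2 nat_less_add_iff2 mult_Suc Suc_eq_plus1 add_less_cancel_left order_less_le_trans mult_le_mono1 Suc_leI)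
  then show ?thesis using assms by (auto simp: kronecker_def Lambda_mat_def)
qed

lemma Lambda_kronecker_carrier: "(Lambda_mat h \<otimes>\<^sub>k 1\<^sub>m m :: 'a::field poly mat) \<in> carrier_mat ((h + 1) * m) m"
  by (simp add: kronecker_def Lambda_mat_def carrier_matI)

lemma Lambda_sandwich_index:
  fixes M :: "'a::field poly mat"
  assumes M: "M \<in> carrier_mat ((h + 1) * m) ((e + 1) * n)" and ab: "a < m" "b < n"
  shows "((Lambda_mat h \<otimes>\<^sub>k 1\<^sub>m m)\<^sup>T * M * (Lambda_mat e \<otimes>\<^sub>k 1\<^sub>m n)) $$ (a, b) =
    (\<Sum>i<h + 1. \<Sum>j<e + 1. monom 1 ((h - i) + (e - j)) * M $$ (i * m + a, j * n + b))"
proof -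
  let ?L = "Lambda_mat h \<otimes>\<^sub>k 1\<^sub>m m :: 'a poly mat" and ?R = "Lambda_mat e \<otimes>\<^sub>k 1\<^sub>m n :: 'a poly mat"
  note L = Lambda_kronecker_carrier[of h m, where ?'a = 'a] and R = Lambda_kronecker_carrier[of e n, where ?'a = 'a]
  have LM: "?L\<^sup>T * M \<in> carrier_mat m ((e + 1) * n)" by (rule mult_carrier_mat[OF _ M]) (simp only: transpose_carrier_mat L)
  have left: "(?L\<^sup>T * M) $$ (a, y) = (\<Sum>i<h + 1. monom 1 (h - i) * M $$ (i * m + a, y))" if y: "y < (e + 1) * n" for y
  proof -
    have "(?L\<^sup>T * M) $$ (a, y) = (\<Sum>x<(h + 1) * m. ?L $$ (x, a) * M $$ (x, y))"
      using L M ab y by (simp add: scalar_prod_def atLeast0LessThan)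
    also have "\<dots> = (\<Sum>i<h + 1. \<Sum>c<m. (if c = a then monom 1 (h - i) * M $$ (i * m + c, y) else 0))"
      unfolding sum_lessThan_mult using ab by (intro sum.cong refl) (simp add: Lambda_kronecker_index)
    finally show ?thesis using ab by simp
  qed
  have "(?L\<^sup>T * M * ?R) $$ (a, b) = (\<Sum>y<(e + 1) * n. (?L\<^sup>T * M) $$ (a, y) * ?R $$ (y, b))"
    by (rule mult_mat_index_sum[OF LM R ab])
  also have "\<dots> = (\<Sum>j<e + 1. \<Sum>c<n. (if c = b then (?L\<^sup>T * M) $$ (a, j * n + c) * monom 1 (e - j) else 0))"
    unfolding sum_lessThan_mult using ab by (intro sum.cong refl) (simp add: Lambda_kronecker_index del: index_mult_mat(1))
  also have "\<dots> = (\<Sum>j<e + 1. (?L\<^sup>T * M) $$ (a, j * n + b) * monom 1 (e - j))"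
    using ab by simp
  also have "\<dots> = (\<Sum>j<e + 1. \<Sum>i<h + 1. monom 1 ((h - i) + (e - j)) * M $$ (i * m + a, j * n + b))"
  proof (intro sum.cong refl)
    fix j assume "j \<in> {..<e + 1}"
    then have "j * n + b < (e + 1) * n"
      using ab by (metis lessThan_iff Suc_leI Suc_eq_plus1 add.commute add_less_cancel_left mult_Suc mult_le_mono1 order_less_le_trans)
    then show "(?L\<^sup>T * M) $$ (a, j * n + b) * monom 1 (e - j)
      = (\<Sum>i<h + 1. monom 1 ((h - i) + (e - j)) * M $$ (i * m + a, j * n + b))"
      unfolding left[OF \<open>j * n + b < (e + 1) * n\<close>] sum_distrib_right
    proof (intro sum.cong refl)
      fix i
      have "monom 1 ((h - i) + (e - j)) = monom 1 (h - i) * monom (1 :: 'a) (e - j)" by (simp add: mult_monom)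
      then show "monom 1 (h - i) * M $$ (i * m + a, j * n + b) * monom 1 (e - j)
        = monom 1 ((h - i) + (e - j)) * M $$ (i * m + a, j * n + b)" by (simp only: mult_ac)
    qed
  qed
  also have "\<dots> = (\<Sum>i<h + 1. \<Sum>j<e + 1. monom 1 ((h - i) + (e - j)) * M $$ (i * m + a, j * n + b))"
    by (rule sum.swap)
  finally show ?thesis .
qed

lemma coeff_monom_mult_degree_1:
  fixes P :: "'a::field poly"
  assumes "degree P \<le> 1"
  shows "coeff (monom 1 s * P) k = (if s = k then coeff P 0 else 0) + (if s + 1 = k then coeff P 1 else 0)"
  using assms by (auto simp: coeff_monom_mult coeff_eq_0 not_le)

lemma matrix_poly_index:
  "a < m \<Longrightarrow> b < n \<Longrightarrow> coeff (matrix_poly m n d D $$ (a, b)) k = (if k \<le> d then D k $$ (a, b) else 0)"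
  by (simp add: matrix_poly_def coeff_sum)

lemma matrix_poly_antidiagonal_sums:
  fixes M :: "'a::field poly mat"
  assumes M: "pencil ((h + 1) * m) ((e + 1) * n) M"
  shows "matrix_poly m n (e + h + 1) (antidiagonal_sums m n e h (coeff_mat M 0) (coeff_mat M 1))
    = (Lambda_mat h \<otimes>\<^sub>k 1\<^sub>m m)\<^sup>T * M * (Lambda_mat e \<otimes>\<^sub>k 1\<^sub>m n)" (is "?L = ?R")
proof (rule eq_matI)
  have Mc: "M \<in> carrier_mat ((h + 1) * m) ((e + 1) * n)" by (rule pencil_carrier[OF M])
  have Rc: "?R \<in> carrier_mat m n"
    using Lambda_kronecker_carrier[of h m, where ?'a = 'a] Lambda_kronecker_carrier[of e n, where ?'a = 'a] Mc
    by (intro mult_carrier_mat[of _ m "(e + 1) * n"] mult_carrier_mat[of _ m "(h + 1) * m"])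
      (simp_all only: transpose_carrier_mat)
  show "dim_row ?L = dim_row ?R" "dim_col ?L = dim_col ?R"
    using carrier_matD[OF Rc] by (simp_all only: matrix_poly_def dim_row_mat dim_col_mat)
  fix a b assume "a < dim_row ?R" "b < dim_col ?R"
  then have ab: "a < m" "b < n" using Rc by auto
  have bound: "i * m + a < (h + 1) * m" "j * n + b < (e + 1) * n" if "i < h + 1" "j < e + 1" for i j
    using that ab by (metis Suc_leI Suc_eq_plus1 add.commute add_less_cancel_left mult_Suc mult_le_mono1 order_less_le_trans)+
  show "?L $$ (a, b) = ?R $$ (a, b)"
  proof (rule poly_eqI)
    fix k
    have "coeff (?R $$ (a, b)) k = (\<Sum>i<h + 1. \<Sum>j<e + 1.
      (if (h - i) + (e - j) = k then coeff_mat M 0 $$ (i * m + a, j * n + b) else 0)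
      + (if (h - i) + (e - j) + 1 = k then coeff_mat M 1 $$ (i * m + a, j * n + b) else 0))"
      unfolding Lambda_sandwich_index[OF Mc ab] coeff_sum
    proof (intro sum.cong refl)
      fix i j assume "i \<in> {..<h + 1}" "j \<in> {..<e + 1}"
      then have ij: "i * m + a < (h + 1) * m" "j * n + b < (e + 1) * n" using bound by auto
      have "degree (M $$ (i * m + a, j * n + b)) \<le> 1" using M[unfolded pencil_def] ij by blast
      then show "coeff (monom 1 (h - i + (e - j)) * M $$ (i * m + a, j * n + b)) k =
        (if h - i + (e - j) = k then coeff_mat M 0 $$ (i * m + a, j * n + b) else 0) +
        (if h - i + (e - j) + 1 = k then coeff_mat M 1 $$ (i * m + a, j * n + b) else 0)"
        using ij Mc by (simp only: coeff_monom_mult_degree_1 coeff_mat_index carrier_matD)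
    qed
    moreover have "\<dots> = 0" if "k > e + h + 1" using that by (intro sum.neutral ballI) auto
    moreover have "antidiagonal_sums m n e h (coeff_mat M 0) (coeff_mat M 1) k $$ (a, b) = (\<Sum>i<h + 1. \<Sum>j<e + 1.
      (if (h - i) + (e - j) = k then coeff_mat M 0 $$ (i * m + a, j * n + b) else 0)
      + (if (h - i) + (e - j) + 1 = k then coeff_mat M 1 $$ (i * m + a, j * n + b) else 0))"
      using ab by (simp only: antidiagonal_sums_def index_mat(1) split_conv)
    ultimately show "coeff (?L $$ (a, b)) k = coeff (?R $$ (a, b)) k"
      unfolding matrix_poly_index[OF ab] by (metis not_le)
  qed
qed

lemma antidiagonal_sums_minus:
  fixes N0 N1 :: "'a::ab_group_add mat"
  assumes "N0 \<in> carrier_mat ((h + 1) * m) ((e + 1) * n)" "N1 \<in> carrier_mat ((h + 1) * m) ((e + 1) * n)"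
    and "P0 \<in> carrier_mat ((h + 1) * m) ((e + 1) * n)" "P1 \<in> carrier_mat ((h + 1) * m) ((e + 1) * n)"
  shows "antidiagonal_sums m n e h (N0 + P0) (N1 + P1) k - antidiagonal_sums m n e h N0 N1 k
    = antidiagonal_sums m n e h P0 P1 k" (is "?L = ?R")
proof (rule eq_matI)
  fix a b assume "a < dim_row ?R" "b < dim_col ?R"
  then have ab: "a < m" "b < n" by (auto simp: antidiagonal_sums_def)
  have bound: "i * m + a < (h + 1) * m" "j * n + b < (e + 1) * n" if "i < h + 1" "j < e + 1" for i j
    using that ab by (metis Suc_leI Suc_eq_plus1 add.commute add_less_cancel_left mult_Suc mult_le_mono1 order_less_le_trans)+
  have idx: "(G + H) $$ (i * m + a, j * n + b) = G $$ (i * m + a, j * n + b) + H $$ (i * m + a, j * n + b)"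
    if "i < h + 1" "j < e + 1" "H \<in> carrier_mat ((h + 1) * m) ((e + 1) * n)" for G H :: "'a mat" and i j
    using that bound[OF that(1,2)] by (intro index_add_mat(1)) auto
  have idx': "(N0 + P0) $$ (i * m + a, j * n + b) = N0 $$ (i * m + a, j * n + b) + P0 $$ (i * m + a, j * n + b)"
    "(N1 + P1) $$ (i * m + a, j * n + b) = N1 $$ (i * m + a, j * n + b) + P1 $$ (i * m + a, j * n + b)"
    if "i < Suc h" "j < Suc e" for i j
    using that by (simp_all only: idx[OF _ _ assms(3)] idx[OF _ _ assms(4)] Suc_eq_plus1)
  show "?L $$ (a, b) = ?R $$ (a, b)"
    using ab unfolding antidiagonal_sums_def
    by (simp add: sum_subtractf[symmetric] del: sum.lessThan_Suc)
      (rule sum.cong[OF refl], rule sum.cong[OF refl], use idx' in auto)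
qed (simp_all add: antidiagonal_sums_def)

lemma norm_sum_sq_le:
  fixes z :: "'b \<Rightarrow> 'a::real_normed_vector"
  assumes "finite T"
  shows "(norm (\<Sum>x\<in>T. z x))\<^sup>2 \<le> real (card T) * (\<Sum>x\<in>T. (norm (z x))\<^sup>2)"
proof -
  have "norm (\<Sum>x\<in>T. z x) \<le> (\<Sum>x\<in>T. \<bar>1\<bar> * \<bar>norm (z x)\<bar>)"
    by (rule order_trans[OF norm_sum]) simp
  also have "\<dots> \<le> L2_set (\<lambda>_. 1) T * L2_set (\<lambda>x. norm (z x)) T"
    by (rule L2_set_mult_ineq)
  finally have "(norm (\<Sum>x\<in>T. z x))\<^sup>2 \<le> (L2_set (\<lambda>_. 1 :: real) T * L2_set (\<lambda>x. norm (z x)) T)\<^sup>2"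
    by (intro power_mono) auto
  also have "\<dots> = real (card T) * (\<Sum>x\<in>T. (norm (z x))\<^sup>2)"
    by (simp add: power_mult_distrib L2_set_def sum_nonneg)
  finally show ?thesis .
qed

lemma sum_triple:
  fixes f :: "'b \<times> 'c \<times> 'd \<Rightarrow> 'a::comm_monoid_add"
  shows "(\<Sum>x\<in>A \<times> B \<times> D. f x) = (\<Sum>i\<in>A. \<Sum>j\<in>B. \<Sum>t\<in>D. f (i, j, t))"
  by (simp add: sum.cartesian_product case_prod_unfold)

text \<open>The equation determines \<open>j\<close> from \<open>i\<close> and \<open>t\<close>, and \<open>i\<close> from \<open>j\<close> and \<open>t\<close>.\<close>

lemma antidiagonal_card:
  fixes e h k :: nat
  defines "T \<equiv> {(i, j, t). i < h + 1 \<and> j < e + 1 \<and> t < 2 \<and> (h - i) + (e - j) + t = k}"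
  shows "finite T" "card T \<le> 2 * min (e + 1) (h + 1)"
proof -
  have "T \<subseteq> {..<h + 1} \<times> {..<e + 1} \<times> {..<2}" by (auto simp: T_def)
  then show fin: "finite T" by (rule finite_subset) simp
  have "card T = card ((\<lambda>(i, j, t). (i, t)) ` T)"
    by (rule card_image[symmetric]) (auto simp: inj_on_def T_def)
  also have "\<dots> \<le> card ({..<h + 1} \<times> {..<2::nat})" by (rule card_mono) (auto simp: T_def)
  finally have 1: "card T \<le> 2 * (h + 1)" by simp
  have "card T = card ((\<lambda>(i, j, t). (j, t)) ` T)"
    by (rule card_image[symmetric]) (auto simp: inj_on_def T_def)
  also have "\<dots> \<le> card ({..<e + 1} \<times> {..<2::nat})" by (rule card_mono) (auto simp: T_def)
  finally have "card T \<le> 2 * (e + 1)" by simp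
  with 1 show "card T \<le> 2 * min (e + 1) (h + 1)" by simp
qed

text \<open>Every block of \<open>N0\<close> and \<open>N1\<close> belongs to exactly one antidiagonal, and by \<open>antidiagonal_card\<close> an
  antidiagonal has at most \<open>2 min (e + 1) (h + 1)\<close> members. The Cauchy-Schwarz inequality on every antidiagonal
  costs this number as a factor. In the proof, \<open>t\<close> tells \<open>N0\<close> from \<open>N1\<close>.\<close>

lemma antidiagonal_sums_norm:
  fixes N0 N1 :: "'a::real_normed_field mat"
  assumes N: "N0 \<in> carrier_mat ((h + 1) * m) ((e + 1) * n)" "N1 \<in> carrier_mat ((h + 1) * m) ((e + 1) * n)"
  shows "(\<Sum>k\<le>e + h + 1. (frobenius_norm (antidiagonal_sums m n e h N0 N1 k))\<^sup>2)
    \<le> real (2 * min (e + 1) (h + 1)) * ((frobenius_norm N0)\<^sup>2 + (frobenius_norm N1)\<^sup>2)"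
proof -
  define I where "I = {..<h + 1} \<times> {..<e + 1} \<times> {..<2::nat}"
  define w where "w = (\<lambda>(i, j, t). (h - i) + (e - j) + t)"
  define z where "z = (\<lambda>a b (i, j, t :: nat). (if t = 0 then N0 else N1) $$ (i * m + a, j * n + b))"
  define c where "c = real (2 * min (e + 1) (h + 1))"
  have I: "finite I" by (simp add: I_def)
  have wI: "w x \<le> e + h + 1" if "x \<in> I" for x using that by (auto simp: I_def w_def)
  have entry: "antidiagonal_sums m n e h N0 N1 k $$ (a, b) = (\<Sum>x\<in>{x \<in> I. w x = k}. z a b x)"
    if "a < m" "b < n" for k a b
  proof -
    have "(\<Sum>x\<in>{x \<in> I. w x = k}. z a b x) = (\<Sum>x\<in>I. if w x = k then z a b x else 0)"
      by (rule sum.inter_filter[OF I])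
    also have "\<dots> = (\<Sum>i<h + 1. \<Sum>j<e + 1. \<Sum>t<2. if w (i, j, t) = k then z a b (i, j, t) else 0)"
      unfolding I_def by (rule sum_triple)
    also have "\<dots> = antidiagonal_sums m n e h N0 N1 k $$ (a, b)"
    proof -
      have "(\<Sum>t<2. if w (i, j, t) = k then z a b (i, j, t) else 0)
        = (if (h - i) + (e - j) = k then N0 $$ (i * m + a, j * n + b) else 0)
          + (if (h - i) + (e - j) + 1 = k then N1 $$ (i * m + a, j * n + b) else 0)" for i j
        by (simp add: numeral_2_eq_2 w_def z_def)
      then show ?thesis using that by (simp only: antidiagonal_sums_def index_mat(1) split_conv)
    qed
    finally show ?thesis ..
  qed
  have card: "real (card {x \<in> I. w x = k}) \<le> c" for k
  proof -
    have "{x \<in> I. w x = k} = {(i, j, t). i < h + 1 \<and> j < e + 1 \<and> t < 2 \<and> (h - i) + (e - j) + t = k}"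
      by (auto simp: I_def w_def)
    then have "card {x \<in> I. w x = k} \<le> 2 * min (e + 1) (h + 1)"
      using antidiagonal_card(2)[of h e k] by (simp only:)
    then show ?thesis unfolding c_def of_nat_le_iff .
  qed
  have sq: "(\<Sum>k\<le>e + h + 1. (norm (antidiagonal_sums m n e h N0 N1 k $$ (a, b)))\<^sup>2) \<le> c * (\<Sum>x\<in>I. (norm (z a b x))\<^sup>2)"
    if ab: "a < m" "b < n" for a b
  proof -
    have "(\<Sum>k\<le>e + h + 1. (norm (antidiagonal_sums m n e h N0 N1 k $$ (a, b)))\<^sup>2)
      \<le> (\<Sum>k\<le>e + h + 1. c * (\<Sum>x\<in>{x \<in> I. w x = k}. (norm (z a b x))\<^sup>2))"
      unfolding entry[OF ab]
    proof (rule sum_mono)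
      fix k
      show "(norm (\<Sum>x\<in>{x \<in> I. w x = k}. z a b x))\<^sup>2 \<le> c * (\<Sum>x\<in>{x \<in> I. w x = k}. (norm (z a b x))\<^sup>2)"
        using norm_sum_sq_le[of "{x \<in> I. w x = k}" "z a b"] I
          mult_right_mono[OF card[of k], of "\<Sum>x\<in>{x \<in> I. w x = k}. (norm (z a b x))\<^sup>2"]
        by (simp add: sum_nonneg)
    qed
    also have "\<dots> = c * (\<Sum>k\<le>e + h + 1. \<Sum>x\<in>{x \<in> I. w x = k}. (norm (z a b x))\<^sup>2)"
      by (rule sum_distrib_left[symmetric])
    also have "(\<Sum>k\<le>e + h + 1. \<Sum>x\<in>{x \<in> I. w x = k}. (norm (z a b x))\<^sup>2) = (\<Sum>x\<in>I. (norm (z a b x))\<^sup>2)"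
      by (rule sum.group[OF I]) (use wI in auto)
    finally show ?thesis .
  qed
  have blocks: "(frobenius_norm G)\<^sup>2 = (\<Sum>a<m. \<Sum>b<n. \<Sum>i<h + 1. \<Sum>j<e + 1. (norm (G $$ (i * m + a, j * n + b)))\<^sup>2)"
    if "G \<in> carrier_mat ((h + 1) * m) ((e + 1) * n)" for G :: "'a mat"
  proof -
    have "(frobenius_norm G)\<^sup>2 = (\<Sum>i<h + 1. \<Sum>a<m. \<Sum>j<e + 1. \<Sum>b<n. (norm (G $$ (i * m + a, j * n + b)))\<^sup>2)"
      unfolding frobenius_norm_sq_carrier[OF that] sum_lessThan_mult ..
    also have "\<dots> = (\<Sum>a<m. \<Sum>i<h + 1. \<Sum>j<e + 1. \<Sum>b<n. (norm (G $$ (i * m + a, j * n + b)))\<^sup>2)"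
      by (rule sum.swap)
    also have "\<dots> = (\<Sum>a<m. \<Sum>i<h + 1. \<Sum>b<n. \<Sum>j<e + 1. (norm (G $$ (i * m + a, j * n + b)))\<^sup>2)"
      by (intro sum.cong refl sum.swap)
    also have "\<dots> = (\<Sum>a<m. \<Sum>b<n. \<Sum>i<h + 1. \<Sum>j<e + 1. (norm (G $$ (i * m + a, j * n + b)))\<^sup>2)"
      by (intro sum.cong refl sum.swap)
    finally show ?thesis .
  qed
  have zsum: "(\<Sum>x\<in>I. (norm (z a b x))\<^sup>2) = (\<Sum>i<h + 1. \<Sum>j<e + 1. (norm (N0 $$ (i * m + a, j * n + b)))\<^sup>2)
    + (\<Sum>i<h + 1. \<Sum>j<e + 1. (norm (N1 $$ (i * m + a, j * n + b)))\<^sup>2)" for a b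
  proof -
    have "(\<Sum>x\<in>I. (norm (z a b x))\<^sup>2) = (\<Sum>i<h + 1. \<Sum>j<e + 1. \<Sum>t<2. (norm (z a b (i, j, t)))\<^sup>2)"
      unfolding I_def by (rule sum_triple)
    then show ?thesis by (simp add: numeral_2_eq_2 z_def sum.distrib del: sum.lessThan_Suc, simp)
  qed
  have "(\<Sum>k\<le>e + h + 1. (frobenius_norm (antidiagonal_sums m n e h N0 N1 k))\<^sup>2)
    = (\<Sum>k\<le>e + h + 1. \<Sum>a<m. \<Sum>b<n. (norm (antidiagonal_sums m n e h N0 N1 k $$ (a, b)))\<^sup>2)"
    by (intro sum.cong refl frobenius_norm_sq_carrier) (simp add: antidiagonal_sums_def)
  also have "\<dots> = (\<Sum>a<m. \<Sum>k\<le>e + h + 1. \<Sum>b<n. (norm (antidiagonal_sums m n e h N0 N1 k $$ (a, b)))\<^sup>2)"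
    by (rule sum.swap)
  also have "\<dots> = (\<Sum>a<m. \<Sum>b<n. \<Sum>k\<le>e + h + 1. (norm (antidiagonal_sums m n e h N0 N1 k $$ (a, b)))\<^sup>2)"
    by (intro sum.cong refl sum.swap)
  also have "\<dots> \<le> (\<Sum>a<m. \<Sum>b<n. c * (\<Sum>x\<in>I. (norm (z a b x))\<^sup>2))"
    by (intro sum_mono sq) auto
  also have "\<dots> = c * ((frobenius_norm N0)\<^sup>2 + (frobenius_norm N1)\<^sup>2)"
    unfolding blocks[OF N(1)] blocks[OF N(2)] zsum by (simp only: sum.distrib sum_distrib_left distrib_left)
  finally show ?thesis unfolding c_def .
qed

lemma antidiagonal_sums_unique:
  fixes M :: "'a::field poly mat"
  assumes M: "pencil ((h + 1) * m) ((e + 1) * n) M"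
    and D: "\<And>k. k \<le> e + h + 1 \<Longrightarrow> D k \<in> carrier_mat m n"
    and eq: "matrix_poly m n (e + h + 1) D = (Lambda_mat h \<otimes>\<^sub>k 1\<^sub>m m)\<^sup>T * M * (Lambda_mat e \<otimes>\<^sub>k 1\<^sub>m n)"
    and k: "k \<le> e + h + 1"
  shows "D k = antidiagonal_sums m n e h (coeff_mat M 0) (coeff_mat M 1) k"
proof (rule eq_matI)
  let ?A = "antidiagonal_sums m n e h (coeff_mat M 0) (coeff_mat M 1)"
  fix a b assume "a < dim_row (?A k)" "b < dim_col (?A k)"
  then have ab: "a < m" "b < n" by (simp_all add: antidiagonal_sums_def)
  have "matrix_poly m n (e + h + 1) D = matrix_poly m n (e + h + 1) ?A"
    using eq matrix_poly_antidiagonal_sums[OF M] by simp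
  then have "coeff (matrix_poly m n (e + h + 1) D $$ (a, b)) k = coeff (matrix_poly m n (e + h + 1) ?A $$ (a, b)) k"
    by (rule arg_cong)
  then show "D k $$ (a, b) = ?A k $$ (a, b)" using k by (simp only: matrix_poly_index[OF ab] if_True)
qed (use D[OF k] in \<open>auto simp: antidiagonal_sums_def\<close>)

section \<open>The constants of the bound\<close>

text \<open>The constant \<open>f\<^sub>1\<close> is at least \<open>20 s\<close>, more than three times \<open>6 s\<close>. The surplus of \<open>2 s x\<close> makes up for
  the fact that the constant term 1 is divided by 3 as well.\<close>

lemma f1_bound:
  assumes "1 \<le> s_const e h A B C" "1 \<le> x"
  shows "1 + 6 * s_const e h A B C * x \<le> (1 + f1_const e h A B C * x) / 3"
proof -
  let ?s = "s_const e h A B C"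
  have s2: "14 / 10 \<le> sqrt 2" by (rule real_le_rsqrt) (simp add: power2_eq_square)
  have s3: "16 / 10 \<le> sqrt 3" by (rule real_le_rsqrt) (simp add: power2_eq_square)
  have lt: "sqrt 3 < 2" by (rule real_less_lsqrt) auto
  have "(2 + sqrt 3) * (2 - sqrt 3) = 1" by (simp add: algebra_simps)
  then have inv: "1 / (2 - sqrt 3) = 2 + sqrt 3" using lt by (simp add: field_simps)
  have "20 \<le> 4 * (14 / 10) * (2 + 16 / 10 :: real)" by simp
  also have "\<dots> \<le> 4 * sqrt 2 * (2 + sqrt 3)" using s2 s3 by (intro mult_mono) auto
  finally have "20 * (?s * x) \<le> 4 * sqrt 2 * (2 + sqrt 3) * (?s * x)"
    using assms by (intro mult_right_mono) auto
  also have "\<dots> = f1_const e h A B C * x"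
    unfolding f1_const_def inv[symmetric] by simp
  finally have "20 * (?s * x) \<le> f1_const e h A B C * x" .
  moreover have "1 * 1 \<le> ?s * x" using assms by (intro mult_mono) auto
  ultimately show ?thesis by simp
qed

text \<open>The constant \<open>f\<^sub>2\<close> itself is too small for the second stage, but \<open>3 f\<^sub>2 = 4 a - \<surd>2\<close> suffices. The factor 3 is the
  one gained by \<open>f\<^sub>1\<close>.\<close>

lemma f2_bound:
  fixes e h :: nat and x :: real
  assumes "0 < max e h" "0 \<le> x"
  defines "a \<equiv> sqrt 2 * real (max e h)"
  shows "1 + sqrt (4 * a\<^sup>2 + 4 * a + 2) * x \<le> 3 * (1 + f2_const e h * x)"
proof -
  define N where "N = real (max e h)"
  have N: "1 \<le> N" using assms(1) unfolding N_def by linarith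
  have s2: "14 / 10 \<le> sqrt 2" by (rule real_le_rsqrt) (simp add: power2_eq_square)
  have a: "a = sqrt 2 * N" by (simp add: a_def N_def)
  have s2N: "sqrt 2 * 1 \<le> sqrt 2 * N" using N by (intro mult_left_mono) auto
  then have a1: "14 / 10 \<le> a" using s2 a by linarith
  \<comment> \<open>As \<open>a \<ge> 7/5\<close>, the square of \<open>2 a + 6/5\<close> dominates the radicand.\<close>
  have "sqrt (4 * a\<^sup>2 + 4 * a + 2) \<le> 2 * a + 12 / 10"
    by (rule real_le_lsqrt) (use a1 in \<open>auto simp: power2_eq_square algebra_simps\<close>)
  also have "\<dots> \<le> 3 * f2_const e h"
  proof -
    have "3 * f2_const e h = 4 * (sqrt 2 * N) - sqrt 2"
      unfolding f2_const_def N_def[symmetric] by (simp add: field_simps)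
    then show ?thesis using a s2 s2N by linarith
  qed
  finally have "sqrt (4 * a\<^sup>2 + 4 * a + 2) * x \<le> 3 * f2_const e h * x"
    using assms(2) by (rule mult_right_mono)
  then show ?thesis by simp
qed

text \<open>Here \<open>f\<^sub>3 = \<surd>2 + 2 a\<close>, whose square exceeds the radicand by \<open>4 (\<surd>2 - 1) a\<close>.\<close>

lemma f3_bound:
  fixes A :: "'a::real_normed_field mat" and e h :: nat and x :: real
  assumes "0 \<le> x"
  defines "a \<equiv> sqrt 2 * (real (max e h) * max 1 (spectral_norm A ^ max e h))"
  shows "1 + sqrt (4 * a\<^sup>2 + 4 * a + 2) * x \<le> 1 + f3_const e h A * x"
proof -
  have a: "0 \<le> a" by (simp add: a_def le_max_iff_disj)
  have "sqrt (4 * a\<^sup>2 + 4 * a + 2) \<le> sqrt 2 + 2 * a"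
  proof (rule real_le_lsqrt)
    have "4 * a * 1 \<le> 4 * a * sqrt 2" using a by (intro mult_left_mono) auto
    then show "4 * a\<^sup>2 + 4 * a + 2 \<le> (sqrt 2 + 2 * a)\<^sup>2" by (simp add: power2_sum power_mult_distrib mult_ac)
  qed (use a in auto)
  also have "\<dots> = f3_const e h A"
    by (simp add: f3_const_def a_def max.commute[of h e] algebra_simps)
  finally show ?thesis using assms(1) by (simp add: mult_right_mono)
qed

lemma s_const_ge_1: "1 \<le> s_const e h A B C"
proof -
  have ab: "1 \<le> ab_const k A" for k by (simp add: ab_const_def le_max_iff_disj)
  have "0 \<le> gamma_const e h" by (simp add: gamma_const_def)
  then have "0 \<le> gamma_const e h * (ab_const h A * spectral_norm B + ab_const e A * spectral_norm C)"
    using ab[of h] ab[of e] by (intro mult_nonneg_nonneg add_nonneg_nonneg) auto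
  then show ?thesis using ab[of e] unfolding s_const_def Let_def by linarith
qed

context kronecker_coefficients
begin

text \<open>The Kronecker blocks contain entries equal to 1, unless both parameters vanish.\<close>

lemma spectral_size_ge_1:
  assumes "1 \<le> m" "1 \<le> n" "0 < max e h"
  shows "1 \<le> spectral_size"
proof -
  have entry: "norm (blk rs cs a b S0 $$ (0, 0)) \<le> spectral_size" if "a < 3" "b < 3" "0 < rs ! a" "0 < cs ! b" for a b
  proof -
    have "norm (blk rs cs a b S0 $$ (0, 0)) = norm (S0 $$ (off rs a + 0, off cs b + 0))"
      using that by (simp add: blk_def)
    also have "\<dots> \<le> spectral_norm S0"
      using off_less[OF sizes(1) that(1,3)] off_less[OF sizes(2) that(2,4)] S_carrier(1)
      by (intro norm_entry_le_spectral) auto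
    also have "\<dots> \<le> spectral_size" unfolding spectral_size_def by (rule real_le_rsqrt) simp
    finally show ?thesis .
  qed
  show ?thesis
  proof (cases "0 < e")
    case True
    then have "blk rs cs 2 0 S0 $$ (0, 0) = 1"
      using assms by (simp add: S_blocks K_low_def shift_mat_def)
    then show ?thesis using entry[of 2 0] True assms by (simp add: q_def)
  next
    case False
    then have "0 < h" using assms by simp
    then have "blk rs cs 0 2 S0 $$ (0, 0) = 1"
      using assms by (simp add: S_blocks K_low_def shift_mat_def)
    then show ?thesis using entry[of 0 2] \<open>0 < h\<close> assms by (simp add: p_def)
  qed
qed

lemma restoration_factor_bound:
  assumes "1 \<le> m" "1 \<le> n" "0 < max e h"
  shows "restoration_factor \<le> (1 + f1_const e h A B C * spectral_size) * (1 + f2_const e h * spectral_size)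
    * (1 + f3_const e h A * spectral_size)" and "0 \<le> restoration_factor"
proof -
  have x: "1 \<le> spectral_size" by (rule spectral_size_ge_1[OF assms])
  define a2 a3 where "a2 = sqrt 2 * real (max e h)" and "a3 = sqrt 2 * (real (max e h) * max 1 (spectral_norm A ^ max e h))"
  define b1 b2 b3 where "b1 = 1 + 6 * s_const e h A B C * spectral_size"
    and "b2 = 1 + sqrt (4 * a2\<^sup>2 + 4 * a2 + 2) * spectral_size" and "b3 = 1 + sqrt (4 * a3\<^sup>2 + 4 * a3 + 2) * spectral_size"
  define g1 g2 g3 where "g1 = 1 + f1_const e h A B C * spectral_size" and "g2 = 1 + f2_const e h * spectral_size"
    and "g3 = 1 + f3_const e h A * spectral_size"
  have le: "b1 \<le> g1 / 3" "b2 \<le> 3 * g2" "b3 \<le> g3"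
    unfolding b1_def b2_def b3_def g1_def g2_def g3_def a2_def a3_def
    using x by (rule f1_bound[OF s_const_ge_1], intro f2_bound[OF assms(3)], simp, intro f3_bound, simp)
  have nn: "0 \<le> b1" "0 \<le> b2" "0 \<le> b3"
    using x s_const_nonneg[of e h A B C] by (auto simp: b1_def b2_def b3_def a2_def a3_def le_max_iff_disj)
  have eq: "restoration_factor = b3 * b2 * b1"
    by (simp add: restoration_factor_def Let_def b1_def b2_def b3_def a2_def a3_def)
  have "b3 * b2 * b1 \<le> g3 * (3 * g2) * (g1 / 3)"
    using le nn by (intro mult_mono mult_nonneg_nonneg) auto
  then show "restoration_factor \<le> g1 * g2 * g3" by (simp add: eq mult_ac)
  show "0 \<le> restoration_factor" unfolding eq using nn by simp
qed

end

section \<open>The perturbation theorem\<close>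

lemma add_minus_cancel_mat: "X \<in> carrier_mat r c \<Longrightarrow> Y \<in> carrier_mat r c \<Longrightarrow> X + Y - X = (Y :: 'a::ab_group_add mat)"
  by (rule eq_matI) auto

theorem theorem4p15:
  fixes m n l d \<epsilon> \<eta> :: nat
    and R :: "'a::{real_normed_field, euclidean_space} poly fract mat"
    and A B C :: "'a mat" and D :: "nat \<Rightarrow> 'a mat"
    and S :: "'a poly mat"
  assumes "m \<ge> 1" and "n \<ge> 1" and "l \<ge> 1"
    and "d = \<epsilon> + \<eta> + 1" and "max \<epsilon> \<eta> > 0"
    and "minimal_representation m n l d R A B C D"
    and "block_kronecker_linearization m n l \<epsilon> \<eta> R A B C D S"
  shows "\<exists>\<tau>>0. \<exists>K>0. \<forall>\<Delta>\<^sub>S.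
    pencil (dim_row S) (dim_col S) \<Delta>\<^sub>S \<and> pencil_frobenius_norm \<Delta>\<^sub>S < \<tau> \<longrightarrow>
    (\<exists>R' A' B' C' D' S'.
       minimal_representation m n l d R' A' B' C' D' \<and>
       block_kronecker_linearization m n l \<epsilon> \<eta> R' A' B' C' D' S' \<and>
       strictly_equivalent (S + \<Delta>\<^sub>S) S' \<and>
       sqrt ((frobenius_norm (A' - A))\<^sup>2 + (frobenius_norm (B' - B))\<^sup>2 + (frobenius_norm (C' - C))\<^sup>2
             + (\<Sum>i\<le>d. (frobenius_norm (D' i - D i))\<^sup>2))
         / representation_norm l d A B C D
       \<le> K_SR l \<epsilon> \<eta> A B C D S * (pencil_frobenius_norm \<Delta>\<^sub>S / pencil_frobenius_norm S)
         + K * (pencil_frobenius_norm \<Delta>\<^sub>S / pencil_frobenius_norm S)\<^sup>2)"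
proof -
  have A: "A \<in> carrier_mat l l" and B: "B \<in> carrier_mat l n" and C: "C \<in> carrier_mat m l"
    and D: "\<And>i. i \<le> d \<Longrightarrow> D i \<in> carrier_mat m n" and Dd: "D d \<noteq> 0\<^sub>m m n" and min: "minimal_triple A B C"
    using assms(6) by (auto simp: minimal_representation_def)
  obtain M where M: "pencil ((\<eta> + 1) * m) ((\<epsilon> + 1) * n) M"
    and MD: "matrix_poly m n d D = (Lambda_mat \<eta> \<otimes>\<^sub>k 1\<^sub>m m)\<^sup>T * M * (Lambda_mat \<epsilon> \<otimes>\<^sub>k 1\<^sub>m n)"
    and S: "S = block_kronecker_pencil m n l \<epsilon> \<eta> A B C M"
    using assms(4,7) by (auto simp: block_kronecker_linearization_def)
  interpret kd: kronecker_data m n l \<epsilon> \<eta> A B C M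
    by unfold_locales (rule A B C M)+
  interpret kc: kronecker_coefficients m n l \<epsilon> \<eta> A B C "coeff_mat S 0" "coeff_mat S 1"
    unfolding S by (rule kd.coefficients)
  define r c where "r = (\<eta> + 1) * m + l + \<epsilon> * n" and "c = (\<epsilon> + 1) * n + l + \<eta> * m"
  have nrc: "kc.nr = r" "kc.nc = c" by (simp_all add: r_def c_def kc.p_def kc.q_def)
  have Sp: "pencil r c S" using kd.P_pencil unfolding S by (simp add: r_def c_def kd.p_def kd.q_def)
  note Sc = pencil_carrier[OF Sp]
  define \<sigma> where "\<sigma> = kc.spectral_size"
  have \<sigma>: "pencil_spectral_norm S = \<sigma>" by (simp only: \<sigma>_def kc.spectral_size_def pencil_spectral_norm_def)
  define \<rho> where "\<rho> = kc.restoration_factor"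
  define \<kappa> where "\<kappa> = (1 + f1_const \<epsilon> \<eta> A B C * \<sigma>) * (1 + f2_const \<epsilon> \<eta> * \<sigma>) * (1 + f3_const \<epsilon> \<eta> A * \<sigma>)"
  have \<rho>: "0 \<le> \<rho>" "\<rho> \<le> \<kappa>"
    unfolding \<rho>_def \<kappa>_def \<sigma>_def using kc.restoration_factor_bound[OF assms(1,2,5)] by simp_all
  obtain \<tau>0 K0 where \<tau>0: "0 < \<tau>0" and K0: "0 < K0"
    and newton: "\<And>D0 D1. D0 \<in> carrier_mat r c \<Longrightarrow> D1 \<in> carrier_mat r c \<Longrightarrow> pair_norm D0 D1 < \<tau>0 \<Longrightarrow>
      \<exists>X Y T0 T1. X \<in> carrier_mat r r \<and> Y \<in> carrier_mat c c \<and> T0 \<in> carrier_mat r c \<and> T1 \<in> carrier_mat r c \<and>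
        frobenius_norm X < 1 \<and> frobenius_norm Y < 1 \<and> kc.structured T0 T1 \<and>
        (1\<^sub>m r + X) * (coeff_mat S 0 + D0) * (1\<^sub>m c + Y) = coeff_mat S 0 + T0 \<and>
        (1\<^sub>m r + X) * (coeff_mat S 1 + D1) * (1\<^sub>m c + Y) = coeff_mat S 1 + T1 \<and>
        pair_norm T0 T1 \<le> \<rho> * (pair_norm D0 D1 + K0 * (pair_norm D0 D1)\<^sup>2)"
  proof (rule structured_perturbation[OF kc.kronecker_coefficients_axioms, folded r_def c_def \<rho>_def], goal_cases)
    case (1 \<tau> K)
    show ?case by (rule 1(1)[OF 1(2,3)]) (rule 1(4))
  qed
  obtain \<epsilon>0 where \<epsilon>0: "0 < \<epsilon>0" and stable: "\<And>A' B' C'. A' \<in> carrier_mat l l \<Longrightarrow> B' \<in> carrier_mat l n \<Longrightarrow> C' \<in> carrier_mat m l \<Longrightarrow>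
      frobenius_norm (A' - A) < \<epsilon>0 \<Longrightarrow> frobenius_norm (B' - B) < \<epsilon>0 \<Longrightarrow> frobenius_norm (C' - C) < \<epsilon>0 \<Longrightarrow> minimal_triple A' B' C'"
    using minimal_triple_open[OF A B C min] by metis
  define \<mu> where "\<mu> = sqrt (2 * real (Orderings.min (\<epsilon> + 1) (\<eta> + 1)))"
  have \<mu>: "1 \<le> \<mu>" "\<mu>\<^sup>2 = real (2 * Orderings.min (\<epsilon> + 1) (\<eta> + 1))" unfolding \<mu>_def by simp_all
  define \<nu> where "\<nu> = frobenius_norm (D d)"
  have \<nu>: "0 < \<nu>" using frobenius_norm_eq_0[OF D[OF order_refl]] Dd frobenius_norm_nonneg[of "D d"] unfolding \<nu>_def by (metis order_le_less)
  \<comment> \<open>For \<open>\<delta> \<le> 1\<close> the structured perturbation has norm at most \<open>L \<delta>\<close>.\<close>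
  define L where "L = \<rho> * (1 + K0) + 1"
  have L: "0 < L" using \<rho> K0 unfolding L_def by (intro add_nonneg_pos mult_nonneg_nonneg) auto
  \<comment> \<open>The last two bounds preserve minimality and the nonzero leading coefficient \<open>D d\<close>.\<close>
  define \<tau> where "\<tau> = Orderings.min (Orderings.min \<tau>0 1) (Orderings.min (\<epsilon>0 / L) (\<nu> / (\<mu> * L)))"
  have \<tau>: "0 < \<tau>" using \<tau>0 \<epsilon>0 L \<nu> \<mu> unfolding \<tau>_def by auto
  define rn where "rn = representation_norm l d A B C D"
  have rn: "0 < rn" unfolding rn_def representation_norm_def
    using assms(3) by (auto intro!: add_pos_nonneg sum_nonneg)
  define sn where "sn = pencil_frobenius_norm S"
  have sn: "0 < sn"
  proof -
    have "1 \<le> \<sigma>" unfolding \<sigma>_def by (rule kc.spectral_size_ge_1[OF assms(1,2,5)])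
    also have "\<sigma> \<le> sn" unfolding \<sigma>[symmetric] sn_def pencil_spectral_norm_def pencil_frobenius_norm_def
      by (intro real_sqrt_le_mono add_mono power_mono spectral_norm_le_frobenius) auto
    finally show ?thesis by simp
  qed
  \<comment> \<open>The last summand only serves to make \<open>K\<close> positive, since \<open>\<rho>\<close> is known to be nonnegative only.\<close>
  define K where "K = \<mu> * \<rho> * K0 * sn\<^sup>2 / rn + 1"
  have K: "0 < K" unfolding K_def using \<mu> \<rho> K0 rn by (intro add_nonneg_pos divide_nonneg_pos mult_nonneg_nonneg) auto
  show ?thesis
  proof (rule exI[of _ \<tau>], rule conjI[OF \<tau>], rule exI[of _ K], rule conjI[OF K], intro allI impI)
    fix \<Delta> :: "'a poly mat" assume "pencil (dim_row S) (dim_col S) \<Delta> \<and> pencil_frobenius_norm \<Delta> < \<tau>"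
    then have \<Delta>: "pencil r c \<Delta>" and small: "pencil_frobenius_norm \<Delta> < \<tau>" using Sc by auto
    note \<Delta>c = pencil_carrier[OF \<Delta>]
    define \<delta> where "\<delta> = pencil_frobenius_norm \<Delta>"
    have \<delta>: "0 \<le> \<delta>" "\<delta> < \<tau>0" "\<delta> \<le> 1" "\<delta> * L < \<epsilon>0" "\<mu> * (\<delta> * L) < \<nu>"
      using small L \<mu> unfolding \<delta>_def \<tau>_def
      by (auto simp: pencil_frobenius_norm_eq field_simps)
    have co: "coeff_mat S k \<in> carrier_mat r c" "coeff_mat \<Delta> k \<in> carrier_mat r c" for k
      using Sc \<Delta>c coeff_mat_carrier(1)[of S k] coeff_mat_carrier(1)[of \<Delta> k] by auto
    obtain X Y T0 T1 where X: "X \<in> carrier_mat r r" "frobenius_norm X < 1" and Y: "Y \<in> carrier_mat c c" "frobenius_norm Y < 1"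
      and T: "T0 \<in> carrier_mat r c" "T1 \<in> carrier_mat r c" "kc.structured T0 T1"
      and eq: "(1\<^sub>m r + X) * (coeff_mat S 0 + coeff_mat \<Delta> 0) * (1\<^sub>m c + Y) = coeff_mat S 0 + T0"
        "(1\<^sub>m r + X) * (coeff_mat S 1 + coeff_mat \<Delta> 1) * (1\<^sub>m c + Y) = coeff_mat S 1 + T1"
      and nT: "pair_norm T0 T1 \<le> \<rho> * (\<delta> + K0 * \<delta>\<^sup>2)"
      using newton[OF co(2) co(2), of 0 1] \<delta>(2) unfolding \<delta>_def pencil_frobenius_norm_eq by metis
    define U V where "U = 1\<^sub>m r + X" and "V = 1\<^sub>m c + Y"
    have UV: "U \<in> carrier_mat r r" "V \<in> carrier_mat c c" "invertible_mat U" "invertible_mat V"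
      unfolding U_def V_def using X Y invertible_mat_one_plus[OF X] invertible_mat_one_plus[OF Y] by auto
    define S' where "S' = const_poly_mat U * (S + \<Delta>) * const_poly_mat V"
    note S\<Delta> = pencil_add[OF Sp \<Delta>]
    have S'p: "pencil r c S'" unfolding S'_def by (rule pencil_const_sandwich(1)[OF UV(1) S\<Delta> UV(2)])
    have S'co: "coeff_mat S' 0 = coeff_mat S 0 + T0" "coeff_mat S' 1 = coeff_mat S 1 + T1"
      unfolding S'_def pencil_const_sandwich(2)[OF UV(1) S\<Delta> UV(2)] coeff_mat_add[OF Sc \<Delta>c]
      unfolding U_def V_def by (rule eq)+
    define dA dB dC where "dA = kc.state_part T0" and "dB = kc.input_part T0" and "dC = kc.output_part T0"
    have dc: "dA \<in> carrier_mat l l" "dB \<in> carrier_mat l n" "dC \<in> carrier_mat m l"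
      unfolding dA_def dB_def dC_def by (rule kc.parts_carrier)+
    define A' B' C' where "A' = A + dA" and "B' = B + dB" and "C' = C + dC"
    have c': "A' \<in> carrier_mat l l" "B' \<in> carrier_mat l n" "C' \<in> carrier_mat m l"
      unfolding A'_def B'_def C'_def using A B C dc by auto
    have diff: "A' - A = dA" "B' - B = dB" "C' - C = dC"
      unfolding A'_def B'_def C'_def using A B C dc by (simp_all add: add_minus_cancel_mat)
    have coeffs': "kronecker_coefficients m n l \<epsilon> \<eta> A' B' C' (coeff_mat S' 0) (coeff_mat S' 1)"
      unfolding S'co A'_def B'_def C'_def dA_def dB_def dC_def by (rule kc.kronecker_coefficients_add[OF T(3)])
    define M' where "M' = blk kc.rs kc.cs 0 0 S'"
    note S'_form = pencil_eq_block_kronecker_pencil[OF S'p[unfolded r_def c_def] coeffs', folded M'_def]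
    define N0 N1 where "N0 = blk kc.rs kc.cs 0 0 T0" and "N1 = blk kc.rs kc.cs 0 0 T1"
    have Nc: "N0 \<in> carrier_mat ((\<eta> + 1) * m) ((\<epsilon> + 1) * n)" "N1 \<in> carrier_mat ((\<eta> + 1) * m) ((\<epsilon> + 1) * n)"
      unfolding N0_def N1_def using blk_carrier(1)[of kc.rs kc.cs 0 0] by (simp_all add: kc.p_def kc.q_def kd.p_def kd.q_def)
    have sums: "sum_list kc.rs = r" "sum_list kc.cs = c" by (simp_all add: r_def c_def kc.p_def kc.q_def kd.p_def kd.q_def)
    have M_blk: "blk kc.rs kc.cs 0 0 S = M" unfolding S using kd.blk_P[of 0 0] by (simp add: kd.part_def)
    have M'co: "coeff_mat M' 0 = coeff_mat M 0 + N0" "coeff_mat M' 1 = coeff_mat M 1 + N1"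
    proof -
      have blk: "coeff_mat (blk kc.rs kc.cs 0 0 P) k = blk kc.rs kc.cs 0 0 (coeff_mat P k)" if "P \<in> carrier_mat r c" for P :: "'a poly mat" and k
        using blk_coeff_mat[OF kc.sizes(1,2), of 0 0 P k] that unfolding sums by simp
      have "blk kc.rs kc.cs 0 0 (coeff_mat S k + T) = blk kc.rs kc.cs 0 0 (coeff_mat S k) + blk kc.rs kc.cs 0 0 T"
        if "T \<in> carrier_mat r c" for T k
        using blk_add[OF kc.sizes(1,2), of 0 0 "coeff_mat S k" T] co(1) that unfolding sums by simp
      then show "coeff_mat M' 0 = coeff_mat M 0 + N0" "coeff_mat M' 1 = coeff_mat M 1 + N1"
        unfolding M'_def blk[OF pencil_carrier[OF S'p]] S'co M_blk[symmetric] blk[OF Sc] N0_def N1_def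
        using T by simp_all
    qed
    define D' where "D' = antidiagonal_sums m n \<epsilon> \<eta> (coeff_mat M' 0) (coeff_mat M' 1)"
    have Mc: "coeff_mat M k \<in> carrier_mat ((\<eta> + 1) * m) ((\<epsilon> + 1) * n)" for k
      using pencil_carrier[OF M] coeff_mat_carrier(1)[of M k] by (metis carrier_matD)
    have dD: "D' k - D k = antidiagonal_sums m n \<epsilon> \<eta> N0 N1 k" if "k \<le> d" for k
    proof -
      have "D k = antidiagonal_sums m n \<epsilon> \<eta> (coeff_mat M 0) (coeff_mat M 1) k"
        by (rule antidiagonal_sums_unique[OF M _ MD[unfolded assms(4)] that[unfolded assms(4)]]) (simp add: D assms(4))
      then show ?thesis
        unfolding D'_def M'co by (simp only: antidiagonal_sums_minus[OF Mc Mc Nc])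
    qed
    have D'c: "D' k \<in> carrier_mat m n" for k by (simp add: D'_def antidiagonal_sums_def)
    have M'D': "matrix_poly m n d D' = (Lambda_mat \<eta> \<otimes>\<^sub>k 1\<^sub>m m)\<^sup>T * M' * (Lambda_mat \<epsilon> \<otimes>\<^sub>k 1\<^sub>m n)"
      unfolding D'_def assms(4) by (rule matrix_poly_antidiagonal_sums[OF S'_form(1)])
    define dR where "dR = (frobenius_norm dA)\<^sup>2 + (frobenius_norm dB)\<^sup>2 + (frobenius_norm dC)\<^sup>2"
    have parts: "dR + ((frobenius_norm N0)\<^sup>2 + (frobenius_norm N1)\<^sup>2) \<le> (pair_norm T0 T1)\<^sup>2"
      unfolding dR_def dA_def dB_def dC_def N0_def N1_def by (rule kc.parts_norm[OF T(3)])
    have dR0: "0 \<le> dR" by (simp add: dR_def)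
    have sumD: "(\<Sum>i\<le>d. (frobenius_norm (D' i - D i))\<^sup>2) \<le> \<mu>\<^sup>2 * ((frobenius_norm N0)\<^sup>2 + (frobenius_norm N1)\<^sup>2)"
      using antidiagonal_sums_norm[OF Nc] dD unfolding \<mu>(2) assms(4) by simp
    have "dR + (\<Sum>i\<le>d. (frobenius_norm (D' i - D i))\<^sup>2) \<le> \<mu>\<^sup>2 * (pair_norm T0 T1)\<^sup>2"
    proof -
      have "1 * dR \<le> \<mu>\<^sup>2 * dR" using \<mu> dR0 by (intro mult_right_mono one_le_power) auto
      then have "dR + (\<Sum>i\<le>d. (frobenius_norm (D' i - D i))\<^sup>2)
        \<le> \<mu>\<^sup>2 * (dR + ((frobenius_norm N0)\<^sup>2 + (frobenius_norm N1)\<^sup>2))"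
        using sumD by (simp add: distrib_left)
      also have "\<dots> \<le> \<mu>\<^sup>2 * (pair_norm T0 T1)\<^sup>2" using parts by (rule mult_left_mono) simp
      finally show ?thesis .
    qed
    then have total: "sqrt (dR + (\<Sum>i\<le>d. (frobenius_norm (D' i - D i))\<^sup>2)) \<le> \<mu> * pair_norm T0 T1"
      using \<mu> by (intro real_le_lsqrt) (auto simp: power_mult_distrib)
    have T_small: "pair_norm T0 T1 \<le> \<delta> * L"
    proof -
      have "\<delta>\<^sup>2 \<le> \<delta>" using \<delta> by (simp add: power2_eq_square mult_left_le)
      then have "\<rho> * (\<delta> + K0 * \<delta>\<^sup>2) \<le> \<rho> * (\<delta> + K0 * \<delta>)"
        using \<rho> K0 by (intro mult_left_mono add_left_mono) auto
      also have "\<dots> \<le> \<delta> * L" using \<delta> by (simp add: L_def algebra_simps)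
      finally show ?thesis using nT by simp
    qed
    have norm_small: "x < \<epsilon>0" if "x\<^sup>2 \<le> dR" "0 \<le> x" for x
    proof -
      have "0 \<le> (frobenius_norm N0)\<^sup>2 + (frobenius_norm N1)\<^sup>2" by simp
      then have "x\<^sup>2 \<le> (pair_norm T0 T1)\<^sup>2" using that(1) parts by linarith
      then have "x \<le> pair_norm T0 T1" by (rule power2_le_imp_le) simp
      then show ?thesis using T_small \<delta>(4) by simp
    qed
    have min': "minimal_triple A' B' C'"
      using stable[OF c'] norm_small unfolding diff dR_def by simp
    have "D' d \<noteq> 0\<^sub>m m n"
    proof
      assume z: "D' d = 0\<^sub>m m n"
      have "(frobenius_norm (D' d - D d))\<^sup>2 \<le> dR + (\<Sum>i\<le>d. (frobenius_norm (D' i - D i))\<^sup>2)"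
        using dR0 member_le_sum[of d "{..d}" "\<lambda>i. (frobenius_norm (D' i - D i))\<^sup>2"] by simp
      then have "frobenius_norm (D' d - D d) \<le> \<mu> * pair_norm T0 T1"
        using total real_le_rsqrt order_trans by blast
      also have "\<dots> \<le> \<mu> * (\<delta> * L)" using T_small \<mu> by (intro mult_left_mono) auto
      also have "\<dots> < \<nu>" by (rule \<delta>(5))
      finally have lt: "frobenius_norm (D' d - D d) < \<nu>" .
      show False
      proof -
        have "D d - 0\<^sub>m m n = D d" using D[of d] by (intro eq_matI) auto
        then show ?thesis
          using lt frobenius_norm_minus_commute[OF zero_carrier_mat D[OF order_refl]] unfolding z \<nu>_def by simp
      qed
    qed
    define R' where "R' = transfer_mat A' B' C' + map_mat to_fract (matrix_poly m n d D')"
    have rep': "minimal_representation m n l d R' A' B' C' D'"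
      unfolding minimal_representation_def using c' D'c \<open>D' d \<noteq> 0\<^sub>m m n\<close> min' R'_def by blast
    have lin': "block_kronecker_linearization m n l \<epsilon> \<eta> R' A' B' C' D' S'"
      unfolding block_kronecker_linearization_def assms(4)[symmetric]
      using rep' S'_form M'D' by blast
    have se: "strictly_equivalent (S + \<Delta>) S'"
      unfolding strictly_equivalent_def
      using UV S'_def pencil_carrier[OF S\<Delta>] by (intro exI[of _ U] exI[of _ V]) auto
    have "sqrt (dR + (\<Sum>i\<le>d. (frobenius_norm (D' i - D i))\<^sup>2)) \<le> \<mu> * (\<rho> * (\<delta> + K0 * \<delta>\<^sup>2))"
      by (rule order_trans[OF total mult_left_mono[OF nT]]) (use \<mu>(1) in linarith)
    also have "\<dots> \<le> \<mu> * \<kappa> * \<delta> + \<mu> * \<rho> * K0 * \<delta>\<^sup>2"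
    proof -
      have "\<mu> * (\<rho> * \<delta>) \<le> \<mu> * (\<kappa> * \<delta>)" using \<rho> \<mu> \<delta> by (intro mult_left_mono mult_right_mono) auto
      then show ?thesis by (simp add: algebra_simps)
    qed
    finally have "sqrt (dR + (\<Sum>i\<le>d. (frobenius_norm (D' i - D i))\<^sup>2)) / rn \<le> (\<mu> * \<kappa> * \<delta> + \<mu> * \<rho> * K0 * \<delta>\<^sup>2) / rn"
      using rn by (intro divide_right_mono) auto
    also have "\<dots> = K_SR l \<epsilon> \<eta> A B C D S * (\<delta> / sn) + (K - 1) * (\<delta> / sn)\<^sup>2"
      unfolding K_SR_def \<sigma> sn_def[symmetric] rn_def[symmetric] assms(4)[symmetric] \<mu>_def[symmetric] K_def \<kappa>_def
      using sn rn by (simp add: field_simps power2_eq_square)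
    also have "\<dots> \<le> K_SR l \<epsilon> \<eta> A B C D S * (\<delta> / sn) + K * (\<delta> / sn)\<^sup>2"
      by (intro add_left_mono mult_right_mono) auto
    finally have bound: "sqrt (dR + (\<Sum>i\<le>d. (frobenius_norm (D' i - D i))\<^sup>2)) / rn
      \<le> K_SR l \<epsilon> \<eta> A B C D S * (\<delta> / sn) + K * (\<delta> / sn)\<^sup>2" .
    show "\<exists>R' A' B' C' D' S'.
       minimal_representation m n l d R' A' B' C' D' \<and>
       block_kronecker_linearization m n l \<epsilon> \<eta> R' A' B' C' D' S' \<and>
       strictly_equivalent (S + \<Delta>) S' \<and>
       sqrt ((frobenius_norm (A' - A))\<^sup>2 + (frobenius_norm (B' - B))\<^sup>2 + (frobenius_norm (C' - C))\<^sup>2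
             + (\<Sum>i\<le>d. (frobenius_norm (D' i - D i))\<^sup>2))
         / representation_norm l d A B C D
       \<le> K_SR l \<epsilon> \<eta> A B C D S * (pencil_frobenius_norm \<Delta> / pencil_frobenius_norm S)
         + K * (pencil_frobenius_norm \<Delta> / pencil_frobenius_norm S)\<^sup>2"
      using rep' lin' se bound unfolding dR_def diff[symmetric] \<delta>_def sn_def rn_def by blast
  qed
qed

end
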